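(* Let $F=\mathbb{C}^7$. The group $GL(F)$ has exactly ten orbits $O_0,\dots,O_9$ on $\bigwedge^3F$, with the following representatives and dimensions: $O_0$: $0$, dimension $0$; $O_1$: $[123]$, dimension $13$; $O_2$: $[123]+[145]$, dimension $20$; $O_3$: $[123]+[145]+[167]$, dimension $21$; $O_4$: $[123]+[145]+[246]$, dimension $25$; $O_5$: $[123]+[456]$, dimension $26$; $O_6$: $[123]+[145]+[167]+[357]$, dimension $28$; $O_7$: $[123]+[456]+[147]$, dimension $31$; $O_8$: $[123]+[456]+[147]+[257]$, dimension $34$; $O_9$: $[123]+[456]+[147]+[257]+[367]$, dimension $35$. The inclusion order on the orbit closures is the partial order generated by the covering relations (where $i<j$ means $\overline{O_i}\subset\overline{O_j}$): $0<1$, $1<2$, $2<3$, $2<4$, $4<5$, $3<6$, $4<6$, $5<7$, $6<7$, $7<8$, $8<9$.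
   Context: Everything is over $\mathbb{C}$. $\bigwedge^3F$ is the degree-one part of the grading of the simple Lie algebra of type $E_7$ determined by the simple root $\alpha_2$ (Bourbaki numbering). Let $f_1,\dots,f_7$ be a basis of $F$; $[ijk]$ denotes $f_i\wedge f_j\wedge f_k$. *)

theory Defs
  imports "HOL-Analysis.Analysis"
begin

section \<open>The third exterior power\<close>

text \<open>
  In characteristic zero the third exterior power of \<open>F = \<complex>\<^sup>n\<close> is the space of
  antisymmetric tensors in \<open>F \<otimes> F \<otimes> F\<close>; a tensor is given by its coordinates
  \<open>T $ (i, j, k)\<close>. The theorems \<open>span_wedge\<close> and \<open>wedge_universal\<close> below are the
  universal property of the exterior power for this model.
\<close>

definition trivectors :: "(complex ^ ('n::finite \<times> 'n \<times> 'n)) set" where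
  "trivectors = {T. \<forall>i j k. T $ (j, i, k) = - T $ (i, j, k) \<and> T $ (i, k, j) = - T $ (i, j, k)}"

definition wedge ::
  "complex ^ 'n \<Rightarrow> complex ^ 'n \<Rightarrow> complex ^ 'n \<Rightarrow> complex ^ ('n::finite \<times> 'n \<times> 'n)" where
  "wedge u v w = vec_lambda (\<lambda>(i, j, k).
     det (vector [vector [u $ i, u $ j, u $ k],
                  vector [v $ i, v $ j, v $ k],
                  vector [w $ i, w $ j, w $ k]] :: complex ^ 3 ^ 3))"

definition act ::
  "complex ^ 'n ^ 'n \<Rightarrow> complex ^ ('n::finite \<times> 'n \<times> 'n) \<Rightarrow> complex ^ ('n \<times> 'n \<times> 'n)" where
  "act g T = vec_lambda (\<lambda>(a, b, c).
     \<Sum>i\<in>UNIV. \<Sum>j\<in>UNIV. \<Sum>k\<in>UNIV. g $ a $ i * g $ b $ j * g $ c $ k * T $ (i, j, k))"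

definition orbit :: "complex ^ ('n::finite \<times> 'n \<times> 'n) \<Rightarrow> (complex ^ ('n \<times> 'n \<times> 'n)) set" where
  "orbit T = {act g T | g. invertible g}"

lemma wedge_nth:
  "wedge u v w $ (i, j, k) =
     u $ i * v $ j * w $ k + u $ j * v $ k * w $ i + u $ k * v $ i * w $ j
     - u $ i * v $ k * w $ j - u $ j * v $ i * w $ k - u $ k * v $ j * w $ i"
  by (simp add: wedge_def det_3)

lemma act_nth:
  "act g T $ (a, b, c) =
     (\<Sum>i\<in>UNIV. \<Sum>j\<in>UNIV. \<Sum>k\<in>UNIV. g $ a $ i * g $ b $ j * g $ c $ k * T $ (i, j, k))"
  by (simp add: act_def)

lemma trivectorsD:
  assumes "T \<in> trivectors"
  shows "T $ (j, i, k) = - T $ (i, j, k)" "T $ (i, k, j) = - T $ (i, j, k)"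
  using assms unfolding trivectors_def by blast+

lemma subspace_trivectors: "vec.subspace trivectors"
  unfolding vec.subspace_def
proof (intro conjI ballI allI)
  show "0 \<in> trivectors" by (simp add: trivectors_def)
next
  fix x y :: "complex ^ ('a \<times> 'a \<times> 'a)"
  assume xy: "x \<in> trivectors" "y \<in> trivectors"
  have "(x + y) $ (j, i, k) = - (x + y) $ (i, j, k) \<and> (x + y) $ (i, k, j) = - (x + y) $ (i, j, k)"
    for i j k
    unfolding vector_add_component
      trivectorsD(1)[OF xy(1), of j i k] trivectorsD(1)[OF xy(2), of j i k]
      trivectorsD(2)[OF xy(1), of i k j] trivectorsD(2)[OF xy(2), of i k j]
    by simp
  then show "x + y \<in> trivectors" unfolding trivectors_def by blast
next
  fix c and x :: "complex ^ ('a \<times> 'a \<times> 'a)"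
  assume x: "x \<in> trivectors"
  have "(c *s x) $ (j, i, k) = - (c *s x) $ (i, j, k) \<and> (c *s x) $ (i, k, j) = - (c *s x) $ (i, j, k)"
    for i j k
    unfolding vector_smult_component trivectorsD(1)[OF x, of j i k] trivectorsD(2)[OF x, of i k j]
    by simp
  then show "c *s x \<in> trivectors" unfolding trivectors_def by blast
qed

lemma wedge_in_trivectors: "wedge u v w \<in> trivectors"
  by (simp add: trivectors_def wedge_nth mult_ac)

lemma wedge_same [simp]: "wedge u u v = 0" "wedge u v v = 0" "wedge u v u = 0"
  by (auto simp: vec_eq_iff wedge_nth)

lemma linear_act: "Vector_Spaces.linear (*s) (*s) (act g)"
proof (unfold_locales, goal_cases)
  case 1
  show ?case
    by (simp add: vec_eq_iff act_nth distrib_left sum.distrib)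
next
  case 2
  show ?case
    by (simp add: vec_eq_iff act_nth sum_distrib_left mult.left_commute)
qed

lemma act_wedge: "act g (wedge u v w) = wedge (g *v u) (g *v v) (g *v w)"
proof -
  have *: "(\<Sum>i\<in>UNIV. x i) * (\<Sum>j\<in>UNIV. y j) * (\<Sum>k\<in>UNIV. z k)
      = (\<Sum>i\<in>UNIV. \<Sum>j\<in>UNIV. \<Sum>k\<in>UNIV. x i * y j * z k)" for x y z :: "'n \<Rightarrow> complex"
    by (simp add: sum_distrib_left[symmetric] sum_distrib_right[symmetric])
  have A: "(\<Sum>i\<in>UNIV. p $ a $ i * x $ i) * (\<Sum>i\<in>UNIV. p $ b $ i * y $ i) * (\<Sum>i\<in>UNIV. p $ c $ i * z $ i)
    = (\<Sum>i\<in>UNIV. \<Sum>j\<in>UNIV. \<Sum>k\<in>UNIV. p $ a $ i * p $ b $ j * p $ c $ k * (x $ i * y $ j * z $ k))"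
    for p :: "complex ^ 'n ^ 'n" and x y z a b c
    unfolding * by (simp add: mult_ac)
  have "act g (wedge u v w) $ (a, b, c) = wedge (g *v u) (g *v v) (g *v w) $ (a, b, c)" for a b c
  proof -
    have perm: "(g *v x) $ r * (g *v y) $ s * (g *v z) $ t =
        (\<Sum>i\<in>UNIV. \<Sum>j\<in>UNIV. \<Sum>k\<in>UNIV. g $ r $ i * g $ s $ j * g $ t $ k * (x $ i * y $ j * z $ k))"
      for x y z r s t
      by (simp add: matrix_vector_mult_def A)
    have "wedge (g *v u) (g *v v) (g *v w) $ (a, b, c) =
        (g *v u) $ a * (g *v v) $ b * (g *v w) $ c + (g *v w) $ a * (g *v u) $ b * (g *v v) $ c
      + (g *v v) $ a * (g *v w) $ b * (g *v u) $ c - (g *v u) $ a * (g *v w) $ b * (g *v v) $ c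
      - (g *v v) $ a * (g *v u) $ b * (g *v w) $ c - (g *v w) $ a * (g *v v) $ b * (g *v u) $ c"
      by (simp add: wedge_nth mult_ac)
    also have "\<dots> = act g (wedge u v w) $ (a, b, c)"
      unfolding perm act_nth wedge_nth right_diff_distrib distrib_left sum.distrib sum_subtractf
      by (simp only: mult_ac)
    finally show ?thesis by simp
  qed
  then show ?thesis by (simp add: vec_eq_iff)
qed

lemma trivector_eq_sum:
  assumes "T \<in> trivectors"
  shows "T = (\<Sum>i\<in>UNIV. \<Sum>j\<in>UNIV. \<Sum>k\<in>UNIV.
           (T $ (i, j, k) / 6) *s wedge (axis i 1) (axis j 1) (axis k 1))"
proof -
  have s: "T $ (j, i, k) = - T $ (i, j, k)" "T $ (i, k, j) = - T $ (i, j, k)" for i j k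
    by (rule trivectorsD[OF assms])+
  have d1: "(\<Sum>k\<in>UNIV. f k * axis k 1 $ c) = f c" for f :: "'a \<Rightarrow> complex" and c
    by (simp add: axis_def if_distrib[of "\<lambda>x. _ * x"] cong: if_cong)
  have d: "(\<Sum>i\<in>UNIV. \<Sum>j\<in>UNIV. \<Sum>k\<in>UNIV. h i j k * (axis i 1 $ a * axis j 1 $ b * axis k 1 $ c)) = h a b c"
    for h :: "'a \<Rightarrow> 'a \<Rightarrow> 'a \<Rightarrow> complex" and a b c
    by (simp only: mult.assoc[symmetric] d1)
  have *: "T $ (a, b, c) = (\<Sum>i\<in>UNIV. \<Sum>j\<in>UNIV. \<Sum>k\<in>UNIV.
           (T $ (i, j, k) / 6) *s wedge (axis i 1) (axis j 1) (axis k 1)) $ (a, b, c)" for a b c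
  proof -
    let ?h = "\<lambda>i j k. T $ (i, j, k) / 6"
    let ?E = "\<lambda>i j k a b c. ?h i j k * (axis i 1 $ a * axis j 1 $ b * axis k 1 $ c)"
    have "(\<Sum>i\<in>UNIV. \<Sum>j\<in>UNIV. \<Sum>k\<in>UNIV.
           (T $ (i, j, k) / 6) *s wedge (axis i 1) (axis j 1) (axis k 1)) $ (a, b, c)
       = (\<Sum>i\<in>UNIV. \<Sum>j\<in>UNIV. \<Sum>k\<in>UNIV. ?E i j k a b c + ?E i j k b c a + ?E i j k c a b
            - ?E i j k a c b - ?E i j k b a c - ?E i j k c b a)"
      by (simp only: sum_component vector_smult_component wedge_nth right_diff_distrib distrib_left mult_ac)
    also have "\<dots> = ?h a b c + ?h b c a + ?h c a b - ?h a c b - ?h b a c - ?h c b a"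
      by (simp only: sum.distrib sum_subtractf d)
    also have "\<dots> = T $ (a, b, c)"
    proof -
      have "T $ (b, c, a) = T $ (a, b, c)" using s(1)[of a b c] s(2)[of b a c] by simp
      moreover have "T $ (c, a, b) = T $ (a, b, c)" using s(1)[of a c b] s(2)[of a b c] by simp
      moreover have "T $ (c, b, a) = - T $ (a, b, c)" using s(1)[of b c a] calculation(1) by simp
      ultimately show ?thesis using s(1)[of a b c] s(2)[of a b c] by (simp add: field_simps)
    qed
    finally show ?thesis by (rule sym)
  qed
  have "T $ p = (\<Sum>i\<in>UNIV. \<Sum>j\<in>UNIV. \<Sum>k\<in>UNIV.
           (T $ (i, j, k) / 6) *s wedge (axis i 1) (axis j 1) (axis k 1)) $ p" for p
    by (cases p rule: prod_cases3) (simp only:, rule *)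
  then show ?thesis by (rule iffD2[OF vec_eq_iff, OF allI])
qed

theorem span_wedge: "vec.span {wedge u v w | u v w. True} = trivectors"
proof
  show "vec.span {wedge u v w | u v w. True} \<subseteq> (trivectors :: (complex ^ ('n::finite \<times> 'n \<times> 'n)) set)"
    by (rule vec.span_minimal) (auto intro: wedge_in_trivectors subspace_trivectors)
  show "(trivectors :: (complex ^ ('n::finite \<times> 'n \<times> 'n)) set) \<subseteq> vec.span {wedge u v w | u v w. True}"
  proof
    fix T :: "complex ^ ('n::finite \<times> 'n \<times> 'n)"
    assume "T \<in> trivectors"
    have "(\<Sum>i\<in>UNIV. \<Sum>j\<in>UNIV. \<Sum>k\<in>UNIV. (T $ (i, j, k) / 6) *s
        wedge (axis i 1) (axis j 1) (axis k 1)) \<in> vec.span {wedge u v w | u v w. True}"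
      by (intro vec.span_sum vec.span_scale vec.span_base) blast
    with trivector_eq_sum[OF \<open>T \<in> trivectors\<close>]
    show "T \<in> vec.span {wedge u v w | u v w. True}"
      by (rule ssubst)
  qed
qed

theorem wedge_universal:
  fixes \<phi> :: "complex ^ 'n::finite \<Rightarrow> complex ^ 'n \<Rightarrow> complex ^ 'n \<Rightarrow> complex ^ 'm::finite"
  assumes lin: "\<And>v w. Vector_Spaces.linear (*s) (*s) (\<lambda>u. \<phi> u v w)"
               "\<And>u w. Vector_Spaces.linear (*s) (*s) (\<lambda>v. \<phi> u v w)"
               "\<And>u v. Vector_Spaces.linear (*s) (*s) (\<lambda>w. \<phi> u v w)"
    and alt: "\<And>u v. \<phi> u u v = 0" "\<And>u v. \<phi> u v v = 0"
  shows "\<exists>L. Vector_Spaces.linear (*s) (*s) L \<and> (\<forall>u v w. L (wedge u v w) = \<phi> u v w)"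
proof -
  define e :: "'n \<Rightarrow> complex ^ 'n" where "e i = axis i 1" for i
  define L where "L T = (\<Sum>i\<in>UNIV. \<Sum>j\<in>UNIV. \<Sum>k\<in>UNIV.
      (T $ (i, j, k) / 6) *s \<phi> (e i) (e j) (e k))" for T
  have "Vector_Spaces.linear (*s) (*s) L"
    by unfold_locales
      (auto simp: vec_eq_iff L_def sum.distrib sum_distrib_left algebra_simps add_divide_distrib)
  moreover have "L (wedge u v w) = \<phi> u v w" for u v w
  proof -
    have x: "x = (\<Sum>i\<in>UNIV. x $ i *s e i)" for x :: "complex ^ 'n"
      unfolding e_def by (simp add: basis_expansion)
    have ex: "\<phi> x y z = (\<Sum>i\<in>UNIV. \<Sum>j\<in>UNIV. \<Sum>k\<in>UNIV.
        (x $ i * y $ j * z $ k) *s \<phi> (e i) (e j) (e k))" for x y z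
    proof -
      have 1: "\<phi> x y z = (\<Sum>i\<in>UNIV. x $ i *s \<phi> (e i) y z)" for x y z
        by (subst x[of x]) (simp add: vec.linear_sum[OF lin(1)] vec.linear_scale[OF lin(1)])
      have 2: "\<phi> x y z = (\<Sum>i\<in>UNIV. y $ i *s \<phi> x (e i) z)" for x y z
        by (subst x[of y]) (simp add: vec.linear_sum[OF lin(2)] vec.linear_scale[OF lin(2)])
      have 3: "\<phi> x y z = (\<Sum>i\<in>UNIV. z $ i *s \<phi> x y (e i))" for x y z
        by (subst x[of z]) (simp add: vec.linear_sum[OF lin(3)] vec.linear_scale[OF lin(3)])
      have "\<phi> x y z = (\<Sum>i\<in>UNIV. x $ i *s (\<Sum>j\<in>UNIV. y $ j *s
          (\<Sum>k\<in>UNIV. z $ k *s \<phi> (e i) (e j) (e k))))"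
        by (subst 1, subst 2, subst 3) (rule refl)
      then show ?thesis
        by (simp only: vec.scale_sum_right vec.scale_scale mult.assoc)
    qed
    have s12: "\<phi> b a c = - \<phi> a b c" for a b c
    proof -
      have "0 = \<phi> (a + b) (a + b) c" by (simp add: alt)
      also have "\<dots> = \<phi> a b c + \<phi> b a c"
        unfolding vec.linear_add[OF lin(1)] vec.linear_add[OF lin(2)] by (simp add: alt)
      finally show ?thesis by (metis add.commute minus_unique)
    qed
    have s23: "\<phi> a c b = - \<phi> a b c" for a b c
    proof -
      have "0 = \<phi> a (b + c) (b + c)" by (simp add: alt)
      also have "\<dots> = \<phi> a b c + \<phi> a c b"
        unfolding vec.linear_add[OF lin(3)] vec.linear_add[OF lin(2)] by (simp add: alt)
      finally show ?thesis by (metis add.commute minus_unique)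
    qed
    let ?E = "\<lambda>x y z. (\<Sum>i\<in>UNIV. \<Sum>j\<in>UNIV. \<Sum>k\<in>UNIV.
        (x $ i * y $ j * z $ k) *s \<phi> (e i) (e j) (e k))"
    have six: "6 * (t / 6) = t" for t :: complex
      by simp
    have "6 *s L (wedge u v w) =
        ?E u v w + ?E w u v + ?E v w u - ?E u w v - ?E v u w - ?E w v u"
      unfolding L_def wedge_nth vec.scale_sum_right vec.scale_scale six
        vec.scale_left_distrib vec.scale_left_diff_distrib sum.distrib sum_subtractf
      by (simp only: mult_ac)
    also have "\<dots> = \<phi> u v w + \<phi> w u v + \<phi> v w u - \<phi> u w v - \<phi> v u w - \<phi> w v u"
      by (simp only: ex[symmetric])
    also have "\<dots> = 6 *s \<phi> u v w"
      using s12[of u v w] s23[of u v w] s12[of u w v] s23[of v u w] s12[of v w u]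
      by (simp add: vec_eq_iff)
    finally show ?thesis by (simp add: vec_eq_iff)
  qed
  ultimately show ?thesis by blast
qed


section \<open>Zariski topology and dimension\<close>

inductive polynomial_fun :: "(complex ^ 'm::finite \<Rightarrow> complex) \<Rightarrow> bool" where
  coord: "polynomial_fun (\<lambda>x. x $ i)"
| const: "polynomial_fun (\<lambda>x. c)"
| add: "polynomial_fun p \<Longrightarrow> polynomial_fun q \<Longrightarrow> polynomial_fun (\<lambda>x. p x + q x)"
| mult: "polynomial_fun p \<Longrightarrow> polynomial_fun q \<Longrightarrow> polynomial_fun (\<lambda>x. p x * q x)"

definition zero_locus :: "(complex ^ 'm::finite \<Rightarrow> complex) set \<Rightarrow> (complex ^ 'm) set" where
  "zero_locus P = {x. \<forall>p\<in>P. p x = 0}"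

lemma zero_locusI: "(\<And>p. p \<in> P \<Longrightarrow> p x = 0) \<Longrightarrow> x \<in> zero_locus P"
  by (simp add: zero_locus_def)

lemma zero_locusD: "x \<in> zero_locus P \<Longrightarrow> p \<in> P \<Longrightarrow> p x = 0"
  by (simp add: zero_locus_def)

definition zariski :: "(complex ^ 'm::finite) topology" where
  "zariski = topology (\<lambda>U. \<exists>P. (\<forall>p\<in>P. polynomial_fun p) \<and> - U = zero_locus P)"

lemma istopology_zariski:
  "istopology (\<lambda>U. \<exists>P. (\<forall>p\<in>P. polynomial_fun p) \<and> - U = zero_locus P)"
  (is "istopology ?Z")
  unfolding istopology_def
proof (intro conjI allI impI)
  fix S T assume "?Z S" "?Z T"
  then obtain P Q where P: "\<forall>p\<in>P. polynomial_fun p" "- S = zero_locus P"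
    and Q: "\<forall>p\<in>Q. polynomial_fun p" "- T = zero_locus Q" by blast
  define R where "R = {\<lambda>x. p x * q x | p q. p \<in> P \<and> q \<in> Q}"
  have R1: "\<forall>p\<in>R. polynomial_fun p"
  proof
    fix r assume "r \<in> R"
    then obtain p q where r: "r = (\<lambda>x. p x * q x)" and "p \<in> P" "q \<in> Q"
      unfolding R_def by blast
    with P(1) Q(1) have "polynomial_fun p" "polynomial_fun q" by blast+
    then show "polynomial_fun r" unfolding r by (rule polynomial_fun.mult)
  qed
  have R2: "zero_locus R = zero_locus P \<union> zero_locus Q"
  proof
    show "zero_locus R \<subseteq> zero_locus P \<union> zero_locus Q"
    proof
      fix x assume x: "x \<in> zero_locus R"
      have "p x = 0 \<or> q x = 0" if "p \<in> P" "q \<in> Q" for p q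
      proof -
        have "(\<lambda>x. p x * q x) \<in> R" using that unfolding R_def by blast
        from zero_locusD[OF x this] show ?thesis by simp
      qed
      then show "x \<in> zero_locus P \<union> zero_locus Q"
        unfolding zero_locus_def Un_iff mem_Collect_eq by metis
    qed
    show "zero_locus P \<union> zero_locus Q \<subseteq> zero_locus R"
    proof
      fix x assume x: "x \<in> zero_locus P \<union> zero_locus Q"
      have "r x = 0" if "r \<in> R" for r
      proof -
        obtain p q where r: "r = (\<lambda>x. p x * q x)" and pq: "p \<in> P" "q \<in> Q"
          using \<open>r \<in> R\<close> unfolding R_def by blast
        have "p x = 0 \<or> q x = 0"
          using x zero_locusD[of x P p] zero_locusD[of x Q q] pq by blast
        then show ?thesis unfolding r by (rule disjE) simp_all
      qed
      then show "x \<in> zero_locus R" by (rule zero_locusI)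
    qed
  qed
  have "- (S \<inter> T) = zero_locus R"
    by (simp only: Compl_Int P(2) Q(2) R2)
  with R1 show "?Z (S \<inter> T)" by (intro exI[of _ R] conjI)
next
  fix K assume K: "\<forall>S\<in>K. ?Z S"
  define P where "P S = (SOME P. (\<forall>p\<in>P. polynomial_fun p) \<and> - S = zero_locus P)"
    for S :: "(complex ^ 'a) set"
  have P: "\<forall>p\<in>P S. polynomial_fun p" "- S = zero_locus (P S)" if "S \<in> K" for S
    using someI_ex[OF bspec[OF K that]] unfolding P_def by (rule conjunct1 conjunct2)+
  have "- \<Union>K = (\<Inter>S\<in>K. - S)" by blast
  also have "\<dots> = (\<Inter>S\<in>K. zero_locus (P S))" by (intro INF_cong refl P(2))
  also have "\<dots> = zero_locus (\<Union>S\<in>K. P S)" unfolding zero_locus_def by blast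
  finally have "- \<Union>K = zero_locus (\<Union>S\<in>K. P S)" .
  moreover have "\<forall>p\<in>(\<Union>S\<in>K. P S). polynomial_fun p" using P(1) by blast
  ultimately show "?Z (\<Union>K)" by (intro exI[of _ "\<Union>S\<in>K. P S"] conjI)
qed

lemma closedin_zariski:
  fixes C :: "(complex ^ 'm::finite) set"
  shows "closedin zariski C \<longleftrightarrow> (\<exists>P. (\<forall>p\<in>P. polynomial_fun p) \<and> C = zero_locus P)"
proof -
  have o: "openin zariski U \<longleftrightarrow> (\<exists>P. (\<forall>p\<in>P. polynomial_fun p) \<and> - U = zero_locus P)"
    for U :: "(complex ^ 'm) set"
    by (simp add: zariski_def topology_inverse'[OF istopology_zariski])
  have "openin zariski (UNIV :: (complex ^ 'm) set)"
    unfolding o by (rule exI[of _ "{\<lambda>x. 1}"]) (auto simp: zero_locus_def polynomial_fun.const)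
  then have "topspace zariski = (UNIV :: (complex ^ 'm) set)"
    using openin_subset by blast
  then show ?thesis
    by (simp add: closedin_def o double_diff Compl_eq_Diff_UNIV)
qed

definition irreducible_space :: "'a topology \<Rightarrow> bool" where
  "irreducible_space X \<longleftrightarrow> topspace X \<noteq> {} \<and>
     (\<forall>A B. closedin X A \<and> closedin X B \<and> A \<union> B = topspace X \<longrightarrow>
        A = topspace X \<or> B = topspace X)"

definition krull_dim :: "'a topology \<Rightarrow> enat" where
  "krull_dim X = (SUP n \<in> {n. \<exists>Z :: nat \<Rightarrow> 'a set.
       (\<forall>i\<le>n. closedin X (Z i) \<and> irreducible_space (subtopology X (Z i))) \<and>
       (\<forall>i<n. Z i \<subset> Z (Suc i))}. enat n)"


section \<open>The ten orbits\<close>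

definition basis7 :: "(nat \<Rightarrow> complex ^ 7) \<Rightarrow> bool" where
  "basis7 f \<longleftrightarrow> inj_on f {1..7} \<and> vec.independent (f ` {1..7}) \<and> vec.span (f ` {1..7}) = UNIV"

definition representatives :: "(nat \<Rightarrow> complex ^ 7) \<Rightarrow> (complex ^ (7 \<times> 7 \<times> 7)) list" where
  "representatives f = (let w = (\<lambda>i j k. wedge (f i) (f j) (f k)) in
     [0,
      w 1 2 3,
      w 1 2 3 + w 1 4 5,
      w 1 2 3 + w 1 4 5 + w 1 6 7,
      w 1 2 3 + w 1 4 5 + w 2 4 6,
      w 1 2 3 + w 4 5 6,
      w 1 2 3 + w 1 4 5 + w 1 6 7 + w 3 5 7,
      w 1 2 3 + w 4 5 6 + w 1 4 7,
      w 1 2 3 + w 4 5 6 + w 1 4 7 + w 2 5 7,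
      w 1 2 3 + w 4 5 6 + w 1 4 7 + w 2 5 7 + w 3 6 7])"

definition orbit_no :: "(nat \<Rightarrow> complex ^ 7) \<Rightarrow> nat \<Rightarrow> (complex ^ (7 \<times> 7 \<times> 7)) set" where
  "orbit_no f i = orbit (representatives f ! i)"

definition orbit_closure :: "(nat \<Rightarrow> complex ^ 7) \<Rightarrow> nat \<Rightarrow> (complex ^ (7 \<times> 7 \<times> 7)) set" where
  "orbit_closure f i = subtopology zariski trivectors closure_of orbit_no f i"

end

theory Submission
  imports Defs
begin

text \<open>
  \<^bold>\<open>Classification.\<close> The normal forms are found modulo a line. For a nonzero trivector \<open>T\<close> choose a
  basis in which \<open>[123]\<close> has coefficient 1. Shearing \<open>f\<^sub>1, f\<^sub>2, f\<^sub>3\<close> along \<open>f\<^sub>4, f\<^sub>5, f\<^sub>6\<close> absorbs the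
  monomials with two indices among 1, 2, 3, so that modulo multiples of \<open>f\<^sub>7\<close> only \<open>[123]\<close>, a
  \<open>3 \<times> 3\<close> matrix \<open>M\<close> of coefficients and a multiple of \<open>[456]\<close> are left. Row and column operations
  diagonalise \<open>M\<close>. If \<open>M\<close> is invertible, a quadratic equation decides between \<open>[123] + [456]\<close> (distinct
  roots) and its tangent form \<open>[123] + [145] + [246]\<close> (a double root); lower ranks give one of these two
  forms, \<open>[123] + [145]\<close> or \<open>[123]\<close> (\<open>nf6_classify\<close>, \<open>nonzero_rep_mod\<close>). It remains to put back the multiple \<open>f\<^sub>7 \<and> \<omega>\<close>. For
  \<open>[123] + [456]\<close> it is again a \<open>3 \<times> 3\<close> matrix up to row and column operations, and its rank
  separates \<open>O\<^sub>5, O\<^sub>7, O\<^sub>8, O\<^sub>9\<close> (\<open>rep_mod_5\<close>). For the three smaller forms there is an alternative: either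
  \<open>\<omega>\<close> is so special that \<open>T\<close> is a representative of \<open>O\<^sub>1, O\<^sub>2, O\<^sub>3, O\<^sub>4\<close> or \<open>O\<^sub>6\<close>, or another line in the
  place of \<open>\<langle>f\<^sub>7\<rangle>\<close> leads to a larger form (\<open>rep_mod_1\<close>, \<open>rep_mod_2\<close>, \<open>rep_mod_4\<close>).

  \<^bold>\<open>Dimensions.\<close> Krull dimension is compared with numbers of algebraically independent functions. These
  numbers grow along a strict chain of irreducible closed sets (\<open>alg_indep_on_extend\<close>), and a set in the
  closure of the image of a polynomial map of \<open>d\<close> variables has at most \<open>d\<close> of them
  (\<open>algebraically_dependent\<close>). The upper bound for an orbit comes from a Kempf collapsing
  (\<open>orbit_subset_kempf\<close>). For the lower bound, the orbit map is restricted to a slice through the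
  identity on which its differential is triangular, hence dominant onto a coordinate space; the
  coordinate subspaces of the slice yield the chain (\<open>krull_dim_ge\<close>, \<open>orbit_dim_ge\<close>).

  \<^bold>\<open>Closures.\<close> Each covering relation is realised by a curve. Conversely, an inclusion of closures forces
  an inequality of dimensions, and the ten dimensions increase strictly. So the orbits are distinct and
  the only pairs \<open>i < j\<close> left to exclude are (3,4), (3,5) and (5,6). The contraction \<open>\<xi> \<mapsto> \<iota>\<^sub>\<xi> T\<close> is
  injective for \<open>O\<^sub>3\<close> but not for \<open>O\<^sub>5\<close>, which excludes (3,5) and, as \<open>O\<^sub>4\<close> lies in the closure of \<open>O\<^sub>5\<close>, also
  (3,4). The map \<open>\<xi> \<mapsto> \<iota>\<^sub>\<xi> T \<and> T\<close> has a one-dimensional kernel for \<open>O\<^sub>5\<close> and a larger one for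
  \<open>O\<^sub>6\<close>, which excludes (5,6).
\<close>

section \<open>Polynomial functions and their monomials\<close>

text \<open>
  Here the number of variables is a term and not a type as in \<open>polynomial_fun\<close>, so that induction on it
  is possible.
\<close>

inductive_set pfun :: "'i set \<Rightarrow> (('i \<Rightarrow> complex) \<Rightarrow> complex) set" for I :: "'i set" where
  var: "i \<in> I \<Longrightarrow> (\<lambda>x. x i) \<in> pfun I"
| const: "(\<lambda>x. c) \<in> pfun I"
| add: "p \<in> pfun I \<Longrightarrow> q \<in> pfun I \<Longrightarrow> (\<lambda>x. p x + q x) \<in> pfun I"
| mult: "p \<in> pfun I \<Longrightarrow> q \<in> pfun I \<Longrightarrow> (\<lambda>x. p x * q x) \<in> pfun I"

lemma pfun_sum: "(\<And>a. a \<in> A \<Longrightarrow> p a \<in> pfun I) \<Longrightarrow> (\<lambda>x. \<Sum>a\<in>A. p a x) \<in> pfun I"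
  by (induction A rule: infinite_finite_induct) (auto intro: pfun.intros)

lemma pfun_prod: "(\<And>a. a \<in> A \<Longrightarrow> p a \<in> pfun I) \<Longrightarrow> (\<lambda>x. \<Prod>a\<in>A. p a x) \<in> pfun I"
  by (induction A rule: infinite_finite_induct) (auto intro: pfun.intros)

lemma pfun_power: "p \<in> pfun I \<Longrightarrow> (\<lambda>x. p x ^ n) \<in> pfun I"
  by (induction n) (auto intro: pfun.intros)

lemma pfun_cmult: "p \<in> pfun I \<Longrightarrow> (\<lambda>x. c * p x) \<in> pfun I"
  by (intro pfun.mult pfun.const)

lemma pfun_cong: "p \<in> pfun I \<Longrightarrow> (\<And>i. i \<in> I \<Longrightarrow> x i = y i) \<Longrightarrow> p x = p y"
  by (induction rule: pfun.induct) auto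

lemma pfun_compose:
  "p \<in> pfun I \<Longrightarrow> (\<And>i. i \<in> I \<Longrightarrow> g i \<in> pfun J) \<Longrightarrow> (\<lambda>x. p (\<lambda>i. g i x)) \<in> pfun J"
  by (induction rule: pfun.induct) (auto intro: pfun.intros)

lemma polynomial_fun_param:
  "polynomial_fun p \<Longrightarrow> (\<And>i. (\<lambda>y. G y $ i) \<in> pfun J) \<Longrightarrow> (\<lambda>y. p (G y)) \<in> pfun J"
  by (induction rule: polynomial_fun.induct) (auto intro: pfun.intros)

lemma polynomial_fun_pfun:
  "F \<in> pfun I \<Longrightarrow> (\<And>i. i \<in> I \<Longrightarrow> polynomial_fun (p i)) \<Longrightarrow> polynomial_fun (\<lambda>v. F (\<lambda>i. p i v))"
  by (induction rule: pfun.induct) (auto intro: polynomial_fun.intros)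

lemma pfun_tendsto:
  assumes "p \<in> pfun I" "\<And>i. i \<in> I \<Longrightarrow> ((\<lambda>t. \<gamma> t i) \<longlongrightarrow> x i) F"
  shows "((\<lambda>t. p (\<gamma> t)) \<longlongrightarrow> p x) F"
  using assms by (induction rule: pfun.induct) (auto intro: tendsto_intros)

text \<open>
  Along a line a polynomial function is a univariate polynomial, and those have no zero divisors.
\<close>

lemma pfun_line:
  assumes "p \<in> pfun I"
  shows "\<exists>P. \<forall>t. p (\<lambda>i. x i + t * d i) = poly P t"
  using assms
proof (induction rule: pfun.induct)
  case (var i)
  show ?case by (rule exI[of _ "[:x i, d i:]"]) simp
next
  case (const c)
  show ?case by (rule exI[of _ "[:c:]"]) simp
next
  case (add p q)
  then show ?case by (metis poly_add)
next
  case (mult p q)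
  then show ?case by (metis poly_mult)
qed

lemma pfun_mult_eq_0:
  assumes p: "p \<in> pfun I" and q: "q \<in> pfun I" and 0: "\<And>x. p x * q x = 0"
  shows "(\<forall>x. p x = 0) \<or> (\<forall>x. q x = 0)"
proof (rule ccontr)
  assume "\<not> ?thesis"
  then obtain x y where xy: "p x \<noteq> 0" "q y \<noteq> 0" by blast
  obtain P where P: "\<And>t. p (\<lambda>i. x i + t * (y i - x i)) = poly P t"
    using pfun_line[OF p, of x "\<lambda>i. y i - x i"] by blast
  obtain Q where Q: "\<And>t. q (\<lambda>i. x i + t * (y i - x i)) = poly Q t"
    using pfun_line[OF q, of x "\<lambda>i. y i - x i"] by blast
  have "poly (P * Q) t = 0" for t using 0 P[of t] Q[of t] by (metis poly_mult)
  then have "P * Q = 0" using poly_all_0_iff_0 by blast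
  moreover have "poly P 0 \<noteq> 0" using P[of 0] xy by simp
  moreover have "poly Q 1 \<noteq> 0" using Q[of 1] xy by simp
  ultimately show False by auto
qed

text \<open>
  A monomial is a coefficient with a list of variables; the length of the list is the degree. Bounding
  the degree of some presentation suffices, so a normal form of polynomials is avoided.
\<close>

definition term_val :: "('i \<Rightarrow> complex) \<Rightarrow> complex \<times> 'i list \<Rightarrow> complex" where
  "term_val x m = fst m * prod_list (map x (snd m))"

definition deg_le :: "'i set \<Rightarrow> nat \<Rightarrow> (('i \<Rightarrow> complex) \<Rightarrow> complex) \<Rightarrow> bool" where
  "deg_le I n p \<longleftrightarrow> (\<exists>ms. (\<forall>m \<in> set ms. set (snd m) \<subseteq> I \<and> length (snd m) \<le> n) \<and>
     (\<forall>x. p x = sum_list (map (term_val x) ms)))"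

lemma deg_leE:
  assumes "deg_le I n p"
  obtains ms where "\<forall>m \<in> set ms. set (snd m) \<subseteq> I \<and> length (snd m) \<le> n"
    "\<forall>x. p x = sum_list (map (term_val x) ms)"
  using assms unfolding deg_le_def by (elim exE conjE) (rule that)

lemma deg_le_mono: "deg_le I n p \<Longrightarrow> n \<le> m \<Longrightarrow> deg_le I m p"
  unfolding deg_le_def by (meson le_trans)

lemma deg_le_const: "deg_le I n (\<lambda>x. c)"
  unfolding deg_le_def by (rule exI[of _ "[(c, [])]"]) (simp add: term_val_def)

lemma deg_le_var: "i \<in> I \<Longrightarrow> deg_le I 1 (\<lambda>x. x i)"
  unfolding deg_le_def by (rule exI[of _ "[(1, [i])]"]) (simp add: term_val_def)

lemma deg_le_add:
  assumes "deg_le I n p" "deg_le I n q" shows "deg_le I n (\<lambda>x. p x + q x)"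
proof -
  obtain cs where c: "\<forall>m \<in> set cs. set (snd m) \<subseteq> I \<and> length (snd m) \<le> n"
      and p0: "\<forall>x. p x = sum_list (map (term_val x) cs)"
    using assms(1) by (rule deg_leE)
  note p = p0[rule_format]
  obtain ds where d: "\<forall>m \<in> set ds. set (snd m) \<subseteq> I \<and> length (snd m) \<le> n"
      and q0: "\<forall>x. q x = sum_list (map (term_val x) ds)"
    using assms(2) by (rule deg_leE)
  note q = q0[rule_format]
  from c d have "\<forall>m \<in> set (cs @ ds). set (snd m) \<subseteq> I \<and> length (snd m) \<le> n"
    unfolding set_append by blast
  moreover have "p x + q x = sum_list (map (term_val x) (cs @ ds))" for x
    unfolding p q by simp
  ultimately show ?thesis unfolding deg_le_def by (intro exI[of _ "cs @ ds"]) simp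
qed

lemma deg_le_mult:
  assumes "deg_le I n p" "deg_le I m q" shows "deg_le I (n + m) (\<lambda>x. p x * q x)"
proof -
  obtain cs where c: "\<forall>m \<in> set cs. set (snd m) \<subseteq> I \<and> length (snd m) \<le> n"
      and p0: "\<forall>x. p x = sum_list (map (term_val x) cs)"
    using assms(1) by (rule deg_leE)
  note p = p0[rule_format]
  obtain ds where d: "\<forall>k \<in> set ds. set (snd k) \<subseteq> I \<and> length (snd k) \<le> m"
      and q0: "\<forall>x. q x = sum_list (map (term_val x) ds)"
    using assms(2) by (rule deg_leE)
  note q = q0[rule_format]
  define tm where "tm k l = (fst k * fst l, snd k @ snd l)" for k l :: "complex \<times> 'a list"
  define es where "es = concat (map (\<lambda>k. map (tm k) ds) cs)"
  have 1: "term_val x (tm k l) = term_val x k * term_val x l" for x k l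
    by (simp add: term_val_def tm_def)
  have 2: "sum_list (map (term_val x) (map (tm k) ds)) = term_val x k * sum_list (map (term_val x) ds)" for x k
    by (induction ds) (simp_all add: 1 distrib_left)
  have "sum_list (map (term_val x) es) = p x * q x" for x
    unfolding es_def p q by (induction cs) (simp_all only: concat.simps list.map map_append sum_list_append 2
       sum_list.Cons sum_list.Nil distrib_right mult_zero_left)
  moreover have "\<forall>k \<in> set es. set (snd k) \<subseteq> I \<and> length (snd k) \<le> n + m"
    using c d unfolding es_def by (fastforce intro: add_mono simp: tm_def)
  ultimately show ?thesis unfolding deg_le_def by (intro exI[of _ es]) simp
qed

lemma deg_le_power: "deg_le I n p \<Longrightarrow> deg_le I (m * n) (\<lambda>x. p x ^ m)"
  by (induction m) (auto simp: deg_le_const intro: deg_le_mult)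

lemma deg_le_prod:
  "finite A \<Longrightarrow> (\<And>a. a \<in> A \<Longrightarrow> deg_le I n (p a)) \<Longrightarrow> deg_le I (card A * n) (\<lambda>x. \<Prod>a\<in>A. p a x)"
  by (induction A rule: finite_induct) (auto simp: deg_le_const intro: deg_le_mult)

lemma pfun_deg_le: "p \<in> pfun I \<Longrightarrow> \<exists>n. deg_le I n p"
proof (induction rule: pfun.induct)
  case (add p q)
  then obtain n m where "deg_le I n p" "deg_le I m q" by (elim exE) (rule that)
  then have "deg_le I (max n m) p" "deg_le I (max n m) q" by (auto intro: deg_le_mono)
  then show ?case by (blast intro: deg_le_add)
next
  case (mult p q)
  then obtain n m where "deg_le I n p" "deg_le I m q" by (elim exE) (rule that)
  then show ?case by (blast intro: deg_le_mult)
qed (blast intro: deg_le_const deg_le_var)+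

lemma pfun_monomials:
  assumes "p \<in> pfun I"
  obtains ms where "\<forall>m \<in> set ms. set (snd m) \<subseteq> I" "\<forall>x. p x = sum_list (map (term_val x) ms)"
proof -
  obtain n where "deg_le I n p" using pfun_deg_le[OF assms] by (elim exE) (rule that)
  then obtain ms where "\<forall>m \<in> set ms. set (snd m) \<subseteq> I \<and> length (snd m) \<le> n"
      and p: "\<forall>x. p x = sum_list (map (term_val x) ms)" by (rule deg_leE)
  then have "\<forall>m \<in> set ms. set (snd m) \<subseteq> I" by simp
  then show thesis using p by (rule that)
qed

lemma pfun_prod_list: "set is \<subseteq> I \<Longrightarrow> (\<lambda>x. prod_list (map x is)) \<in> pfun I"
  by (induction "is") (auto intro: pfun.intros)

lemma pfun_term_val: "set (snd m) \<subseteq> I \<Longrightarrow> (\<lambda>x. term_val x m) \<in> pfun I"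
  unfolding term_val_def by (intro pfun_cmult pfun_prod_list)

lemma pfun_homogeneous_parts:
  assumes "p \<in> pfun I"
  shows "\<exists>N q. (\<forall>n. q n \<in> pfun I) \<and> (\<forall>n t x. q n (\<lambda>i. t * x i) = t ^ n * q n x) \<and>
     (\<forall>M\<ge>N. \<forall>x. p x = (\<Sum>n\<le>M. q n x))"
proof -
  obtain ms where I: "\<forall>m \<in> set ms. set (snd m) \<subseteq> I"
    and p0: "\<forall>x. p x = sum_list (map (term_val x) ms)"
    using assms by (rule pfun_monomials)
  note p = p0[rule_format]
  have "\<exists>N q. (\<forall>n. q n \<in> pfun I) \<and> (\<forall>n t x. q n (\<lambda>i. t * x i) = t ^ n * q n x) \<and>
     (\<forall>M\<ge>N. \<forall>x. sum_list (map (term_val x) ms) = (\<Sum>n\<le>M. q n x))"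
    using I
  proof (induction ms)
    case Nil
    show ?case by (intro exI[of _ 0] exI[of _ "\<lambda>n x. 0"]) (auto intro: pfun.intros)
  next
    case (Cons m ms)
    have "\<forall>m \<in> set ms. set (snd m) \<subseteq> I" using Cons.prems by simp
    from Cons.IH[OF this] obtain N q where q: "\<forall>n. q n \<in> pfun I"
      "\<forall>n t x. q n (\<lambda>i. t * x i) = t ^ n * q n x"
      "\<forall>M\<ge>N. \<forall>x. sum_list (map (term_val x) ms) = (\<Sum>n\<le>M. q n x)"
      by (elim exE conjE) (rule that)
    define d where "d = length (snd m)"
    define q' where "q' n = (\<lambda>x. q n x + (if n = d then term_val x m else 0))" for n
    have A: "q' n \<in> pfun I" for n
    proof (cases "n = d")
      case True
      have "set (snd m) \<subseteq> I" using Cons.prems by simp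
      then have "(\<lambda>x. q n x + term_val x m) \<in> pfun I"
        by (intro pfun.add pfun_term_val q(1)[rule_format])
      then show ?thesis using True by (simp add: q'_def)
    next
      case False
      then show ?thesis using q(1)[rule_format, of n] by (simp add: q'_def)
    qed
    have "prod_list (map (\<lambda>i. t * x i) js) = t ^ length js * prod_list (map x js)"
      for t and x :: "'a \<Rightarrow> complex" and js by (induction js) (simp_all add: mult_ac)
    then have "term_val (\<lambda>i. t * x i) m = t ^ d * term_val x m" for t x
      by (simp add: term_val_def d_def)
    then have B: "q' n (\<lambda>i. t * x i) = t ^ n * q' n x" for n t x
      using q(2) by (simp add: q'_def algebra_simps)
    have C: "sum_list (map (term_val x) (m # ms)) = (\<Sum>n\<le>M. q' n x)"
      if "M \<ge> max N d" for M x
      using that q(3) by (simp add: q'_def sum.distrib)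
    show ?case by (intro exI[of _ "max N d"] exI[of _ q'] conjI allI impI A B C)
  qed
  then show ?thesis using p by simp
qed

text \<open>
  Separating the last variable serves to find the lowest power of a new function in an algebraic relation.
\<close>

lemma pfun_Suc_expand:
  assumes "p \<in> pfun {..<Suc k}"
  shows "\<exists>N q. (\<forall>n. q n \<in> pfun {..<k}) \<and> (\<forall>M\<ge>N. \<forall>x. p x = (\<Sum>n\<le>M. x k ^ n * q n x))"
proof -
  obtain ms where I: "\<forall>m \<in> set ms. set (snd m) \<subseteq> {..<Suc k}"
    and p0: "\<forall>x. p x = sum_list (map (term_val x) ms)"
    using assms by (rule pfun_monomials)
  note p = p0[rule_format]
  have "\<exists>N q. (\<forall>n. q n \<in> pfun {..<k}) \<and>
     (\<forall>M\<ge>N. \<forall>x. sum_list (map (term_val x) ms) = (\<Sum>n\<le>M. x k ^ n * q n x))"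
    using I
  proof (induction ms)
    case Nil
    show ?case by (intro exI[of _ 0] exI[of _ "\<lambda>n x. 0"]) (auto intro: pfun.intros)
  next
    case (Cons m ms)
    have "\<forall>m \<in> set ms. set (snd m) \<subseteq> {..<Suc k}" using Cons.prems by simp
    from Cons.IH[OF this] obtain N q where q: "\<forall>n. q n \<in> pfun {..<k}"
      "\<forall>M\<ge>N. \<forall>x. sum_list (map (term_val x) ms) = (\<Sum>n\<le>M. x k ^ n * q n x)"
      by (elim exE conjE) (rule that)
    define m' where "m' = (fst m, filter (\<lambda>i. i \<noteq> k) (snd m))"
    define d where "d = length (filter (\<lambda>i. i = k) (snd m))"
    define q' where "q' n = (\<lambda>x. q n x + (if n = d then term_val x m' else 0))" for n
    have "set (snd m') \<subseteq> {..<k}" using Cons.prems by (auto simp: m'_def less_Suc_eq)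
    have A: "q' n \<in> pfun {..<k}" for n
    proof (cases "n = d")
      case True
      have "set (snd m') \<subseteq> {..<k}" using \<open>set (snd m') \<subseteq> {..<k}\<close> .
      then have "(\<lambda>x. q n x + term_val x m') \<in> pfun {..<k}"
        by (intro pfun.add pfun_term_val q(1)[rule_format])
      then show ?thesis using True by (simp add: q'_def)
    next
      case False
      then show ?thesis using q(1)[rule_format, of n] by (simp add: q'_def)
    qed
    have E: "prod_list (map x js) = x k ^ length (filter (\<lambda>i. i = k) js) * prod_list (map x (filter (\<lambda>i. i \<noteq> k) js))"
      for x :: "nat \<Rightarrow> complex" and js by (induction js) (simp_all add: mult_ac)
    have js: "term_val x m = x k ^ d * term_val x m'" for x
      unfolding term_val_def d_def m'_def fst_conv snd_conv by (subst E) (rule mult.left_commute)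
    have C: "sum_list (map (term_val x) (m # ms)) = (\<Sum>n\<le>M. x k ^ n * q' n x)"
      if "M \<ge> max N d" for M x
    proof -
      have "(\<Sum>n\<le>M. x k ^ n * q' n x)
          = (\<Sum>n\<le>M. x k ^ n * q n x) + (\<Sum>n\<le>M. if n = d then x k ^ n * term_val x m' else 0)"
        unfolding sum.distrib[symmetric] q'_def by (intro sum.cong) (auto simp: algebra_simps)
      also have "(\<Sum>n\<le>M. if n = d then x k ^ n * term_val x m' else 0) = x k ^ d * term_val x m'"
        using that by (subst sum.delta) auto
      finally show ?thesis using that q(2) by (simp add: js)
    qed
    show ?case by (intro exI[of _ "max N d"] exI[of _ q'] conjI allI impI A C)
  qed
  then show ?thesis using p by simp
qed

section \<open>Algebraic independence\<close>

text \<open>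
  Solving one equation for one unknown reduces both numbers by one.
\<close>

lemma underdetermined_system:
  fixes C :: "'b \<Rightarrow> 'a \<Rightarrow> complex"
  assumes "finite A" "finite B" "card A < card B"
  shows "\<exists>c. (\<exists>b\<in>B. c b \<noteq> 0) \<and> (\<forall>a\<in>A. (\<Sum>b\<in>B. c b * C b a) = 0)"
  using assms
proof (induction A arbitrary: B C rule: finite_induct)
  case empty
  then have "B \<noteq> {}" by auto
  then show ?case by (intro exI[of _ "\<lambda>_. 1"]) auto
next
  case (insert a A)
  show ?case
  proof (cases "\<forall>b\<in>B. C b a = 0")
    case True
    have "card A < card B" using insert by simp
    then obtain c where "(\<exists>b\<in>B. c b \<noteq> 0)" "(\<forall>a\<in>A. (\<Sum>b\<in>B. c b * C b a) = 0)"
      using insert.IH[OF insert.prems(1)] by blast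
    then show ?thesis using True by (intro exI[of _ c]) auto
  next
    case False
    then obtain b0 where b0: "b0 \<in> B" "C b0 a \<noteq> 0" by blast
    define C' where "C' b a' = C b a' - C b a / C b0 a * C b0 a'" for b a'
    have "card A < card (B - {b0})" using insert b0 by simp
    then obtain c where c: "\<exists>b\<in>B - {b0}. c b \<noteq> 0"
      "\<forall>a'\<in>A. (\<Sum>b\<in>B - {b0}. c b * C' b a') = 0"
      using insert.IH[of "B - {b0}" C'] insert.prems(1) by blast
    define s where "s = (\<Sum>b\<in>B - {b0}. c b * C b a)"
    define d where "d = c(b0 := - s / C b0 a)"
    have split: "(\<Sum>b\<in>B. d b * C b a') = - s / C b0 a * C b0 a' + (\<Sum>b\<in>B - {b0}. c b * C b a')" for a'
      using insert.prems(1) b0(1) by (subst sum.remove[of _ b0]) (auto simp: d_def intro!: sum.cong)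
    have "(\<Sum>b\<in>B. d b * C b a') = 0" if "a' \<in> A" for a'
    proof -
      have "(\<Sum>b\<in>B - {b0}. c b * C' b a') = (\<Sum>b\<in>B - {b0}. c b * C b a') - s / C b0 a * C b0 a'"
        unfolding s_def C'_def by (simp add: sum_subtractf algebra_simps sum_divide_distrib sum_distrib_left)
      then show ?thesis using c(2) that split by simp
    qed
    moreover have "(\<Sum>b\<in>B. d b * C b a) = 0" unfolding split using b0 by (simp add: s_def)
    moreover have "\<exists>b\<in>B. d b \<noteq> 0" using c(1) by (auto simp: d_def)
    ultimately show ?thesis by (intro exI[of _ d]) auto
  qed
qed

text \<open>
  Exponent vectors with \<open>k\<close> entries below \<open>b\<close> are encoded by the numbers below \<open>b ^ k\<close> through their base \<open>b\<close>
  digits. The substitution \<open>x\<^sub>i = t\<close> to the power \<open>b ^ i\<close> turns the monomial with code \<open>N\<close> into \<open>t ^ N\<close>, which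
  makes distinct monomials linearly independent (\<open>digit_monomials_independent\<close>).
\<close>

lemma sum_digits_less:
  fixes b :: nat
  assumes "\<And>i. i < k \<Longrightarrow> e i < b"
  shows "(\<Sum>i<k. e i * b ^ i) < b ^ k"
  using assms
proof (induction k)
  case (Suc k)
  then have "(\<Sum>i<k. e i * b ^ i) < b ^ k" by simp
  moreover have "Suc (e k) * b ^ k \<le> b * b ^ k" using Suc.prems[of k] by (intro mult_right_mono) auto
  ultimately show ?case by simp
qed simp

lemma digit_add_high:
  fixes b :: nat
  assumes "j < k" "b > 0"
  shows "(r + q * b ^ k) div b ^ j mod b = r div b ^ j mod b"
proof -
  have "b ^ k = b ^ Suc (k - Suc j + j)" using assms by simp
  also have "\<dots> = b ^ (k - Suc j) * b * b ^ j" by (simp add: power_add)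
  finally have "r + q * b ^ k = r + (q * b ^ (k - Suc j) * b) * b ^ j" by simp
  then have "(r + q * b ^ k) div b ^ j = q * b ^ (k - Suc j) * b + r div b ^ j"
    using assms by (metis div_mult_self1 less_numeral_extra(3) zero_less_power)
  then show ?thesis by simp
qed

lemma digit_sum_digits:
  fixes b :: nat
  assumes "\<And>i. i < k \<Longrightarrow> e i < b" "j < k"
  shows "(\<Sum>i<k. e i * b ^ i) div b ^ j mod b = e j"
  using assms
proof (induction k)
  case (Suc k)
  have lt: "(\<Sum>i<k. e i * b ^ i) < b ^ k" using Suc.prems by (intro sum_digits_less) auto
  have b: "b > 0" using Suc.prems by force
  show ?case
  proof (cases "j = k")
    case True
    then show ?thesis using lt b Suc.prems by simp
  next
    case False
    then have "j < k" using Suc.prems by simp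
    then show ?thesis using Suc digit_add_high[OF \<open>j < k\<close> b] by simp
  qed
qed simp

lemma sum_digits_eq:
  fixes b :: nat
  shows "N < b ^ k \<Longrightarrow> (\<Sum>i<k. (N div b ^ i mod b) * b ^ i) = N"
proof (induction k arbitrary: N)
  case (Suc k)
  have b: "b > 0" using Suc.prems by (cases b) auto
  have "N div b ^ k < b" using Suc.prems b by (simp add: less_mult_imp_div_less mult.commute)
  moreover have "(N mod b ^ k) div b ^ i mod b = N div b ^ i mod b" if "i < k" for i
    using digit_add_high[OF that b, of "N mod b ^ k" "N div b ^ k"] by (metis mod_div_mult_eq)
  then have "(\<Sum>i<k. (N div b ^ i mod b) * b ^ i) = N mod b ^ k"
    using Suc.IH[of "N mod b ^ k"] b by simp
  ultimately show ?case by (simp add: mod_div_mult_eq)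
qed simp

lemma deg_le_digits:
  assumes "deg_le {..<k} n p"
  shows "\<exists>C. \<forall>x. p x = (\<Sum>N<Suc n ^ k. C N * (\<Prod>i<k. x i ^ (N div Suc n ^ i mod Suc n)))"
proof -
  obtain ms where I: "\<forall>m \<in> set ms. set (snd m) \<subseteq> {..<k} \<and> length (snd m) \<le> n"
    and p0: "\<forall>x. p x = sum_list (map (term_val x) ms)"
    using assms by (rule deg_leE)
  note p = p0[rule_format]
  define g where "g N x = (\<Prod>i<k. x i ^ (N div Suc n ^ i mod Suc n))" for N and x :: "nat \<Rightarrow> complex"
  have "\<exists>C. \<forall>x. sum_list (map (term_val x) ms) = (\<Sum>N<Suc n ^ k. C N * g N x)"
    using I
  proof (induction ms)
    case Nil
    show ?case by (intro exI[of _ "\<lambda>_. 0"]) simp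
  next
    case (Cons m ms)
    have "\<forall>m \<in> set ms. set (snd m) \<subseteq> {..<k} \<and> length (snd m) \<le> n" using Cons.prems by simp
    from Cons.IH[OF this] obtain C where C: "\<forall>x. sum_list (map (term_val x) ms) = (\<Sum>N<Suc n ^ k. C N * g N x)"
      by (elim exE) (rule that)
    have js: "set (snd m) \<subseteq> {..<k}" "length (snd m) \<le> n" using Cons.prems by auto
    define e where "e i = count_list (snd m) i" for i
    have e: "e i < Suc n" for i using js(2) count_le_length[of "snd m" i] unfolding e_def by simp
    define M where "M = (\<Sum>i<k. e i * Suc n ^ i)"
    have M: "M < Suc n ^ k" unfolding M_def by (rule sum_digits_less) (rule e)
    have cnt: "prod_list (map x is) = (\<Prod>i<k. x i ^ count_list is i)" if "set is \<subseteq> {..<k}"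
      for x :: "nat \<Rightarrow> complex" and "is"
      using that
    proof (induction "is")
      case (Cons j js)
      then have "(\<Prod>i<k. x i ^ count_list (j # js) i)
          = (\<Prod>i<k. (if i = j then x j else 1) * x i ^ count_list js i)"
        by (intro prod.cong) auto
      then show ?case using Cons by (simp add: prod.distrib)
    qed simp
    have "prod_list (map x (snd m)) = g M x" for x
    proof -
      have "g M x = (\<Prod>i<k. x i ^ e i)"
        unfolding g_def M_def
        by (intro prod.cong refl arg_cong2[where f = power] digit_sum_digits e) simp
      then show ?thesis using cnt[OF js(1)] by (simp add: e_def)
    qed
    then have "term_val x m = fst m * g M x" for x by (simp add: term_val_def)
    moreover have "(\<Sum>N<Suc n ^ k. (if N = M then fst m else 0) * g N x) = fst m * g M x" for x
    proof -
      have "(\<Sum>N<Suc n ^ k. (if N = M then fst m else 0) * g N x)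
          = (\<Sum>N<Suc n ^ k. if N = M then fst m * g N x else 0)"
        by (intro sum.cong) auto
      then show ?thesis using M by simp
    qed
    ultimately show ?case
      using C by (intro exI[of _ "\<lambda>N. (if N = M then fst m else 0) + C N"])
        (simp add: distrib_right sum.distrib)
  qed
  then show ?thesis using p unfolding g_def by simp
qed

lemma digit_monomials_independent:
  assumes "\<And>x. (\<Sum>N<b ^ k. c N * (\<Prod>i<k. x i ^ (N div b ^ i mod b))) = (0 :: complex)" "N < b ^ k"
  shows "c N = 0"
proof -
  have "(\<Sum>N<b ^ k. c N * t ^ N) = 0" for t
  proof -
    have "(\<Prod>i<k. (t ^ b ^ i) ^ (N div b ^ i mod b)) = t ^ N" if "N < b ^ k" for N
      using sum_digits_eq[OF that] by (simp flip: power_mult power_sum add: mult.commute)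
    then show ?thesis using assms(1)[of "\<lambda>i. t ^ b ^ i"] by simp
  qed
  then have "\<forall>t. poly (\<Sum>N<b ^ k. monom (c N) N) t = 0" by (simp add: poly_sum poly_monom)
  then have "(\<Sum>N<b ^ k. monom (c N) N) = 0" using poly_all_0_iff_0 by blast
  then have "coeff (\<Sum>N<b ^ k. monom (c N) N) N = 0" by simp
  then show ?thesis using assms(2) by (simp add: coeff_sum)
qed

text \<open>
  More than \<open>k\<close> polynomials in \<open>k\<close> variables are algebraically dependent by counting: the
  monomials of degree at most \<open>s\<close> in each of \<open>k + 1\<close> quantities number \<open>(s + 1)\<^bsup>k + 1\<^esup>\<close>, while
  their values lie in a space whose dimension grows like \<open>s\<^sup>k\<close>.
\<close>

lemma algebraically_dependent:
  fixes P :: "nat \<Rightarrow> (nat \<Rightarrow> complex) \<Rightarrow> complex"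
  assumes "\<And>i. i < Suc k \<Longrightarrow> P i \<in> pfun {..<k}"
  shows "\<exists>F \<in> pfun {..<Suc k}. (\<exists>y. F y \<noteq> 0) \<and> (\<forall>x. F (\<lambda>i. P i x) = 0)"
proof -
  have "\<exists>D. \<forall>i<Suc k. deg_le {..<k} (D i) (P i)"
    using pfun_deg_le[OF assms] by (metis)
  then obtain D0 where D0: "\<And>i. i < Suc k \<Longrightarrow> deg_le {..<k} (D0 i) (P i)" by blast
  define D where "D = Max (D0 ` {..<Suc k})"
  have D: "deg_le {..<k} D (P i)" if "i < Suc k" for i
    by (rule deg_le_mono[OF D0[OF that]]) (use that in \<open>auto simp: D_def intro!: Max_ge\<close>)
  \<comment> \<open>the \<open>b ^ (k + 1)\<close> products of powers with exponents below \<open>b\<close> have degree at most \<open>n\<close>, so they lie in a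
    space of dimension \<open>(n + 1) ^ k \<le> ((k + 1) (D + 1) b) ^ k\<close>; this is smaller by the choice of \<open>b\<close>\<close>
  define b where "b = Suc ((Suc k * Suc D) ^ k)"
  define n where "n = Suc k * (b * D)"
  define g where "g N x = (\<Prod>i<Suc k. P i x ^ (N div b ^ i mod b))" for N x
  have "deg_le {..<k} n (g N)" for N
  proof -
    have "deg_le {..<k} (b * D) (\<lambda>x. P i x ^ (N div b ^ i mod b))" if "i < Suc k" for i
    proof (rule deg_le_mono[OF deg_le_power[OF D[OF that]]])
      have "N div b ^ i mod b < b" by (simp add: b_def)
      then show "N div b ^ i mod b * D \<le> b * D" by (intro mult_right_mono) auto
    qed
    then show ?thesis unfolding g_def n_def
      using deg_le_prod[of "{..<Suc k}" "{..<k}" "b * D" "\<lambda>i x. P i x ^ (N div b ^ i mod b)"]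
      by (simp del: prod.lessThan_Suc mult_Suc)
  qed
  then have "\<exists>C. \<forall>x. g N x = (\<Sum>M<Suc n ^ k. C M * (\<Prod>i<k. x i ^ (M div Suc n ^ i mod Suc n)))" for N
    by (rule deg_le_digits)
  then have "\<exists>C :: nat \<Rightarrow> nat \<Rightarrow> complex. \<forall>N x. g N x = (\<Sum>M<Suc n ^ k. C N M * (\<Prod>i<k. x i ^ (M div Suc n ^ i mod Suc n)))"
    by (intro choice allI)
  then obtain C where C0: "\<forall>N x. g N x = (\<Sum>M<Suc n ^ k. C N M * (\<Prod>i<k. x i ^ (M div Suc n ^ i mod Suc n)))"
    by (elim exE) (rule that)
  note C = C0[rule_format]
  have "Suc n \<le> Suc k * Suc D * b" by (simp add: n_def b_def algebra_simps)
  then have "Suc n ^ k \<le> (Suc k * Suc D * b) ^ k" by (rule power_mono) simp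
  also have "\<dots> = (Suc k * Suc D) ^ k * b ^ k" by (rule power_mult_distrib)
  also have "\<dots> < b * b ^ k" by (intro mult_strict_right_mono) (auto simp: b_def)
  finally have "card {..<Suc n ^ k} < card {..<b ^ Suc k}" by simp
  then obtain c where c: "\<exists>N\<in>{..<b ^ Suc k}. c N \<noteq> 0"
    "\<forall>M\<in>{..<Suc n ^ k}. (\<Sum>N\<in>{..<b ^ Suc k}. c N * C N M) = 0"
    using underdetermined_system[of "{..<Suc n ^ k}" "{..<b ^ Suc k}" C] by blast
  define F where "F = (\<lambda>y. \<Sum>N<b ^ Suc k. c N * (\<Prod>i<Suc k. y i ^ (N div b ^ i mod b)))"
  have "F \<in> pfun {..<Suc k}"
    unfolding F_def by (intro pfun_sum pfun_cmult pfun_prod pfun_power pfun.var)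
  moreover have "\<exists>y. F y \<noteq> 0"
    using c(1) digit_monomials_independent[where k = "Suc k" and b = b and c = c] unfolding F_def by blast
  moreover have "F (\<lambda>i. P i x) = 0" for x
  proof -
    have "F (\<lambda>i. P i x) = (\<Sum>N<b ^ Suc k. c N * g N x)" by (simp add: F_def g_def)
    also have "\<dots> = (\<Sum>M<Suc n ^ k. (\<Sum>N<b ^ Suc k. c N * C N M) * (\<Prod>i<k. x i ^ (M div Suc n ^ i mod Suc n)))"
      unfolding C sum_distrib_left sum_distrib_right mult.assoc by (rule sum.swap)
    also have "\<dots> = 0" using c(2) by (intro sum.neutral) simp
    finally show ?thesis .
  qed
  ultimately show ?thesis by blast
qed

text \<open>
  A polynomial map with \<open>\<Phi> 0 = 0\<close> and surjective derivative at 0 is dominant: if \<open>Q\<close> vanishes on its image,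
  then the lowest homogeneous part of \<open>Q\<close> vanishes on the image of the derivative, as one sees by dividing
  \<open>Q (\<Phi> (t x))\<close> by the power of \<open>t\<close> and letting \<open>t\<close> tend to 0. The derivative enters as the value
  \<open>M x 0\<close> of the difference quotient.
\<close>

lemma dominant_of_onto_linear_part:
  fixes \<Phi> :: "('a \<Rightarrow> complex) \<Rightarrow> 'i \<Rightarrow> complex"
  assumes Q: "Q \<in> pfun I" and 0: "\<And>x. Q (\<Phi> x) = 0"
    and \<Phi>: "\<And>x t i. i \<in> I \<Longrightarrow> \<Phi> (\<lambda>j. t * x j) i = t * M x t i"
    and L: "\<And>x i. i \<in> I \<Longrightarrow> ((\<lambda>t. M x t i) \<longlongrightarrow> M x 0 i) (at 0)"
    and onto: "\<And>z. \<exists>x. \<forall>i\<in>I. M x 0 i = z i"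
  shows "Q z = 0"
proof (rule ccontr)
  assume "Q z \<noteq> 0"
  obtain N q where q: "\<forall>n. q n \<in> pfun I" "\<forall>n t x. q n (\<lambda>i. t * x i) = t ^ n * q n x"
     "\<forall>M\<ge>N. \<forall>x. Q x = (\<Sum>n\<le>M. q n x)"
    using pfun_homogeneous_parts[OF Q] by (elim exE conjE) (rule that)
  define R where "R n \<longleftrightarrow> n \<le> N \<and> (\<exists>z. q n z \<noteq> 0)" for n
  have "\<exists>n. R n"
    using \<open>Q z \<noteq> 0\<close> q(3) unfolding R_def by (metis atMost_iff le_refl sum.neutral)
  define r where "r = (LEAST n. R n)"
  have "R r" using \<open>\<exists>n. R n\<close> unfolding r_def by (metis LeastI)
  then obtain z0 where r: "r \<le> N" "q r z0 \<noteq> 0" unfolding R_def by blast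
  have low: "q n x = 0" if "n < r" for n x
    using not_less_Least[of n R] that r(1) unfolding R_def r_def by auto
  obtain x where x: "\<And>i. i \<in> I \<Longrightarrow> M x 0 i = z0 i" using onto by blast
  define h where "h t = (\<Sum>n=r..N. t ^ (n - r) * q n (M x t))" for t
  have "h t = 0" if "t \<noteq> 0" for t
  proof -
    have cng: "q n (\<Phi> (\<lambda>j. t * x j)) = q n (\<lambda>i. t * M x t i)" for n
      by (rule pfun_cong[OF q(1)[rule_format]]) (rule \<Phi>)
    have "0 = (\<Sum>n\<le>N. q n (\<Phi> (\<lambda>j. t * x j)))" using 0 q(3) by (metis le_refl)
    also have "\<dots> = (\<Sum>n\<le>N. q n (\<lambda>i. t * M x t i))"
      by (simp only: cng)
    also have "\<dots> = (\<Sum>n=r..N. t ^ n * q n (M x t))"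
      using q(2) low by (intro sum.mono_neutral_cong_right) auto
    also have "\<dots> = t ^ r * h t"
      unfolding h_def sum_distrib_left by (intro sum.cong refl) (simp flip: power_add mult.assoc)
    finally show ?thesis using that by simp
  qed
  then have "eventually (\<lambda>t. h t = 0) (at 0)" by (simp add: eventually_at_filter)
  then have "(h \<longlongrightarrow> 0) (at 0)" using tendsto_eventually by fastforce
  moreover have "(h \<longlongrightarrow> (\<Sum>n=r..N. 0 ^ (n - r) * q n z0)) (at 0)"
    unfolding h_def
  proof (intro tendsto_sum tendsto_mult tendsto_power tendsto_ident_at)
    fix n
    show "((\<lambda>t. q n (M x t)) \<longlongrightarrow> q n z0) (at 0)"
      by (rule pfun_tendsto[OF q(1)[rule_format]]) (use L[of _ x] x in metis)
  qed
  moreover have "(\<Sum>n=r..N. 0 ^ (n - r) * q n z0) = q r z0"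
  proof -
    have "(\<Sum>n=r..N. 0 ^ (n - r) * q n z0) = (\<Sum>n\<in>{r}. 0 ^ (n - r) * q n z0)"
      using r(1) by (intro sum.mono_neutral_right) auto
    then show ?thesis by simp
  qed
  ultimately show False using r(2) LIM_unique by metis
qed

section \<open>Krull dimension\<close>

definition alg_indep_on :: "(complex ^ 'm::finite) set \<Rightarrow> (nat \<Rightarrow> complex ^ 'm \<Rightarrow> complex) \<Rightarrow> nat \<Rightarrow> bool" where
  "alg_indep_on X p k \<longleftrightarrow> (\<forall>i<k. polynomial_fun (p i)) \<and>
     (\<forall>F \<in> pfun {..<k}. (\<forall>v\<in>X. F (\<lambda>i. p i v) = 0) \<longrightarrow> (\<forall>y. F y = 0))"

definition zcl :: "(complex ^ 'm::finite) set \<Rightarrow> (complex ^ 'm) set" where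
  "zcl S = {v. \<forall>q. polynomial_fun q \<longrightarrow> (\<forall>w\<in>S. q w = 0) \<longrightarrow> q v = 0}"

lemma zclI: "(\<And>q. polynomial_fun q \<Longrightarrow> \<forall>w\<in>S. q w = 0 \<Longrightarrow> q v = 0) \<Longrightarrow> v \<in> zcl S"
  by (auto simp: zcl_def)

lemma zclD: "v \<in> zcl S \<Longrightarrow> polynomial_fun q \<Longrightarrow> (\<And>w. w \<in> S \<Longrightarrow> q w = 0) \<Longrightarrow> q v = 0"
  by (auto simp: zcl_def)

lemma zcl_superset: "S \<subseteq> zcl S"
  by (auto simp: zcl_def)

lemma zcl_mono: "S \<subseteq> T \<Longrightarrow> zcl S \<subseteq> zcl T"
  by (auto simp: zcl_def)

lemma zcl_zcl [simp]: "zcl (zcl S) = zcl S"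
  by (auto simp: zcl_def)

lemma topspace_zariski [simp]: "topspace zariski = UNIV"
proof -
  have "closedin zariski (UNIV :: (complex ^ 'm::finite) set)"
    unfolding closedin_zariski by (rule exI[of _ "{}"]) (simp add: zero_locus_def)
  then show ?thesis using closedin_subset by blast
qed

lemma closedin_zariski_zcl: "closedin zariski C \<longleftrightarrow> zcl C = C"
proof
  assume "closedin zariski C"
  then obtain P where "\<forall>p\<in>P. polynomial_fun p" "C = zero_locus P" unfolding closedin_zariski by blast
  then have "zcl C \<subseteq> C" by (auto simp: zcl_def zero_locus_def)
  then show "zcl C = C" using zcl_superset by blast
next
  assume "zcl C = C"
  then have "C = zero_locus {q. polynomial_fun q \<and> (\<forall>w\<in>C. q w = 0)}"
    unfolding zcl_def zero_locus_def by blast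
  then show "closedin zariski C" unfolding closedin_zariski by (intro exI[of _ "{q. polynomial_fun q \<and> (\<forall>w\<in>C. q w = 0)}"]) auto
qed

lemma zariski_closure_of: "zariski closure_of S = zcl S"
proof (rule closure_of_unique)
  show "S \<subseteq> zcl S" by (rule zcl_superset)
  show "closedin zariski (zcl S)" by (simp add: closedin_zariski_zcl)
  fix T assume "S \<subseteq> T" "closedin zariski T"
  then show "zcl S \<subseteq> T" using zcl_mono[of S T] by (simp add: closedin_zariski_zcl)
qed

lemma closedin_subtopology_zariski:
  "closedin (subtopology zariski X) C \<longleftrightarrow> C = X \<inter> zcl C"
proof
  assume "closedin (subtopology zariski X) C"
  then obtain D where D: "zcl D = D" "C = D \<inter> X" unfolding closedin_subtopology closedin_zariski_zcl by blast
  then have "zcl C \<subseteq> D" using zcl_mono[of C D] by auto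
  then show "C = X \<inter> zcl C" using D zcl_superset[of C] by blast
next
  assume "C = X \<inter> zcl C"
  then show "closedin (subtopology zariski X) C"
    unfolding closedin_subtopology closedin_zariski_zcl by (intro exI[of _ "zcl C"]) auto
qed

lemma irreducible_subtopology_zariski:
  "irreducible_space (subtopology zariski Y) \<longleftrightarrow> Y \<noteq> {} \<and>
     (\<forall>p q. polynomial_fun p \<longrightarrow> polynomial_fun q \<longrightarrow> (\<forall>v\<in>Y. p v * q v = 0) \<longrightarrow>
        (\<forall>v\<in>Y. p v = 0) \<or> (\<forall>v\<in>Y. q v = 0))" (is "?I \<longleftrightarrow> ?R")
proof
  assume I: ?I
  have "(\<forall>v\<in>Y. p v = 0) \<or> (\<forall>v\<in>Y. q v = 0)"
    if p: "polynomial_fun p" and q: "polynomial_fun q" and 0: "\<forall>v\<in>Y. p v * q v = 0" for p q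
  proof -
    have cl: "closedin (subtopology zariski Y) {v\<in>Y. r v = 0}" if "polynomial_fun r" for r
      unfolding closedin_subtopology_zariski using that zcl_superset[of "{v\<in>Y. r v = 0}"] by (auto dest: zclD)
    have "{v\<in>Y. p v = 0} \<union> {v\<in>Y. q v = 0} = Y" using 0 by auto
    then have "{v\<in>Y. p v = 0} = Y \<or> {v\<in>Y. q v = 0} = Y"
      using I cl[OF p] cl[OF q] unfolding irreducible_space_def by simp
    then show ?thesis by blast
  qed
  then show ?R using I by (auto simp: irreducible_space_def)
next
  assume R: ?R
  have "A = Y \<or> B = Y" if A: "A = Y \<inter> zcl A" and B: "B = Y \<inter> zcl B" and AB: "A \<union> B = Y" for A B
  proof (rule ccontr)
    assume "\<not> ?thesis"
    then obtain v w where "v \<in> Y" "v \<notin> zcl A" "w \<in> Y" "w \<notin> zcl B" using A B by blast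
    then obtain p q where "polynomial_fun p" "\<forall>u\<in>A. p u = 0" "p v \<noteq> 0"
      "polynomial_fun q" "\<forall>u\<in>B. q u = 0" "q w \<noteq> 0" unfolding zcl_def by blast
    moreover from this have "\<forall>v\<in>Y. p v * q v = 0" using AB by auto
    ultimately show False using R \<open>v \<in> Y\<close> \<open>w \<in> Y\<close> by blast
  qed
  then show ?I using R unfolding irreducible_space_def by (auto simp: closedin_subtopology_zariski)
qed

lemma irreducible_zariskiD:
  assumes "irreducible_space (subtopology zariski Y)" "polynomial_fun p" "polynomial_fun q"
    and "\<And>v. v \<in> Y \<Longrightarrow> p v * q v = 0"
  shows "(\<forall>v\<in>Y. p v = 0) \<or> (\<forall>v\<in>Y. q v = 0)"
proof -
  have "\<forall>v\<in>Y. p v * q v = 0" using assms(4) by blast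
  then show ?thesis
    using assms(1)[unfolded irreducible_subtopology_zariski, THEN conjunct2, THEN spec[of _ p], THEN spec[of _ q]]
      assms(2,3) by simp
qed

lemma alg_indep_on_mono: "alg_indep_on X p k \<Longrightarrow> X \<subseteq> Y \<Longrightarrow> alg_indep_on Y p k"
  unfolding alg_indep_on_def by blast

text \<open>
  A function \<open>f\<close> that vanishes on \<open>Z\<close> but not on \<open>Y\<close> can be adjoined. Order a relation on \<open>Y\<close> by
  powers of \<open>f\<close>; the lowest power can be cancelled since \<open>Y\<close> is irreducible, and then restricting to \<open>Z\<close>
  leaves a relation between the old functions.
\<close>

lemma alg_indep_on_extend:
  assumes Z: "alg_indep_on Z p k" and ZY: "Z \<subseteq> Y" "y0 \<in> Y" "y0 \<notin> zcl Z"
    and Y: "irreducible_space (subtopology zariski Y)"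
  shows "\<exists>p. alg_indep_on Y p (Suc k)"
proof -
  obtain f where f: "polynomial_fun f" "\<And>v. v \<in> Z \<Longrightarrow> f v = 0" "f y0 \<noteq> 0"
    using ZY(3) unfolding zcl_def by blast
  define p' where "p' = p(k := f)"
  have p': "\<forall>i<Suc k. polynomial_fun (p' i)"
    using Z f(1) by (auto simp: alg_indep_on_def p'_def less_Suc_eq)
  have "F y = 0" if F: "F \<in> pfun {..<Suc k}" and van: "\<forall>v\<in>Y. F (\<lambda>i. p' i v) = 0" for F y
  proof (rule ccontr)
    assume "F y \<noteq> 0"
    obtain N q where q0: "\<forall>n. q n \<in> pfun {..<k}" "\<forall>M\<ge>N. \<forall>x. F x = (\<Sum>n\<le>M. x k ^ n * q n x)"
      using pfun_Suc_expand[OF F] by (elim exE conjE) (rule that)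
    then have q: "\<And>n. q n \<in> pfun {..<k}" "\<And>x. F x = (\<Sum>n\<le>N. x k ^ n * q n x)" by simp_all
    define R where "R n \<longleftrightarrow> n \<le> N \<and> (\<exists>z. q n z \<noteq> 0)" for n
    have "\<exists>n. R n"
      using \<open>F y \<noteq> 0\<close> q(2)[of y] unfolding R_def by (metis (no_types, lifting) atMost_iff mult_zero_right sum.neutral)
    define r where "r = (LEAST n. R n)"
    have "R r" using \<open>\<exists>n. R n\<close> unfolding r_def by (metis LeastI)
    then obtain z0 where r: "r \<le> N" "q r z0 \<noteq> 0" unfolding R_def by blast
    have low: "q n x = 0" if "n < r" for n x
      using not_less_Least[of n R] that r(1) unfolding R_def r_def by auto
    define H where "H = (\<lambda>x. \<Sum>n=r..N. x k ^ (n - r) * q n x)"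
    have FH: "F x = x k ^ r * H x" for x
    proof -
      have "F x = (\<Sum>n=r..N. x k ^ n * q n x)"
        unfolding q(2) using low by (intro sum.mono_neutral_right) auto
      also have "\<dots> = x k ^ r * H x"
        unfolding H_def sum_distrib_left by (intro sum.cong refl) (simp flip: power_add mult.assoc)
      finally show ?thesis .
    qed
    have "q n \<in> pfun {..<Suc k}" for n
      using pfun_compose[OF q(1)[of n], of "\<lambda>i x. x i" "{..<Suc k}"] by (simp add: pfun.var)
    then have "H \<in> pfun {..<Suc k}" unfolding H_def
      by (intro pfun_sum pfun.mult pfun_power) (simp_all add: pfun.var)
    then have HP: "polynomial_fun (\<lambda>v. H (\<lambda>i. p' i v))"
      by (rule polynomial_fun_pfun) (use p' in simp)
    have "polynomial_fun (\<lambda>v. f v ^ n)" for n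
      by (induction n) (simp_all add: polynomial_fun.const polynomial_fun.mult f(1))
    moreover have "f v ^ r * H (\<lambda>i. p' i v) = 0" if "v \<in> Y" for v
      using van FH that by (simp add: p'_def)
    ultimately have "(\<forall>v\<in>Y. f v ^ r = 0) \<or> (\<forall>v\<in>Y. H (\<lambda>i. p' i v) = 0)"
      by (intro irreducible_zariskiD[OF Y _ HP])
    moreover have "f y0 ^ r \<noteq> 0" using f(3) by simp
    ultimately have "\<forall>v\<in>Y. H (\<lambda>i. p' i v) = 0" using ZY(2) by blast
    moreover have "H (\<lambda>i. p' i v) = q r (\<lambda>i. p i v)" if "v \<in> Z" for v
    proof -
      have "H (\<lambda>i. p' i v) = (\<Sum>n\<in>{r}. 0 ^ (n - r) * q n (\<lambda>i. p' i v))"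
        unfolding H_def using r(1) f(2)[OF that] by (intro sum.mono_neutral_cong_right) (auto simp: p'_def)
      also have "q r (\<lambda>i. p' i v) = q r (\<lambda>i. p i v)"
        by (rule pfun_cong[OF q(1)]) (simp add: p'_def)
      then have "(\<Sum>n\<in>{r}. 0 ^ (n - r) * q n (\<lambda>i. p' i v)) = q r (\<lambda>i. p i v)" by simp
      finally show ?thesis .
    qed
    ultimately have "\<forall>v\<in>Z. q r (\<lambda>i. p i v) = 0" using ZY(1) by (metis subsetD)
    then show False using Z q(1) r(2) unfolding alg_indep_on_def by blast
  qed
  then have "alg_indep_on Y p' (Suc k)" unfolding alg_indep_on_def using p' by blast
  then show ?thesis by (rule exI[of _ p'])
qed

lemma alg_indep_on_chain:
  assumes "\<And>i. i \<le> n \<Longrightarrow> closedin (subtopology zariski X) (Z i) \<and>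
      irreducible_space (subtopology (subtopology zariski X) (Z i))"
    and "\<And>i. i < n \<Longrightarrow> Z i \<subset> Z (Suc i)" and "m \<le> n"
  shows "\<exists>p. alg_indep_on (Z m) p m"
  using assms(3)
proof (induction m)
  case 0
  have cst: "F \<in> pfun {..<0} \<Longrightarrow> F x = F y" for F :: "(nat \<Rightarrow> complex) \<Rightarrow> complex" and x y
    by (rule pfun_cong) auto
  have "Z 0 \<noteq> {}" using assms(1)[of 0] closedin_subset[of "subtopology zariski X" "Z 0"]
    by (auto simp: irreducible_space_def)
  then have "alg_indep_on (Z 0) (\<lambda>_ _. 0) 0"
    unfolding alg_indep_on_def
  proof (intro conjI ballI impI allI)
    fix F :: "(nat \<Rightarrow> complex) \<Rightarrow> complex" and y
    assume "F \<in> pfun {..<0}" "\<forall>v\<in>Z 0. F (\<lambda>i. 0) = 0"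
    then show "F y = 0" using \<open>Z 0 \<noteq> {}\<close> cst[of F y "\<lambda>i. 0"] by auto
  qed simp
  then show ?case by (rule exI[of _ "\<lambda>_ _. 0"])
next
  case (Suc m)
  then obtain p where p: "alg_indep_on (Z m) p m" by auto
  have cl: "Z i = X \<inter> zcl (Z i)" if "i \<le> n" for i
    using assms(1)[OF that] closedin_subtopology_zariski by blast
  then have sub: "Z i \<subseteq> X" if "i \<le> n" for i using that by blast
  have "irreducible_space (subtopology zariski (Z (Suc m)))"
    using assms(1)[OF Suc.prems] sub[OF Suc.prems] by (simp add: subtopology_subtopology inf.absorb2)
  moreover have lt: "Z m \<subset> Z (Suc m)" using assms(2)[of m] Suc.prems by simp
  moreover obtain y where "y \<in> Z (Suc m)" "y \<notin> Z m" using lt by blast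
  moreover from this have "y \<notin> zcl (Z m)" using cl[of m] sub[OF Suc.prems] Suc.prems by auto
  ultimately show ?case using alg_indep_on_extend[OF p] by blast
qed

lemma krull_dim_le:
  assumes "\<And>p. \<not> alg_indep_on X p (Suc d)"
  shows "krull_dim (subtopology zariski X) \<le> enat d"
  unfolding krull_dim_def
proof (rule SUP_least)
  fix n assume "n \<in> {n. \<exists>Z :: nat \<Rightarrow> (complex ^ 'a) set.
       (\<forall>i\<le>n. closedin (subtopology zariski X) (Z i) \<and> irreducible_space (subtopology (subtopology zariski X) (Z i))) \<and>
       (\<forall>i<n. Z i \<subset> Z (Suc i))}"
  then obtain Z where Z: "\<And>i. i \<le> n \<Longrightarrow> closedin (subtopology zariski X) (Z i) \<and> irreducible_space (subtopology (subtopology zariski X) (Z i))"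
    "\<And>i. i < n \<Longrightarrow> Z i \<subset> Z (Suc i)" by blast
  have "n \<le> d"
  proof (rule ccontr)
    assume "\<not> n \<le> d"
    then have d: "Suc d \<le> n" by simp
    obtain p where "alg_indep_on (Z (Suc d)) p (Suc d)" using alg_indep_on_chain[where n = n and X = X and Z = Z, OF Z d] by blast
    moreover have "Z (Suc d) \<subseteq> X" using Z(1)[OF d] closedin_subset by fastforce
    ultimately show False using assms alg_indep_on_mono by blast
  qed
  then show "enat n \<le> enat d" by simp
qed

lemma not_alg_indep_on_parametrized:
  assumes G: "\<And>i. (\<lambda>y. G y $ i) \<in> pfun {..<d}" and X: "X \<subseteq> zcl (range G)"
  shows "\<not> alg_indep_on X p (Suc d)"
proof
  assume *: "alg_indep_on X p (Suc d)"
  then have p: "polynomial_fun (p i)" if "i < Suc d" for i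
    using that unfolding alg_indep_on_def by blast
  have "(\<lambda>y. p i (G y)) \<in> pfun {..<d}" if "i < Suc d" for i
    using p[OF that] G by (rule polynomial_fun_param)
  then obtain F where F: "F \<in> pfun {..<Suc d}" "\<exists>y. F y \<noteq> 0" "\<forall>x. F (\<lambda>i. p i (G x)) = 0"
    using algebraically_dependent[of d "\<lambda>i y. p i (G y)"] by blast
  have "polynomial_fun (\<lambda>v. F (\<lambda>i. p i v))"
    by (rule polynomial_fun_pfun[OF F(1)]) (use p in simp)
  then have "F (\<lambda>i. p i v) = 0" if "v \<in> X" for v
    using F(3) X that by (intro zclD[of v "range G" "\<lambda>v. F (\<lambda>i. p i v)"]) auto
  then show False using * F(1,2) unfolding alg_indep_on_def by blast
qed

text \<open>
  The members of the chain are the closures in \<open>X\<close> of the images under \<open>\<phi>\<close> of the coordinate subspaces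
  \<open>y\<^sub>k = y\<^sub>k\<^sub>+\<^sub>1 = \<dots> = 0\<close>, restricted to the open set \<open>h \<noteq> 0\<close> that is mapped into \<open>X\<close>. They are irreducible as
  closures of images of open sets in affine spaces, and the \<open>k\<close>-th one has \<open>k\<close> but not \<open>k + 1\<close> algebraically
  independent functions, so that the inclusions are strict.
\<close>

lemma krull_dim_ge:
  fixes \<phi> :: "(nat \<Rightarrow> complex) \<Rightarrow> complex ^ 'm::finite"
  assumes \<phi>: "\<And>i. (\<lambda>y. \<phi> y $ i) \<in> pfun {..<d}"
    and h: "h \<in> pfun {..<d}" "h (\<lambda>_. 0) \<noteq> 0" and O: "\<And>y. h y \<noteq> 0 \<Longrightarrow> \<phi> y \<in> X"
    and \<psi>: "\<And>n. n < d \<Longrightarrow> polynomial_fun (\<psi> n)"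
    and ind: "\<And>k F y. k \<le> d \<Longrightarrow> F \<in> pfun {..<k} \<Longrightarrow>
        (\<And>y. (\<And>i. i \<ge> k \<Longrightarrow> y i = (0 :: complex)) \<Longrightarrow> F (\<lambda>i. \<psi> i (\<phi> y)) = 0) \<Longrightarrow> F y = 0"
  shows "enat d \<le> krull_dim (subtopology zariski X)" "alg_indep_on X \<psi> d"
proof -
  define tr where "tr k y i = (if i < k then y i else 0)" for k i :: nat and y :: "nat \<Rightarrow> complex"
  define C where "C k = {y. (\<forall>i\<ge>k. y i = 0) \<and> h y \<noteq> 0}" for k
  define Z where "Z k = X \<inter> zcl (\<phi> ` C k)" for k
  have 0: "(\<lambda>_. 0) \<in> C k" for k by (simp add: C_def h)
  have tr_pfun: "(\<lambda>y. p (tr k y)) \<in> pfun {..<k}" if "p \<in> pfun {..<d}" for p k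
  proof -
    have "(\<lambda>y. tr k y i) \<in> pfun {..<k}" for i
      by (cases "i < k") (simp_all add: tr_def pfun.var pfun.const)
    then have "(\<lambda>y. p (\<lambda>i. tr k y i)) \<in> pfun {..<k}" by (rule pfun_compose[OF that])
    then show ?thesis by simp
  qed
  have trC: "h (tr k y) \<noteq> 0 \<Longrightarrow> tr k y \<in> C k" for k y by (simp add: C_def tr_def)
  have Ctr: "y \<in> C k \<Longrightarrow> tr k y = y" for k y by (auto simp: C_def tr_def)
  have van: "p (\<phi> y) = 0" if "polynomial_fun p" "\<forall>v\<in>\<phi> ` C k. p v = 0" "\<forall>i\<ge>k. y i = 0"
    for p k and y :: "nat \<Rightarrow> complex"
  proof -
    have p: "(\<lambda>y. p (\<phi> y)) \<in> pfun {..<d}" using that(1) \<phi> by (rule polynomial_fun_param)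
    have "p (\<phi> (tr k y)) * h (tr k y) = 0" for y using trC[of k y] that(2) by auto
    then have "(\<forall>y. p (\<phi> (tr k y)) = 0) \<or> (\<forall>y. h (tr k y) = 0)"
      by (rule pfun_mult_eq_0[OF tr_pfun[OF p, of k] tr_pfun[OF h(1), of k]])
    moreover have "tr k (\<lambda>_. 0) = (\<lambda>_. 0)" by (auto simp: tr_def)
    ultimately have "p (\<phi> (tr k y)) = 0" using h(2) by metis
    moreover have "tr k y = y" using that(3) by (auto simp: tr_def)
    ultimately show ?thesis by simp
  qed
  have CX: "\<phi> ` C k \<subseteq> Z k" for k using O zcl_superset[of "\<phi> ` C k"] by (auto simp: Z_def C_def)
  have indep: "alg_indep_on (Z k) \<psi> k" if k: "k \<le> d" for k
    unfolding alg_indep_on_def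
  proof (intro conjI allI impI ballI)
    fix i assume "i < k" then show "polynomial_fun (\<psi> i)" using \<psi> k by simp
  next
    fix F y assume F: "F \<in> pfun {..<k}" "\<forall>v\<in>Z k. F (\<lambda>i. \<psi> i v) = 0"
    show "F y = 0"
    proof (rule ind[OF k F(1)])
      fix y :: "nat \<Rightarrow> complex" assume y: "\<And>i. i \<ge> k \<Longrightarrow> y i = 0"
      have "polynomial_fun (\<lambda>v. F (\<lambda>i. \<psi> i v))"
        by (rule polynomial_fun_pfun[OF F(1)]) (use \<psi> k in simp)
      then show "F (\<lambda>i. \<psi> i (\<phi> y)) = 0"
        using van[of "\<lambda>v. F (\<lambda>i. \<psi> i v)" k y] F(2) CX y by blast
    qed
  qed
  show "alg_indep_on X \<psi> d" using indep[of d] by (auto intro: alg_indep_on_mono simp: Z_def)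
  have dep: "\<not> alg_indep_on (Z k) p (Suc k)" for k p
  proof (rule not_alg_indep_on_parametrized[of "\<lambda>y. \<phi> (tr k y)"])
    show "(\<lambda>y. \<phi> (tr k y) $ i) \<in> pfun {..<k}" for i by (rule tr_pfun[OF \<phi>])
    have "\<phi> ` C k \<subseteq> range (\<lambda>y. \<phi> (tr k y))" using Ctr by (metis image_subsetI rangeI)
    then show "Z k \<subseteq> zcl (range (\<lambda>y. \<phi> (tr k y)))" using zcl_mono unfolding Z_def by blast
  qed
  have irr: "irreducible_space (subtopology zariski (Z k))" for k
    unfolding irreducible_subtopology_zariski
  proof (intro conjI allI impI)
    show "Z k \<noteq> {}" using CX[of k] 0[of k] by auto
    fix p q :: "complex ^ 'm \<Rightarrow> complex"
    assume p: "polynomial_fun p" and q: "polynomial_fun q" and pq: "\<forall>v\<in>Z k. p v * q v = 0"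
    have pp: "(\<lambda>y. p (\<phi> y)) \<in> pfun {..<d}" and qq: "(\<lambda>y. q (\<phi> y)) \<in> pfun {..<d}"
      using p q \<phi> by (auto intro: polynomial_fun_param)
    have "p (\<phi> (tr k y)) * q (\<phi> (tr k y)) = 0" for y
      using van[of "\<lambda>v. p v * q v" k "tr k y"] pq CX[of k] p q
      by (auto intro: polynomial_fun.mult simp: tr_def)
    then have "(\<forall>y. p (\<phi> (tr k y)) = 0) \<or> (\<forall>y. q (\<phi> (tr k y)) = 0)"
      by (rule pfun_mult_eq_0[OF tr_pfun[OF pp, of k] tr_pfun[OF qq, of k]])
    moreover have "\<forall>v\<in>Z k. r v = 0" if r: "polynomial_fun r" "\<forall>y. r (\<phi> (tr k y)) = 0" for r
    proof
      fix v assume "v \<in> Z k"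
      then have "v \<in> zcl (\<phi> ` C k)" by (simp add: Z_def)
      moreover have "r w = 0" if w: "w \<in> \<phi> ` C k" for w
      proof -
        obtain y where y: "w = \<phi> y" "y \<in> C k" using w by blast
        show ?thesis using r(2)[rule_format, of y] Ctr[OF y(2)] y(1) by simp
      qed
      ultimately show "r v = 0" by (rule zclD[OF _ r(1)])
    qed
    ultimately show "(\<forall>v\<in>Z k. p v = 0) \<or> (\<forall>v\<in>Z k. q v = 0)"
      using p q by (elim disjE) simp_all
  qed
  have cl: "closedin (subtopology zariski X) (Z k)" for k
    unfolding closedin_subtopology_zariski Z_def using zcl_mono[of "X \<inter> zcl (\<phi> ` C k)" "zcl (\<phi> ` C k)"]
      zcl_superset[of "X \<inter> zcl (\<phi> ` C k)"] by auto
  have lt: "Z k \<subset> Z (Suc k)" if "k < d" for k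
  proof
    have "C k \<subseteq> C (Suc k)" by (auto simp: C_def)
    then show "Z k \<subseteq> Z (Suc k)" unfolding Z_def using zcl_mono[OF image_mono] by blast
    show "Z k \<noteq> Z (Suc k)" using indep[of "Suc k"] dep[of k] that by auto
  qed
  have "Z k \<subseteq> X" for k by (auto simp: Z_def)
  then have "(\<forall>i\<le>d. closedin (subtopology zariski X) (Z i) \<and>
        irreducible_space (subtopology (subtopology zariski X) (Z i))) \<and> (\<forall>i<d. Z i \<subset> Z (Suc i))"
    using cl irr lt by (simp add: subtopology_subtopology inf.absorb2)
  then show "enat d \<le> krull_dim (subtopology zariski X)"
    unfolding krull_dim_def by (intro SUP_upper) blast
qed

section \<open>Trivectors, bases and orbits\<close>

lemma wedge_add:
  "wedge (u + u') v w = wedge u v w + wedge u' v w"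
  "wedge u (v + v') w = wedge u v w + wedge u v' w"
  "wedge u v (w + w') = wedge u v w + wedge u v w'"
  by (auto simp: vec_eq_iff wedge_nth algebra_simps)

lemma wedge_scale:
  "wedge (c *s u) v w = c *s wedge u v w"
  "wedge u (c *s v) w = c *s wedge u v w"
  "wedge u v (c *s w) = c *s wedge u v w"
  by (auto simp: vec_eq_iff wedge_nth algebra_simps)

lemma wedge_minus:
  "wedge (- u) v w = - wedge u v w"
  "wedge u (- v) w = - wedge u v w"
  "wedge u v (- w) = - wedge u v w"
  by (auto simp: vec_eq_iff wedge_nth algebra_simps)

lemma wedge_diff:
  "wedge (u - u') v w = wedge u v w - wedge u' v w"
  "wedge u (v - v') w = wedge u v w - wedge u v' w"
  "wedge u v (w - w') = wedge u v w - wedge u v w'"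
  by (auto simp: vec_eq_iff wedge_nth algebra_simps)

lemma wedge_zero [simp]: "wedge 0 v w = 0" "wedge u 0 w = 0" "wedge u v 0 = 0"
  by (auto simp: vec_eq_iff wedge_nth)

lemma wedge_swap: "wedge v u w = - wedge u v w" "wedge u w v = - wedge u v w"
  by (auto simp: vec_eq_iff wedge_nth algebra_simps)

lemma act_add: "act g (S + T) = act g S + act g T"
  using linear_act by (rule vec.linear_add)

lemma act_scale: "act g (c *s T) = c *s act g T"
  using linear_act by (rule vec.linear_scale)

lemma act_zero [simp]: "act g 0 = 0"
  using linear_act by (rule vec.linear_0)

lemma trivectors_induct [consumes 1, case_names wedge zero add scale]:
  assumes "T \<in> trivectors" "\<And>u v w. P (wedge u v w)" "P 0"
    "\<And>S T. P S \<Longrightarrow> P T \<Longrightarrow> P (S + T)" "\<And>c T. P T \<Longrightarrow> P (c *s T)"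
  shows "P T"
proof -
  have "vec.subspace (Collect P)"
    unfolding vec.subspace_def using assms by auto
  moreover have "T \<in> vec.span {wedge u v w | u v w. True}" using assms(1) by (simp only: span_wedge)
  moreover have "{wedge u v w | u v w. True} \<subseteq> Collect P" using assms(2) by auto
  ultimately show ?thesis using vec.span_minimal by blast
qed

lemma act_act: "T \<in> trivectors \<Longrightarrow> act g (act h T) = act (g ** h) T"
  by (induction rule: trivectors_induct) (simp_all add: act_wedge act_add act_scale matrix_vector_mul_assoc)

lemma act_one: "T \<in> trivectors \<Longrightarrow> act (mat 1) T = T"
  by (induction rule: trivectors_induct) (simp_all add: act_wedge act_add act_scale)

lemma act_trivectors: "T \<in> trivectors \<Longrightarrow> act g T \<in> trivectors"
  by (induction rule: trivectors_induct)
    (simp_all add: act_wedge act_add act_scale wedge_in_trivectors vec.subspace_add[OF subspace_trivectors]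
      vec.subspace_scale[OF subspace_trivectors] vec.subspace_0[OF subspace_trivectors])

text \<open>
  In the index type the number 7 equals 0. Coordinates are therefore addressed by \<open>of_nat i\<close> with
  \<open>i \<in> {1..7}\<close>, which matches the numbering of the basis.
\<close>

lemma UNIV_7: "(UNIV :: 7 set) = of_nat ` {1..7}"
proof -
  have "x \<in> of_nat ` {1..7}" for x :: 7
  proof (cases x)
    case (of_int z)
    show ?thesis
    proof (cases "z = 0")
      case True
      then have "x = of_nat 7" using of_int by simp
      then show ?thesis by (intro image_eqI[of _ _ 7]) auto
    next
      case False
      then have "x = of_nat (nat z)" using of_int by simp
      moreover have "nat z \<in> {1..7}" using False of_int by auto
      ultimately show ?thesis by blast
    qed
  qed
  then show ?thesis by auto
qed

lemma inj_of_nat_7: "inj_on (of_nat :: nat \<Rightarrow> 7) {1..7}"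
proof (rule eq_card_imp_inj_on)
  have "card (of_nat ` {1..7} :: 7 set) = 7" unfolding UNIV_7[symmetric] by simp
  then show "card (of_nat ` {1..7} :: 7 set) = card {1..7::nat}" by simp
qed simp

definition std :: "nat \<Rightarrow> complex ^ 7" where
  "std i = axis (of_nat i) 1"

lemma basis7_spanI:
  assumes "vec.span (f ` {1..7}) = UNIV"
  shows "basis7 f"
proof -
  have d: "vec.dim (UNIV :: (complex ^ 7) set) = 7" unfolding vec_dim_card by simp
  have "7 \<le> card (f ` {1..7})"
    using vec.dim_le_card[of UNIV "f ` {1..7}"] assms d by simp
  moreover have "card (f ` {1..7}) \<le> 7" using card_image_le[of "{1..7}" f] by simp
  ultimately have c: "card (f ` {1..7}) = 7" by simp
  then have "inj_on f {1..7}" by (intro eq_card_imp_inj_on) auto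
  moreover have "vec.independent (f ` {1..7})"
    by (rule vec.card_le_dim_spanning[of _ UNIV]) (use assms d c in auto)
  ultimately show ?thesis using assms by (simp add: basis7_def)
qed

lemma basis7_change:
  assumes "basis7 f" "\<And>i. i \<in> {1..7} \<Longrightarrow> f i \<in> vec.span (f' ` {1..7})"
  shows "basis7 f'"
proof (rule basis7_spanI)
  have "vec.span (f ` {1..7}) \<subseteq> vec.span (f' ` {1..7})"
    using assms(2) by (intro vec.span_minimal vec.subspace_span) auto
  then show "vec.span (f' ` {1..7}) = UNIV" using assms(1) by (auto simp: basis7_def)
qed

lemma basis7_std: "basis7 std"
proof (rule basis7_spanI)
  have "x \<in> vec.span (std ` {1..7})" for x
  proof -
    have "x = (\<Sum>a\<in>UNIV. x $ a *s axis a 1)" by (simp add: basis_expansion)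
    moreover have "axis a 1 \<in> vec.span (std ` {1..7})" for a :: 7
    proof -
      have "a \<in> of_nat ` {1..7}" using UNIV_7 by blast
      then show ?thesis unfolding std_def by (intro vec.span_base) auto
    qed
    ultimately show ?thesis by (metis (no_types, lifting) vec.span_scale vec.span_sum)
  qed
  then show "vec.span (std ` {1..7}) = UNIV" by blast
qed

lemma basis7_invertible:
  assumes "basis7 f" "invertible g"
  shows "basis7 (\<lambda>i. g *v f i)"
proof (rule basis7_spanI)
  have "x \<in> vec.span ((\<lambda>i. g *v f i) ` {1..7})" for x
  proof -
    obtain g' where g: "g ** g' = mat 1" using assms(2) by (auto simp: invertible_def)
    have "g' *v x \<in> vec.span (f ` {1..7})" using assms(1) by (simp add: basis7_def)
    then have "g *v (g' *v x) \<in> (*v) g ` vec.span (f ` {1..7})" by blast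
    also have "\<dots> = vec.span ((*v) g ` f ` {1..7})"
      by (rule vec.linear_span_image[symmetric]) (rule matrix_vector_mul_linear_gen)
    finally show ?thesis using g by (simp add: matrix_vector_mul_assoc image_image)
  qed
  then show "vec.span ((\<lambda>i. g *v f i) ` {1..7}) = UNIV" by blast
qed

lemma matrix_mult_axis: "A *v axis k 1 = column k A" for A :: "complex ^ 'n ^ 'm"
  by (simp add: vec_eq_iff matrix_vector_mult_def axis_def column_def if_distrib cong: if_cong)

lemma std_to_basis7:
  assumes "basis7 f"
  shows "\<exists>g. invertible g \<and> (\<forall>i\<in>{1..7}. g *v std i = f i)"
proof -
  define idx :: "7 \<Rightarrow> nat" where "idx = inv_into {1..7} of_nat"
  have idx: "idx (of_nat i) = i" if "i \<in> {1..7}" for i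
    unfolding idx_def using inj_of_nat_7 that by simp
  define g :: "complex ^ 7 ^ 7" where "g = (\<chi> a b. f (idx b) $ a)"
  have col: "column b g = f (idx b)" for b by (simp add: column_def g_def vec_eq_iff)
  have 1: "g *v std i = f i" if "i \<in> {1..7}" for i
    unfolding std_def matrix_mult_axis col by (simp only: idx[OF that])
  have "columns g = (\<lambda>b. f (idx b)) ` of_nat ` {1..7}"
    unfolding UNIV_7[symmetric] columns_def col by blast
  also have "\<dots> = f ` {1..7}"
    unfolding image_image by (intro image_cong refl) (simp only: idx)
  finally have "columns g = f ` {1..7}" .
  then have "vec.span (columns g) = UNIV" using assms by (simp add: basis7_def)
  then obtain g' where "g ** g' = mat 1" using matrix_right_invertible_span_columns[of g] by auto
  then have "invertible g" by (simp add: invertible_right_inverse) blast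
  then show ?thesis using 1 by blast
qed

lemma basis7_to_basis7:
  assumes "basis7 f" "basis7 f'"
  shows "\<exists>g. invertible g \<and> (\<forall>i\<in>{1..7}. g *v f i = f' i)"
proof -
  obtain g g' where g: "invertible g" "\<forall>i\<in>{1..7}. g *v std i = f i"
    and g': "invertible g'" "\<forall>i\<in>{1..7}. g' *v std i = f' i"
    using std_to_basis7[OF assms(1)] std_to_basis7[OF assms(2)] by blast
  obtain h where h: "h ** g = mat 1" "g ** h = mat 1" using g(1) by (auto simp: invertible_def)
  have "invertible (g' ** h)" using g'(1) h by (intro invertible_mult) (auto simp: invertible_def)
  moreover have "(g' ** h) *v f i = f' i" if "i \<in> {1..7}" for i
  proof -
    have "h *v f i = std i" using g(2) that h(1)
      by (metis matrix_vector_mul_assoc matrix_vector_mul_lid)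
    then show ?thesis using g'(2) that by (simp flip: matrix_vector_mul_assoc)
  qed
  ultimately show ?thesis by blast
qed

definition wedge_sum :: "(nat \<Rightarrow> complex ^ 'n::finite) \<Rightarrow> (nat \<times> nat \<times> nat) list \<Rightarrow> complex ^ ('n \<times> 'n \<times> 'n)" where
  "wedge_sum f S = (\<Sum>(i, j, k)\<leftarrow>S. wedge (f i) (f j) (f k))"

lemma wedge_sum_simps [simp]:
  "wedge_sum f [] = 0"
  "wedge_sum f ((i, j, k) # S) = wedge (f i) (f j) (f k) + wedge_sum f S"
  by (simp_all add: wedge_sum_def)

definition rep_triples :: "(nat \<times> nat \<times> nat) list list" where
  "rep_triples = [[], [(1,2,3)], [(1,2,3), (1,4,5)], [(1,2,3), (1,4,5), (1,6,7)],
     [(1,2,3), (1,4,5), (2,4,6)], [(1,2,3), (4,5,6)], [(1,2,3), (1,4,5), (1,6,7), (3,5,7)],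
     [(1,2,3), (4,5,6), (1,4,7)], [(1,2,3), (4,5,6), (1,4,7), (2,5,7)],
     [(1,2,3), (4,5,6), (1,4,7), (2,5,7), (3,6,7)]]"

lemma atMost_9: "i \<le> (9::nat) \<longleftrightarrow> i \<in> {0,1,2,3,4,5,6,7,8,9}"
  by auto

lemma representatives_nth: "i \<le> 9 \<Longrightarrow> representatives f ! i = wedge_sum f (rep_triples ! i)"
  unfolding atMost_9
  by (elim insertE emptyE) (simp_all add: representatives_def rep_triples_def Let_def add.assoc nth_Cons')

lemma rep_triples_range: "i \<le> 9 \<Longrightarrow> \<forall>(a, b, c) \<in> set (rep_triples ! i). {a, b, c} \<subseteq> {1..7}"
  unfolding atMost_9 by (elim insertE emptyE) (auto simp: rep_triples_def nth_Cons')

lemma wedge_sum_cong: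
  assumes "\<And>i. i \<in> I \<Longrightarrow> f i = g i" "\<forall>(a, b, c) \<in> set S. {a, b, c} \<subseteq> I"
  shows "wedge_sum f S = wedge_sum g S"
  using assms(2)
proof (induction S)
  case (Cons t S)
  obtain a b c where t: "t = (a, b, c)" by (cases t) auto
  have "a \<in> I" "b \<in> I" "c \<in> I" using Cons.prems t by auto
  then show ?case using Cons t by (simp add: assms(1))
qed simp

lemma act_wedge_sum: "act g (wedge_sum f S) = wedge_sum (\<lambda>i. g *v f i) S"
  by (induction S) (auto simp: act_add act_wedge)

lemma wedge_sum_trivectors: "wedge_sum f S \<in> trivectors"
  by (induction S) (auto simp: vec.subspace_0[OF subspace_trivectors]
      intro!: vec.subspace_add[OF subspace_trivectors] wedge_in_trivectors)

text \<open>
  The group acts transitively on bases, so the orbit consists of the same expression written in all bases.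
\<close>

lemma orbit_no_iff:
  assumes f: "basis7 f" and i: "i \<le> 9"
  shows "T \<in> orbit_no f i \<longleftrightarrow> (\<exists>f'. basis7 f' \<and> T = wedge_sum f' (rep_triples ! i))"
proof
  assume "T \<in> orbit_no f i"
  then obtain g where "invertible g" "T = act g (wedge_sum f (rep_triples ! i))"
    unfolding orbit_no_def orbit_def representatives_nth[OF i] by blast
  then show "\<exists>f'. basis7 f' \<and> T = wedge_sum f' (rep_triples ! i)"
    using basis7_invertible[OF f] by (auto simp: act_wedge_sum)
next
  assume "\<exists>f'. basis7 f' \<and> T = wedge_sum f' (rep_triples ! i)"
  then obtain f' where f': "basis7 f'" "T = wedge_sum f' (rep_triples ! i)" by blast
  obtain g where g: "invertible g" "\<forall>i\<in>{1..7}. g *v f i = f' i" using basis7_to_basis7[OF f f'(1)] by blast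
  have "T = act g (wedge_sum f (rep_triples ! i))"
    unfolding act_wedge_sum f'(2) by (rule wedge_sum_cong[OF _ rep_triples_range[OF i]]) (simp add: g(2)[rule_format])
  then show "T \<in> orbit_no f i"
    unfolding orbit_no_def orbit_def representatives_nth[OF i] using g(1) by blast
qed

lemma orbit_no_std: "basis7 f \<Longrightarrow> i \<le> 9 \<Longrightarrow> orbit_no f i = orbit_no std i"
  by (rule set_eqI) (simp add: orbit_no_iff basis7_std)

section \<open>Dimensions of the orbits\<close>

definition idx7 :: "7 \<Rightarrow> nat" where "idx7 = inv_into {1..7} of_nat"

lemma idx7_of_nat: "i \<in> {1..7} \<Longrightarrow> idx7 (of_nat i) = i"
  unfolding idx7_def using inj_of_nat_7 by simp

lemma of_nat_idx7: "of_nat (idx7 a) = a"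
  unfolding idx7_def by (rule f_inv_into_f) (use UNIV_7 in blast)

lemma idx7_range: "idx7 a \<in> {1..7}"
  unfolding idx7_def by (rule inv_into_into) (use UNIV_7 in blast)

lemma std_nth: "i \<in> {1..7} \<Longrightarrow> j \<in> {1..7} \<Longrightarrow> std i $ of_nat j = (if i = j then 1 else 0)"
  using inj_onD[OF inj_of_nat_7, of i j] by (auto simp: std_def axis_def)

text \<open>
  \<open>triple_ix\<close>, \<open>wedge_coeff\<close> and the functions built on them compute coordinates of sums of basis trivectors
  over the integers, so that tables of coefficients can be checked by evaluation.
\<close>

definition triple_ix :: "nat \<times> nat \<times> nat \<Rightarrow> 7 \<times> 7 \<times> 7" where
  "triple_ix = (\<lambda>(i, j, k). (of_nat i, of_nat j, of_nat k))"

definition kron :: "nat \<Rightarrow> nat \<Rightarrow> int" where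
  "kron i j = (if i = j then 1 else 0)"

fun wedge_coeff :: "nat \<times> nat \<times> nat \<Rightarrow> nat \<times> nat \<times> nat \<Rightarrow> int" where
  "wedge_coeff (i, j, k) (l, m, n) =
     kron i l * kron j m * kron k n + kron i m * kron j n * kron k l + kron i n * kron j l * kron k m
     - kron i l * kron j n * kron k m - kron i m * kron j l * kron k n - kron i n * kron j m * kron k l"

lemma wedge_std_nth:
  assumes "{i, j, k} \<subseteq> {1..7}" "{l, m, n} \<subseteq> {1..7}"
  shows "wedge (std i) (std j) (std k) $ triple_ix (l, m, n) = of_int (wedge_coeff (i, j, k) (l, m, n))"
  using assms by (simp add: triple_ix_def wedge_nth std_nth kron_def del: of_int_mult)

text \<open>
  The derivative of \<open>f \<mapsto> wedge_sum f S\<close> in the direction \<open>g\<close>.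
\<close>

definition wedge_der ::
  "(nat \<Rightarrow> complex ^ 'n::finite) \<Rightarrow> (nat \<Rightarrow> complex ^ 'n) \<Rightarrow> (nat \<times> nat \<times> nat) list \<Rightarrow> complex ^ ('n \<times> 'n \<times> 'n)" where
  "wedge_der f g S = (\<Sum>(i, j, k)\<leftarrow>S. wedge (g i) (f j) (f k) + wedge (f i) (g j) (f k) + wedge (f i) (f j) (g k))"

lemma wedge_der_simps [simp]:
  "wedge_der f g [] = 0"
  "wedge_der f g ((i, j, k) # S) =
     wedge (g i) (f j) (f k) + wedge (f i) (g j) (f k) + wedge (f i) (f j) (g k) + wedge_der f g S"
  by (simp_all add: wedge_der_def)

lemma wedge_sum_taylor:
  "wedge_sum (\<lambda>i. f i + t *s g i) S =
     wedge_sum f S + t *s wedge_der f g S + t^2 *s wedge_der g f S + t^3 *s wedge_sum g S"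
proof (induction S)
  case (Cons s S)
  obtain i j k where "s = (i, j, k)" by (cases s) auto
  then show ?case using Cons
    by (simp add: wedge_add wedge_scale vec.scale_right_distrib power2_eq_square power3_eq_cube)
qed simp

lemma wedge_der_linear:
  "wedge_der f (\<lambda>i. g i + h i) S = wedge_der f g S + wedge_der f h S"
  "wedge_der f (\<lambda>i. c *s g i) S = c *s wedge_der f g S"
  "wedge_der f (\<lambda>i. 0) S = 0"
proof -
  show "wedge_der f (\<lambda>i. g i + h i) S = wedge_der f g S + wedge_der f h S"
    by (induction S) (auto simp: wedge_add)
  show "wedge_der f (\<lambda>i. c *s g i) S = c *s wedge_der f g S"
    by (induction S) (auto simp: wedge_scale vec.scale_right_distrib)
  show "wedge_der f (\<lambda>i. 0) S = 0" by (induction S) auto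
qed

lemma wedge_der_sum: "wedge_der f (\<lambda>i. \<Sum>m\<in>A. g m i) S = (\<Sum>m\<in>A. wedge_der f (g m) S)"
  by (induction A rule: infinite_finite_induct) (simp_all add: wedge_der_linear)

text \<open>
  A list of triples \<open>(c, a, b)\<close> encodes the matrix \<open>\<Sum> c E\<^sub>a\<^sub>b\<close>; \<open>elem_map\<close> is its action on the
  standard basis and \<open>der_coeff\<close> a coordinate of its derivation action on a sum of basis trivectors.
\<close>

definition elem_map :: "(int \<times> nat \<times> nat) list \<Rightarrow> nat \<Rightarrow> complex ^ 7" where
  "elem_map A i = (\<Sum>(c, a, b)\<leftarrow>A. if i = b then of_int c *s std a else 0)"

fun der1_coeff :: "nat \<Rightarrow> nat \<Rightarrow> (nat \<times> nat \<times> nat) list \<Rightarrow> nat \<times> nat \<times> nat \<Rightarrow> int" where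
  "der1_coeff a b [] t = 0"
| "der1_coeff a b ((i, j, k) # S) t =
     (if i = b then wedge_coeff (a, j, k) t else 0) + (if j = b then wedge_coeff (i, a, k) t else 0) +
     (if k = b then wedge_coeff (i, j, a) t else 0) + der1_coeff a b S t"

fun der_coeff :: "(int \<times> nat \<times> nat) list \<Rightarrow> (nat \<times> nat \<times> nat) list \<Rightarrow> nat \<times> nat \<times> nat \<Rightarrow> int" where
  "der_coeff [] S t = 0"
| "der_coeff ((c, a, b) # A) S t = c * der1_coeff a b S t + der_coeff A S t"

definition in7 :: "nat \<Rightarrow> bool" where "in7 a \<longleftrightarrow> 1 \<le> a \<and> a \<le> 7"

definition triples7 :: "(nat \<times> nat \<times> nat) list \<Rightarrow> bool" where
  "triples7 S = list_all (\<lambda>(i, j, k). in7 i \<and> in7 j \<and> in7 k) S"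

text \<open>
  The entries of the list are a tangent direction \<open>A\<close> of the group and a coordinate \<open>t\<close>. When the matrix of
  the coordinates of the derivatives is triangular with nonzero diagonal, the differential of the orbit
  map has rank at least the length of the list.
\<close>

fun triangular :: "(nat \<times> nat \<times> nat) list \<Rightarrow> ((int \<times> nat \<times> nat) list \<times> nat \<times> nat \<times> nat) list \<Rightarrow> bool" where
  "triangular S [] = True"
| "triangular S ((A, t) # L) \<longleftrightarrow> triples7 [t] \<and> list_all (\<lambda>(c, a, b). in7 a) A \<and>
     der_coeff A S t \<noteq> 0 \<and> list_all (\<lambda>(B, u). der_coeff B S t = 0) L \<and> triangular S L"

lemma der1_coeff:
  assumes "triples7 S" "triples7 [t]" "in7 a"
  shows "wedge_der std (\<lambda>i. if i = b then std a else 0) S $ triple_ix t = of_int (der1_coeff a b S t)"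
  using assms(1)
proof (induction S)
  case (Cons s S)
  obtain i j k l m n where s: "s = (i, j, k)" "t = (l, m, n)" by (cases s, cases t) auto
  have r: "{i, j, k, l, m, n, a} \<subseteq> {1..7}" using assms Cons.prems s by (auto simp: triples7_def in7_def)
  have "wedge_der std (\<lambda>i. if i = b then std a else 0) S $ triple_ix t = of_int (der1_coeff a b S t)"
    using Cons by (simp add: triples7_def)
  moreover have "wedge (if i = b then std a else 0) (std j) (std k) $ triple_ix t = of_int (if i = b then wedge_coeff (a, j, k) t else 0)"
    "wedge (std i) (if j = b then std a else 0) (std k) $ triple_ix t = of_int (if j = b then wedge_coeff (i, a, k) t else 0)"
    "wedge (std i) (std j) (if k = b then std a else 0) $ triple_ix t = of_int (if k = b then wedge_coeff (i, j, a) t else 0)"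
    unfolding s(2) using r by (simp_all add: wedge_std_nth del: wedge_coeff.simps)
  ultimately show ?case unfolding s(1)
    by (simp only: wedge_der_simps der1_coeff.simps vector_add_component of_int_add)
qed simp

lemma der_coeff:
  assumes "triples7 S" "triples7 [t]" "list_all (\<lambda>(c, a, b). in7 a) A"
  shows "wedge_der std (elem_map A) S $ triple_ix t = of_int (der_coeff A S t)"
  using assms(3)
proof (induction A)
  case Nil
  have "elem_map [] = (\<lambda>i. 0)" by (simp add: elem_map_def fun_eq_iff)
  then show ?case by (simp add: wedge_der_linear)
next
  case (Cons s A)
  obtain c a b where s: "s = (c, a, b)" by (cases s) auto
  have "elem_map (s # A) = (\<lambda>i. of_int c *s (if i = b then std a else 0) + elem_map A i)"
    by (simp add: elem_map_def s fun_eq_iff)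
  then have "wedge_der std (elem_map (s # A)) S =
      of_int c *s wedge_der std (\<lambda>i. if i = b then std a else 0) S + wedge_der std (elem_map A) S"
    by (simp only: wedge_der_linear)
  then show ?case using Cons der1_coeff[OF assms(1,2), of a b] by (simp add: s)
qed

lemma triangularD:
  assumes "triangular S L" "n < length L"
  shows "triples7 [snd (L ! n)]" "list_all (\<lambda>(c, a, b). in7 a) (fst (L ! n))"
    "der_coeff (fst (L ! n)) S (snd (L ! n)) \<noteq> 0"
    "\<And>m. n < m \<Longrightarrow> m < length L \<Longrightarrow> der_coeff (fst (L ! m)) S (snd (L ! n)) = 0"
proof -
  have "triples7 [snd (L ! n)] \<and> list_all (\<lambda>(c, a, b). in7 a) (fst (L ! n)) \<and>
    der_coeff (fst (L ! n)) S (snd (L ! n)) \<noteq> 0 \<and>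
    (\<forall>m. n < m \<longrightarrow> m < length L \<longrightarrow> der_coeff (fst (L ! m)) S (snd (L ! n)) = 0)"
    using assms
  proof (induction L arbitrary: n)
    case (Cons x L)
    obtain A t where x: "x = (A, t)" by (cases x) auto
    show ?case
    proof (cases n)
      case 0
      have "der_coeff (fst (L ! m)) S t = 0" if "m < length L" for m
        using Cons.prems(1) that by (simp add: x list_all_length case_prod_beta)
      then show ?thesis using Cons.prems 0 by (auto simp: x nth_Cons split: nat.splits)
    next
      case (Suc n')
      then have "n' < length L" using Cons.prems by simp
      then show ?thesis using Cons.IH[of n'] Cons.prems Suc by (auto simp: x nth_Cons split: nat.splits)
    qed
  qed simp
  then show "triples7 [snd (L ! n)]" "list_all (\<lambda>(c, a, b). in7 a) (fst (L ! n))"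
    "der_coeff (fst (L ! n)) S (snd (L ! n)) \<noteq> 0"
    "\<And>m. n < m \<Longrightarrow> m < length L \<Longrightarrow> der_coeff (fst (L ! m)) S (snd (L ! n)) = 0" by blast+
qed

lemma triangular_system:
  fixes L :: "nat \<Rightarrow> nat \<Rightarrow> complex"
  assumes "\<And>i. i < k \<Longrightarrow> L i i \<noteq> 0" "\<And>i m. i < k \<Longrightarrow> m < k \<Longrightarrow> i < m \<Longrightarrow> L m i = 0"
  shows "\<exists>x. \<forall>i<k. (\<Sum>m<k. x m * L m i) = z i"
  using assms
proof (induction k)
  case (Suc k)
  then obtain x where x: "\<forall>i<k. (\<Sum>m<k. x m * L m i) = z i" by auto
  define y where "y = x(k := (z k - (\<Sum>m<k. x m * L m k)) / L k k)"
  have y: "(\<Sum>m<k. y m * L m i) = (\<Sum>m<k. x m * L m i)" for i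
    by (intro sum.cong) (auto simp: y_def)
  have "(\<Sum>m<Suc k. y m * L m i) = z i" if "i < Suc k" for i
  proof (cases "i = k")
    case True
    then show ?thesis using y[of k] Suc.prems(1)[of k] by (simp add: y_def)
  next
    case False
    then have "i < k" "L k i = 0" using that Suc.prems(2)[of i k] by auto
    then show ?thesis using x y[of i] by simp
  qed
  then show ?case by blast
qed simp

lemma pfun_act:
  assumes "\<And>a b. (\<lambda>y. A y $ a $ b) \<in> pfun J" "\<And>i. (\<lambda>y. W y $ i) \<in> pfun J"
  shows "(\<lambda>y. act (A y) (W y) $ i) \<in> pfun J"
proof -
  obtain a b c where i: "i = (a, b, c)" by (cases i) auto
  show ?thesis unfolding i act_nth by (intro pfun_sum pfun.mult assms)
qed

lemma pfun_det:
  assumes "\<And>a b. (\<lambda>y. A y $ a $ b) \<in> pfun J"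
  shows "(\<lambda>y. det (A y :: complex ^ 'n ^ 'n::finite)) \<in> pfun J"
  unfolding det_def by (intro pfun_sum pfun.mult pfun.const pfun_prod assms)

text \<open>
  The slice consists of the matrices \<open>1 + \<Sum> y\<^sub>m A\<^sub>m\<close>. By triangularity, for every \<open>k\<close> the first \<open>k\<close> directions
  are already dominant onto the first \<open>k\<close> coordinates, which is what a chain needs.
\<close>

lemma orbit_dim_ge:
  assumes L: "triangular S L" and S: "triples7 S"
  shows "enat (length L) \<le> krull_dim (subtopology zariski (orbit (wedge_sum std S)))"
    "\<exists>\<psi>. alg_indep_on (orbit (wedge_sum std S)) \<psi> (length L)"
proof -
  define d where "d = length L"
  define T where "T = wedge_sum std S"
  define em where "em m = elem_map (fst (L ! m))" for m
  define c where "c n = triple_ix (snd (L ! n))" for n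
  define B :: "(nat \<Rightarrow> complex) \<Rightarrow> complex ^ 7 ^ 7"
    where "B y = (\<chi> p q. \<Sum>m<d. y m * em m (idx7 q) $ p)" for y
  define A where "A y = mat 1 + B y" for y
  define b where "b y i = (\<Sum>m<d. y m *s em m i)" for y :: "nat \<Rightarrow> complex" and i
  have S7: "\<forall>(i, j, k) \<in> set S. {i, j, k} \<subseteq> {1..7}"
    using S by (auto simp: triples7_def list_all_iff in7_def)
  have Bstd: "B y *v std i = b y i" if "i \<in> {1..7}" for y i
    unfolding std_def matrix_mult_axis
    by (simp add: vec_eq_iff column_def B_def b_def idx7_of_nat[OF that])
  have Astd: "A y *v std i = std i + b y i" if "i \<in> {1..7}" for y i
    using Bstd[OF that] by (simp add: A_def matrix_vector_mult_add_rdistrib)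
  have A_pfun: "(\<lambda>y. A y $ p $ q) \<in> pfun {..<d}" for p q
    unfolding A_def B_def mat_def vector_add_component vec_lambda_beta
    by (intro pfun.add pfun_sum pfun.mult pfun.const pfun.var) auto
  have taylor: "act (A (\<lambda>m. t * y m)) T = T + t *s wedge_der std (b y) S + t^2 *s wedge_der (b y) std S + t^3 *s wedge_sum (b y) S"
    for t y
  proof -
    have "b (\<lambda>m. t * y m) i = t *s b y i" for i
      by (simp add: b_def vec.scale_sum_right)
    then have "act (A (\<lambda>m. t * y m)) T = wedge_sum (\<lambda>i. std i + t *s b y i) S"
      unfolding T_def act_wedge_sum by (intro wedge_sum_cong[OF _ S7]) (simp only: Astd)
    then show ?thesis by (simp only: wedge_sum_taylor T_def)
  qed
  have der: "wedge_der std (b y) S $ c n = (\<Sum>m<d. y m * of_int (der_coeff (fst (L ! m)) S (snd (L ! n))))"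
    if "n < d" for y n
  proof -
    have "wedge_der std (b y) S = (\<Sum>m<d. y m *s wedge_der std (em m) S)"
      unfolding b_def wedge_der_sum wedge_der_linear ..
    moreover have "wedge_der std (em m) S $ c n = of_int (der_coeff (fst (L ! m)) S (snd (L ! n)))" if "m < d" for m
      unfolding em_def c_def
      using that \<open>n < d\<close> L S by (intro der_coeff triangularD) (auto simp: d_def)
    ultimately show ?thesis by (simp add: sum_component)
  qed
  have kk: "enat d \<le> krull_dim (subtopology zariski (orbit T)) \<and> alg_indep_on (orbit T) (\<lambda>n v. v $ c n + (- T $ c n)) d"
  proof (intro conjI krull_dim_ge[where \<phi> = "\<lambda>y. act (A y) T" and h = "\<lambda>y. det (A y)"])
    show "(\<lambda>y. act (A y) T $ i) \<in> pfun {..<d}" for i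
      by (intro pfun_act A_pfun pfun.const)
    \<comment> \<open>each premise of \<open>krull_dim_ge\<close> is to be shown once for either of its two conclusions\<close>
    then show "(\<lambda>y. act (A y) T $ i) \<in> pfun {..<d}" for i .
    show "(\<lambda>y. det (A y)) \<in> pfun {..<d}" by (intro pfun_det A_pfun)
    then show "(\<lambda>y. det (A y)) \<in> pfun {..<d}" .
    have "A (\<lambda>_. 0) = mat 1" by (simp add: A_def B_def vec_eq_iff)
    then show "det (A (\<lambda>_. 0)) \<noteq> 0" by simp
    then show "det (A (\<lambda>_. 0)) \<noteq> 0" .
    show "act (A y) T \<in> orbit T" if "det (A y) \<noteq> 0" for y
      using that unfolding orbit_def by (auto simp: invertible_det_nz)
    then show "act (A y) T \<in> orbit T" if "det (A y) \<noteq> 0" for y using that .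
    show "polynomial_fun (\<lambda>v. v $ c n + (- T $ c n))" for n
      by (intro polynomial_fun.intros)
    then show "polynomial_fun (\<lambda>v. v $ c n + (- T $ c n))" for n .
    show *: "F z = 0" if k: "k \<le> d" and F: "F \<in> pfun {..<k}"
      and van: "\<And>y. (\<And>i. i \<ge> k \<Longrightarrow> y i = 0) \<Longrightarrow> F (\<lambda>n. act (A y) T $ c n + (- T $ c n)) = 0" for k F z
    proof -
      define tr where "tr x i = (if i < k then x i else (0 :: complex))" for x :: "nat \<Rightarrow> complex" and i
      define M where "M x t n = (wedge_der std (b (tr x)) S + t *s wedge_der (b (tr x)) std S + t^2 *s wedge_sum (b (tr x)) S) $ c n"
        for x t n
      show ?thesis
      proof (rule dominant_of_onto_linear_part[where \<Phi> = "\<lambda>x n. act (A (tr x)) T $ c n + (- T $ c n)" and M = M, OF F])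
        show "F (\<lambda>n. act (A (tr x)) T $ c n + - T $ c n) = 0" for x
          by (rule van) (simp add: tr_def)
        show "act (A (tr (\<lambda>j. t * x j))) T $ c i + - T $ c i = t * M x t i" for x t i
        proof -
          have "tr (\<lambda>j. t * x j) = (\<lambda>j. t * tr x j)" by (auto simp: tr_def)
          then show ?thesis unfolding taylor M_def
            by (simp add: taylor algebra_simps power2_eq_square power3_eq_cube)
        qed
        show "((\<lambda>t. M x t i) \<longlongrightarrow> M x 0 i) (at 0)" for x i
          unfolding M_def vector_add_component vector_smult_component by (intro tendsto_intros)
        show "\<exists>x. \<forall>i\<in>{..<k}. M x 0 i = z i" for z
        proof -
          let ?L = "\<lambda>m n. of_int (der_coeff (fst (L ! m)) S (snd (L ! n))) :: complex"
          have "\<exists>x. \<forall>i<k. (\<Sum>m<k. x m * ?L m i) = z i"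
            using triangularD[OF L] k by (intro triangular_system) (auto simp: d_def)
          then obtain x where x: "\<forall>i<k. (\<Sum>m<k. x m * ?L m i) = z i" by blast
          have "M x 0 i = z i" if "i < k" for i
          proof -
            have "M x 0 i = (\<Sum>m<d. tr x m * ?L m i)" unfolding M_def using der[of i] that k by simp
            also have "\<dots> = (\<Sum>m<k. tr x m * ?L m i)"
              using k by (intro sum.mono_neutral_right) (auto simp: tr_def)
            also have "\<dots> = z i" using x that by (simp add: tr_def)
            finally show ?thesis .
          qed
          then show ?thesis by auto
        qed
      qed
    qed
    show "F z = 0" if "k \<le> d" "F \<in> pfun {..<k}"
      "\<And>y. (\<And>i. i \<ge> k \<Longrightarrow> y i = 0) \<Longrightarrow> F (\<lambda>n. act (A y) T $ c n + (- T $ c n)) = 0" for k F z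
      using that by (rule *)
  qed
  then show "enat (length L) \<le> krull_dim (subtopology zariski (orbit (wedge_sum std S)))"
    "\<exists>\<psi>. alg_indep_on (orbit (wedge_sum std S)) \<psi> (length L)"
    unfolding d_def T_def by blast+
qed

text \<open>
  For each representative the list contains as many directions as the orbit has dimensions. The order
  matters: it makes the derivatives triangular. Most directions are elementary matrices; the few longer
  combinations make further coordinates of the derivatives vanish.
\<close>

definition slices :: "((int \<times> nat \<times> nat) list \<times> nat \<times> nat \<times> nat) list list" where
  "slices = [
    [],
    [([(1,4,3)], (1,2,4)), ([(1,5,3)], (1,2,5)), ([(1,6,3)], (1,2,6)), ([(1,7,3)], (1,2,7)),
     ([(1,4,2)], (1,3,4)), ([(1,5,2)], (1,3,5)), ([(1,6,2)], (1,3,6)), ([(1,7,2)], (1,3,7)),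
     ([(1,4,1)], (2,3,4)), ([(1,5,1)], (2,3,5)), ([(1,6,1)], (2,3,6)), ([(1,7,1)], (2,3,7)),
     ([(1,1,1)], (1,2,3))],
    [([(1,6,3)], (1,2,6)), ([(1,7,3)], (1,2,7)), ([(1,6,2)], (1,3,6)), ([(1,7,2)], (1,3,7)),
     ([(1,6,5)], (1,4,6)), ([(1,7,5)], (1,4,7)), ([(1,6,4)], (1,5,6)), ([(1,7,4)], (1,5,7)),
     ([(1,4,1)], (2,3,4)), ([(1,5,1)], (2,3,5)), ([(1,6,1)], (2,3,6)), ([(1,7,1)], (2,3,7)),
     ([(1,2,1)], (2,4,5)), ([(1,3,1)], (3,4,5)), ([(1,2,5)], (1,2,4)), ([(1,2,4)], (1,2,5)),
     ([(1,3,5)], (1,3,4)), ([(1,3,4)], (1,3,5)), ([(1,2,2)], (1,2,3)), ([(1,4,4)], (1,4,5))],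
    [([(1,4,1)], (2,3,4)), ([(1,5,1)], (2,3,5)), ([(1,6,1)], (2,3,6)), ([(1,7,1)], (2,3,7)),
     ([(1,2,1)], (2,4,5)), ([(1,3,1)], (3,4,5)), ([(1,2,5)], (1,2,4)), ([(1,2,4)], (1,2,5)),
     ([(1,2,7)], (1,2,6)), ([(1,2,6)], (1,2,7)), ([(1,3,5)], (1,3,4)), ([(1,3,4)], (1,3,5)),
     ([(1,3,7)], (1,3,6)), ([(1,3,6)], (1,3,7)), ([(1,4,7)], (1,4,6)), ([(1,4,6)], (1,4,7)),
     ([(1,5,7)], (1,5,6)), ([(1,5,6)], (1,5,7)), ([(1,2,2)], (1,2,3)), ([(1,4,4)], (1,4,5)),
     ([(1,6,6)], (1,6,7))],
    [([(1,7,3)], (1,2,7)), ([(1,6,2)], (1,3,6)), ([(1,7,2)], (1,3,7)), ([(1,7,5)], (1,4,7)),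
     ([(1,6,4)], (1,5,6)), ([(1,7,4)], (1,5,7)), ([(1,5,1)], (2,3,5)), ([(1,7,1)], (2,3,7)),
     ([(1,7,6)], (2,4,7)), ([(1,5,4)], (2,5,6)), ([(1,3,1)], (3,4,5)), ([(1,3,2)], (3,4,6)),
     ([(1,2,4)], (1,2,5)), ([(1,1,4)], (1,2,6)), ([(1,3,5)], (1,3,4)), ([(1,3,4)], (1,3,5)),
     ([(1,1,2)], (1,4,6)), ([(1,3,6)], (2,3,4)), ([(1,6,1)], (2,3,6)), ([(-1,6,1), (1,3,4),
     (1,5,2)], (4,5,6)), ([(1,2,1)], (2,4,5)), ([(1,3,3)], (1,2,3)), ([(1,1,6)], (1,2,4)),
     ([(1,5,5)], (1,4,5)), ([(1,6,6)], (2,4,6))],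
    [([(1,4,3)], (1,2,4)), ([(1,5,3)], (1,2,5)), ([(1,6,3)], (1,2,6)), ([(1,7,3)], (1,2,7)),
     ([(1,4,2)], (1,3,4)), ([(1,5,2)], (1,3,5)), ([(1,6,2)], (1,3,6)), ([(1,7,2)], (1,3,7)),
     ([(1,1,6)], (1,4,5)), ([(1,1,5)], (1,4,6)), ([(1,1,4)], (1,5,6)), ([(1,4,1)], (2,3,4)),
     ([(1,5,1)], (2,3,5)), ([(1,6,1)], (2,3,6)), ([(1,7,1)], (2,3,7)), ([(1,2,6)], (2,4,5)),
     ([(1,2,5)], (2,4,6)), ([(1,2,4)], (2,5,6)), ([(1,3,6)], (3,4,5)), ([(1,3,5)], (3,4,6)),
     ([(1,3,4)], (3,5,6)), ([(1,7,6)], (4,5,7)), ([(1,7,5)], (4,6,7)), ([(1,7,4)], (5,6,7)),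
     ([(1,1,1)], (1,2,3)), ([(1,4,4)], (4,5,6))],
    [([(1,4,1)], (2,3,4)), ([(1,6,1)], (2,3,6)), ([(1,2,1)], (2,4,5)), ([(1,2,3)], (2,5,7)),
     ([(1,4,5)], (3,4,7)), ([(1,6,7)], (3,5,6)), ([(1,2,5)], (1,2,4)), ([(1,2,4)], (1,2,5)),
     ([(1,2,7)], (1,2,6)), ([(1,2,6)], (1,2,7)), ([(1,3,5)], (1,3,4)), ([(1,3,7)], (1,3,6)),
     ([(1,4,7)], (1,4,6)), ([(1,4,6)], (1,4,7)), ([(1,5,7)], (1,5,6)), ([(1,5,1)], (2,3,5)),
     ([(-1,6,3), (1,5,1), (-1,2,7)], (5,6,7)), ([(1,7,1)], (2,3,7)), ([(-1,2,5), (-1,7,1),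
     (-1,4,3)], (4,5,7)), ([(1,3,1)], (3,4,5)), ([(-1,3,1), (-1,4,7), (-1,6,5)], (3,6,7)),
     ([(1,2,2)], (1,2,3)), ([(1,1,7)], (1,3,5)), ([(1,1,5)], (1,3,7)), ([(1,4,4)], (1,4,5)),
     ([(1,1,3)], (1,5,7)), ([(1,6,6)], (1,6,7)), ([(1,3,3), (-1,2,2)], (3,5,7))],
    [([(1,5,3)], (1,2,5)), ([(1,6,3)], (1,2,6)), ([(1,5,2)], (1,3,5)), ([(1,6,2)], (1,3,6)),
     ([(1,1,4)], (1,5,6)), ([(1,5,4)], (1,5,7)), ([(1,6,4)], (1,6,7)), ([(1,4,1)], (2,3,4)),
     ([(1,5,1)], (2,3,5)), ([(1,6,1)], (2,3,6)), ([(1,7,1)], (2,3,7)), ([(1,2,6)], (2,4,5)),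
     ([(1,2,5)], (2,4,6)), ([(1,2,1)], (2,4,7)), ([(1,2,4)], (2,5,6)), ([(1,7,3)], (1,2,7)),
     ([(1,3,6)], (3,4,5)), ([(1,3,5)], (3,4,6)), ([(1,3,1)], (3,4,7)), ([(1,3,4)], (3,5,6)),
     ([(1,7,2)], (1,3,7)), ([(1,7,6)], (4,5,7)), ([(1,7,5)], (4,6,7)), ([(1,7,4)], (5,6,7)),
     ([(1,2,7)], (1,2,4)), ([(1,3,7)], (1,3,4)), ([(1,1,6)], (1,4,5)), ([(1,1,5)], (1,4,6)),
     ([(1,2,2)], (1,2,3)), ([(1,7,7)], (1,4,7)), ([(1,5,5)], (4,5,6))],
    [([(1,6,3)], (1,2,6)), ([(1,5,2)], (1,3,5)), ([(1,6,2)], (1,3,6)), ([(1,1,4)], (1,5,6)),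
     ([(1,6,4)], (1,6,7)), ([(1,4,1)], (2,3,4)), ([(1,6,1)], (2,3,6)), ([(1,2,5)], (2,4,6)),
     ([(1,6,5)], (2,6,7)), ([(1,3,6)], (3,4,5)), ([(1,3,5)], (3,4,6)), ([(1,7,1)], (2,3,7)),
     ([(1,3,1)], (3,4,7)), ([(1,3,4)], (3,5,6)), ([(1,7,2)], (1,3,7)), ([(1,3,2)], (3,5,7)),
     ([(1,7,5)], (4,6,7)), ([(1,7,4)], (5,6,7)), ([(1,2,7)], (1,2,4)), ([(1,1,7)], (1,2,5)),
     ([(1,3,7)], (1,3,4)), ([(1,1,6)], (1,4,5)), ([(1,1,5)], (1,4,6)), ([(1,1,2)], (1,5,7)),
     ([(1,5,1)], (2,3,5)), ([(1,2,6)], (2,4,5)), ([(1,2,1)], (2,4,7)), ([(1,2,4)], (2,5,6)),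
     ([(1,7,3)], (1,2,7)), ([(1,7,6)], (4,5,7)), ([(1,3,3)], (1,2,3)), ([(1,4,4)], (1,4,7)),
     ([(1,5,5)], (2,5,7)), ([(1,6,6)], (4,5,6))],
    [([(1,6,3)], (1,2,6)), ([(1,5,2)], (1,3,5)), ([(1,1,4)], (1,5,6)), ([(1,4,1)], (2,3,4)),
     ([(1,2,5)], (2,4,6)), ([(1,3,6)], (3,4,5)), ([(1,2,7)], (1,2,4)), ([(1,1,7)], (1,2,5)),
     ([(1,3,7)], (1,3,4)), ([(1,6,2)], (1,3,6)), ([(1,1,6)], (1,4,5)), ([(1,1,5)], (1,4,6)),
     ([(1,1,2)], (1,5,7)), ([(1,1,3)], (1,6,7)), ([(1,5,1)], (2,3,5)), ([(1,6,1)], (2,3,6)),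
     ([(1,2,6)], (2,4,5)), ([(1,2,1)], (2,4,7)), ([(1,2,4)], (2,5,6)), ([(1,7,3)], (1,2,7)),
     ([(1,2,3)], (2,6,7)), ([(1,3,5)], (3,4,6)), ([(1,7,1)], (2,3,7)), ([(1,3,1)], (3,4,7)),
     ([(1,3,4)], (3,5,6)), ([(1,7,2)], (1,3,7)), ([(1,3,2)], (3,5,7)), ([(1,7,6)], (4,5,7)),
     ([(1,7,5)], (4,6,7)), ([(1,7,4)], (5,6,7)), ([(1,1,1)], (1,2,3)), ([(1,5,5)], (2,5,7)),
     ([(1,6,6)], (3,6,7)), ([(1,4,4)], (1,4,7)), ([(-1,6,6), (-1,5,5), (1,7,7), (-1,4,4)], (4,5,6))]]"

definition orbit_dims :: "nat list" where
  "orbit_dims = [0, 13, 20, 21, 25, 26, 28, 31, 34, 35]"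

lemma slices_check:
  "list_all2 triangular rep_triples slices" "map length slices = orbit_dims" "list_all triples7 rep_triples"
  by code_simp+

lemma orbit_dim_ge_std:
  assumes "i \<le> 9"
  shows "enat (orbit_dims ! i) \<le> krull_dim (subtopology zariski (orbit_no std i))"
    "\<exists>\<psi>. alg_indep_on (orbit_no std i) \<psi> (orbit_dims ! i)"
proof -
  have l: "length rep_triples = 10" "length slices = 10" by (simp_all add: rep_triples_def slices_def)
  have "triangular (rep_triples ! i) (slices ! i)" "triples7 (rep_triples ! i)" "length (slices ! i) = orbit_dims ! i"
    using slices_check assms l by (simp_all add: list_all2_conv_all_nth list_all_length flip: slices_check(2))
  moreover have "orbit_no std i = orbit (wedge_sum std (rep_triples ! i))"
    by (simp add: orbit_no_def representatives_nth[OF assms])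
  ultimately show "enat (orbit_dims ! i) \<le> krull_dim (subtopology zariski (orbit_no std i))"
    "\<exists>\<psi>. alg_indep_on (orbit_no std i) \<psi> (orbit_dims ! i)"
    using orbit_dim_ge by metis+
qed

lemma matrix_add_right_distrib: "(A + B) ** C = A ** C + B ** C" for A B :: "complex ^ 'n ^ 'm"
  by (simp add: vec_eq_iff matrix_matrix_mult_def distrib_right sum.distrib)

lemma trivector_repeat:
  assumes "T \<in> trivectors"
  shows "T $ (a, a, c) = 0" "T $ (a, c, c) = 0" "T $ (a, c, a) = 0"
proof -
  show 1: "T $ (a, a, c) = 0" for a c using trivectorsD(1)[OF assms, of a a c] by simp
  show "T $ (a, c, c) = 0" using trivectorsD(2)[OF assms, of a c c] by simp
  show "T $ (a, c, a) = 0" using trivectorsD(2)[OF assms, of a c a] 1[of a c] by simp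
qed

lemma trivector_eqI:
  assumes "S \<in> trivectors" "T \<in> trivectors"
    and eq: "\<And>i j k. 1 \<le> i \<Longrightarrow> i < j \<Longrightarrow> j < k \<Longrightarrow> k \<le> 7 \<Longrightarrow> S $ triple_ix (i, j, k) = T $ triple_ix (i, j, k)"
  shows "S = T"
proof -
  have D: "S - T \<in> trivectors" by (rule vec.subspace_diff[OF subspace_trivectors assms(1,2)])
  note sw = trivectorsD[OF D] trivector_repeat[OF D]
  have "(S - T) $ (a, b, c) = 0" for a b c
  proof -
    define i j k where ijk: "i = idx7 a" "j = idx7 b" "k = idx7 c"
    have r: "1 \<le> i" "i \<le> 7" "1 \<le> j" "j \<le> 7" "1 \<le> k" "k \<le> 7"
      using idx7_range[of a] idx7_range[of b] idx7_range[of c] by (auto simp: ijk)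
    have abc: "a = of_nat i" "b = of_nat j" "c = of_nat k" by (simp_all add: ijk of_nat_idx7)
    have z: "(S - T) $ (of_nat i, of_nat j, of_nat k) = 0" if "1 \<le> i" "i < j" "j < k" "k \<le> 7" for i j k
      using eq[OF that] by (simp add: triple_ix_def)
    consider "i = j \<or> j = k \<or> i = k" | "i < j" "j < k" | "i < k" "k < j" | "j < i" "i < k" | "j < k" "k < i"
      | "k < i" "i < j" | "k < j" "j < i" by linarith
    then show ?thesis
    proof cases
      case 1
      then show ?thesis using sw(3-5) by (auto simp: abc)
    next
      case 2 then show ?thesis using z r by (simp add: abc)
    next
      case 3 then show ?thesis using z[of i k j] r sw(2)[of a c b] by (simp add: abc)
    next
      case 4 then show ?thesis using z[of j i k] r sw(1)[of b a c] by (simp add: abc)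
    next
      case 5 then show ?thesis using z[of j k i] r sw(1)[of b a c] sw(2)[of b c a] by (simp add: abc)
    next
      case 6 then show ?thesis using z[of k i j] r sw(2)[of a c b] sw(1)[of c a b] by (simp add: abc)
    next
      case 7 then show ?thesis using z[of k j i] r sw(1)[of b a c] sw(2)[of b c a] sw(1)[of c b a] by (simp add: abc)
    qed
  qed
  then have "S - T = 0" by (simp add: vec_eq_iff)
  then show ?thesis by simp
qed

definition incr_triples :: "(nat \<times> nat \<times> nat) list" where
  "incr_triples = filter (\<lambda>(i, j, k). i < j \<and> j < k) (List.product [1..<8] (List.product [1..<8] [1..<8]))"

lemma incr_triples_iff: "(i, j, k) \<in> set incr_triples \<longleftrightarrow> 1 \<le> i \<and> i < j \<and> j < k \<and> k \<le> 7"
  unfolding incr_triples_def by auto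

lemma distinct_incr_triples: "distinct incr_triples"
  unfolding incr_triples_def by (intro distinct_filter distinct_product) auto

lemma wedge_coeff_incr: "i < j \<Longrightarrow> j < k \<Longrightarrow> l < m \<Longrightarrow> m < n \<Longrightarrow> wedge_coeff (i, j, k) (l, m, n) = (if (i, j, k) = (l, m, n) then 1 else 0)"
  by (auto simp: kron_def)

definition basis_wedge :: "nat \<times> nat \<times> nat \<Rightarrow> complex ^ (7 \<times> 7 \<times> 7)" where
  "basis_wedge = (\<lambda>(i, j, k). wedge (std i) (std j) (std k))"

lemma trivector_expand:
  assumes "T \<in> trivectors"
  shows "T = (\<Sum>t\<in>set incr_triples. T $ triple_ix t *s basis_wedge t)"
proof (rule trivector_eqI[OF assms])
  show "(\<Sum>t\<in>set incr_triples. T $ triple_ix t *s basis_wedge t) \<in> trivectors"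
    by (intro vec.subspace_sum[OF subspace_trivectors] vec.subspace_scale[OF subspace_trivectors])
      (auto simp: basis_wedge_def wedge_in_trivectors)
  fix l m n :: nat assume lmn: "1 \<le> l" "l < m" "m < n" "n \<le> 7"
  have bw: "basis_wedge t $ triple_ix (l, m, n) = (if t = (l, m, n) then 1 else 0)" if "t \<in> set incr_triples" for t
  proof -
    obtain i j k where t: "t = (i, j, k)" by (cases t) auto
    have ijk: "1 \<le> i" "i < j" "j < k" "k \<le> 7" using that incr_triples_iff t by auto
    have "basis_wedge t $ triple_ix (l, m, n) = of_int (wedge_coeff (i, j, k) (l, m, n))"
      unfolding t basis_wedge_def prod.case by (rule wedge_std_nth) (use ijk lmn in auto)
    then show ?thesis unfolding wedge_coeff_incr[OF ijk(2,3) lmn(2,3)] t by simp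
  qed
  have "(\<Sum>t\<in>set incr_triples. T $ triple_ix t *s basis_wedge t) $ triple_ix (l, m, n)
      = (\<Sum>t\<in>set incr_triples. if t = (l, m, n) then T $ triple_ix (l, m, n) else 0)"
    unfolding sum_component vector_smult_component by (intro sum.cong refl) (simp add: bw)
  then show "T $ triple_ix (l, m, n) = (\<Sum>t\<in>set incr_triples. T $ triple_ix t *s basis_wedge t) $ triple_ix (l, m, n)"
    using incr_triples_iff[of l m n] lmn by simp
qed

text \<open>
  A grading of \<open>F\<close> is given by the list of the weights of \<open>f\<^sub>1, \<dots>, f\<^sub>7\<close>. The pairs \<open>(a, b)\<close> in
  \<open>unipotent_pos\<close> are the positions of the matrix entries that map \<open>f\<^sub>b\<close> to a vector \<open>f\<^sub>a\<close> of lower weight.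
\<close>

definition weight :: "nat list \<Rightarrow> nat \<Rightarrow> nat" where
  "weight hs i = hs ! (i - 1)"

definition unipotent_pos :: "nat list \<Rightarrow> (nat \<times> nat) list" where
  "unipotent_pos hs = filter (\<lambda>(a, b). weight hs a < weight hs b) (List.product [1..<8] [1..<8])"

definition high_triples :: "nat list \<Rightarrow> nat \<Rightarrow> (nat \<times> nat \<times> nat) list" where
  "high_triples hs c = filter (\<lambda>(i, j, k). c \<le> weight hs i + weight hs j + weight hs k) incr_triples"

lemma unipotent_pos_iff:
  "(a, b) \<in> set (unipotent_pos hs) \<longleftrightarrow> a \<in> {1..7} \<and> b \<in> {1..7} \<and> weight hs a < weight hs b"
  unfolding unipotent_pos_def by auto

lemma distinct_unipotent_pos: "distinct (unipotent_pos hs)"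
  unfolding unipotent_pos_def by (intro distinct_filter distinct_product) auto

lemma sum_nth_distinct:
  "distinct xs \<Longrightarrow> (\<Sum>m<length xs. g (xs ! m)) = (\<Sum>x\<in>set xs. g x)" for g :: "'a \<Rightarrow> 'b::comm_monoid_add"
  using sum.reindex_bij_betw[OF bij_betw_nth[of xs "{..<length xs}" "set xs"], of g] by simp

definition high_space :: "nat list \<Rightarrow> nat \<Rightarrow> (complex ^ (7 \<times> 7 \<times> 7)) set" where
  "high_space hs c = {T \<in> trivectors. \<forall>i j k. T $ (i, j, k) \<noteq> 0 \<longrightarrow>
     c \<le> weight hs (idx7 i) + weight hs (idx7 j) + weight hs (idx7 k)}"

lemma high_space_act:
  assumes T: "T \<in> high_space hs c"
    and p: "\<And>i j. p $ i $ j \<noteq> 0 \<Longrightarrow> weight hs (idx7 j) \<le> weight hs (idx7 i)"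
  shows "act p T \<in> high_space hs c"
proof -
  have "c \<le> weight hs (idx7 a) + weight hs (idx7 b) + weight hs (idx7 e)" if "act p T $ (a, b, e) \<noteq> 0" for a b e
  proof -
    have "\<exists>i j k. p $ a $ i * p $ b $ j * p $ e $ k * T $ (i, j, k) \<noteq> 0"
    proof (rule ccontr)
      assume "\<nexists>i j k. p $ a $ i * p $ b $ j * p $ e $ k * T $ (i, j, k) \<noteq> 0"
      then have "p $ a $ i * p $ b $ j * p $ e $ k * T $ (i, j, k) = 0" for i j k by blast
      then show False using that by (simp only: act_nth sum.neutral_const)
    qed
    then obtain i j k where "p $ a $ i * p $ b $ j * p $ e $ k * T $ (i, j, k) \<noteq> 0" by blast
    then have nz: "p $ a $ i \<noteq> 0" "p $ b $ j \<noteq> 0" "p $ e $ k \<noteq> 0" "T $ (i, j, k) \<noteq> 0" by auto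
    have "c \<le> weight hs (idx7 i) + weight hs (idx7 j) + weight hs (idx7 k)"
      using T nz(4) by (simp add: high_space_def)
    then show ?thesis using p[OF nz(1)] p[OF nz(2)] p[OF nz(3)] by linarith
  qed
  then show ?thesis using T act_trivectors by (auto simp: high_space_def)
qed

lemma wedge_sum_high_space:
  assumes "triples7 S" "list_all (\<lambda>(i, j, k). c \<le> weight hs i + weight hs j + weight hs k) S"
  shows "wedge_sum std S \<in> high_space hs c"
  using assms
proof (induction S)
  case Nil
  then show ?case by (simp add: high_space_def vec.subspace_0[OF subspace_trivectors])
next
  case (Cons t S)
  obtain i j k where t: "t = (i, j, k)" by (cases t) auto
  have r: "i \<in> {1..7}" "j \<in> {1..7}" "k \<in> {1..7}" and c: "c \<le> weight hs i + weight hs j + weight hs k"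
    using Cons.prems by (auto simp: t triples7_def in7_def)
  have IH: "wedge_sum std S \<in> high_space hs c" using Cons by (simp add: triples7_def)
  have nz: "c \<le> weight hs (idx7 a) + weight hs (idx7 b) + weight hs (idx7 e)"
    if "wedge (std i) (std j) (std k) $ (a, b, e) \<noteq> 0" for a b e
  proof -
    have s: "idx7 x = i" if "std i $ x \<noteq> 0" "i \<in> {1..7}" for i x
      using that idx7_of_nat[of i] by (auto simp: std_def axis_def split: if_splits)
    define P where "P x y z \<longleftrightarrow> std i $ x \<noteq> 0 \<and> std j $ y \<noteq> 0 \<and> std k $ z \<noteq> 0" for x y z
    have "P a b e \<or> P e a b \<or> P b e a \<or> P a e b \<or> P b a e \<or> P e b a"
    proof (rule ccontr)
      assume "\<not> ?thesis"
      then have "std i $ a * std j $ b * std k $ e = 0" "std i $ b * std j $ e * std k $ a = 0"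
        "std i $ e * std j $ a * std k $ b = 0" "std i $ a * std j $ e * std k $ b = 0"
        "std i $ b * std j $ a * std k $ e = 0" "std i $ e * std j $ b * std k $ a = 0"
        unfolding P_def by auto
      then show False using that by (simp only: wedge_nth) simp
    qed
    moreover have "weight hs (idx7 x) = weight hs i \<and> weight hs (idx7 y) = weight hs j \<and> weight hs (idx7 z) = weight hs k"
      if "P x y z" for x y z using that s r by (auto simp: P_def)
    ultimately show ?thesis using c by (elim disjE) fastforce+
  qed
  have "c \<le> weight hs (idx7 a) + weight hs (idx7 b) + weight hs (idx7 e)"
    if "(wedge (std i) (std j) (std k) + wedge_sum std S) $ (a, b, e) \<noteq> 0" for a b e
    using that nz[of a b e] IH unfolding high_space_def by (cases "wedge (std i) (std j) (std k) $ (a, b, e) = 0") auto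
  then show ?case
    using wedge_sum_trivectors[of std "t # S"] by (simp add: t high_space_def)
qed

text \<open>
  The Kempf collapsing attached to a grading of \<open>F\<close> by weights: the parabolic \<open>P\<close> of matrices that do
  not lower weights preserves the span \<open>W\<close> of the basis trivectors of weight at least \<open>c\<close>, and
  \<open>U P\<close>, where \<open>U\<close> consists of the matrices \<open>1 + u\<close> with \<open>u\<close> lowering weights, is dense. So the orbit of a point
  of \<open>W\<close> lies in the closure of the image of \<open>U \<times> W\<close>.
\<close>

lemma orbit_subset_kempf:
  fixes hs c
  defines "U \<equiv> unipotent_pos hs" and "W \<equiv> high_triples hs c"
  assumes T: "T \<in> high_space hs c"
  shows "\<exists>G. (\<forall>i. (\<lambda>y. G y $ i) \<in> pfun {..<length U + length W}) \<and> orbit T \<subseteq> zcl (range G)"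
proof -
  define d where "d = length U + length W"
  define Ub :: "(nat \<Rightarrow> complex) \<Rightarrow> complex ^ 7 ^ 7"
    where "Ub y = (\<chi> p q. \<Sum>m<length U. y m * (if U ! m = (idx7 p, idx7 q) then 1 else 0))" for y
  define Wb where "Wb y = (\<Sum>n<length W. y (length U + n) *s basis_wedge (W ! n))" for y :: "nat \<Rightarrow> complex"
  define G where "G y = act (mat 1 + Ub y) (Wb y)" for y
  have W: "distinct W" "set W \<subseteq> set incr_triples"
    unfolding W_def high_triples_def using distinct_incr_triples by auto
  have G_pfun: "(\<lambda>y. G y $ i) \<in> pfun {..<d}" for i
    unfolding G_def
  proof (rule pfun_act)
    show "(\<lambda>y. (mat 1 + Ub y) $ a $ b) \<in> pfun {..<d}" for a b
      unfolding Ub_def mat_def vector_add_component vec_lambda_beta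
      by (intro pfun.add pfun_sum pfun.mult pfun.const pfun.var) (auto simp: d_def)
    show "(\<lambda>y. Wb y $ i) \<in> pfun {..<d}" for i
      unfolding Wb_def sum_component vector_smult_component
      by (intro pfun_sum pfun.mult pfun.const pfun.var) (auto simp: d_def)
  qed
  have surj: "act (mat 1 + u) w \<in> range G"
    if u: "\<And>p q. u $ p $ q \<noteq> 0 \<Longrightarrow> weight hs (idx7 p) < weight hs (idx7 q)" and w: "w \<in> high_space hs c" for u w
  proof -
    define y where "y m = (if m < length U then u $ of_nat (fst (U ! m)) $ of_nat (snd (U ! m))
      else w $ triple_ix (W ! (m - length U)))" for m
    have "Ub y $ p $ q = u $ p $ q" for p q
    proof -
      have "Ub y $ p $ q = (\<Sum>m<length U. (\<lambda>x. if x = (idx7 p, idx7 q) then u $ p $ q else 0) (U ! m))"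
        unfolding Ub_def vec_lambda_beta
        by (rule sum.cong) (auto simp: y_def of_nat_idx7)
      also have "\<dots> = (\<Sum>x\<in>set U. if x = (idx7 p, idx7 q) then u $ p $ q else 0)"
        unfolding U_def by (rule sum_nth_distinct[OF distinct_unipotent_pos])
      also have "\<dots> = u $ p $ q"
        using u[of p q] idx7_range[of p] idx7_range[of q] by (auto simp: U_def unipotent_pos_iff)
      finally show ?thesis .
    qed
    then have 1: "Ub y = u" by (simp add: vec_eq_iff)
    have "Wb y = (\<Sum>n<length W. (\<lambda>t. w $ triple_ix t *s basis_wedge t) (W ! n))"
      unfolding Wb_def by (rule sum.cong) (auto simp: y_def)
    also have "\<dots> = (\<Sum>t\<in>set W. w $ triple_ix t *s basis_wedge t)" by (rule sum_nth_distinct[OF W(1)])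
    also have "\<dots> = (\<Sum>t\<in>set incr_triples. w $ triple_ix t *s basis_wedge t)"
    proof (intro sum.mono_neutral_left W(2) ballI)
      fix t assume t: "t \<in> set incr_triples - set W"
      obtain i j k where ijk: "t = (i, j, k)" by (cases t) auto
      have r: "i \<in> {1..7}" "j \<in> {1..7}" "k \<in> {1..7}" using t incr_triples_iff ijk by auto
      have "\<not> c \<le> weight hs i + weight hs j + weight hs k"
        using t by (auto simp: W_def high_triples_def ijk)
      then have "w $ triple_ix t = 0" using w idx7_of_nat[OF r(1)] idx7_of_nat[OF r(2)] idx7_of_nat[OF r(3)]
        unfolding high_space_def ijk triple_ix_def by fastforce
      then show "w $ triple_ix t *s basis_wedge t = 0" by simp
    qed simp
    also have "\<dots> = w" using w trivector_expand[of w] by (simp add: high_space_def)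
    finally have "Wb y = w" .
    then have "act (mat 1 + u) w = G y" using 1 by (simp add: G_def)
    then show ?thesis by simp
  qed
  have "orbit T \<subseteq> zcl (range G)"
  proof
    fix v assume "v \<in> orbit T"
    then obtain g where v: "v = act g T" by (auto simp: orbit_def)
    show "v \<in> zcl (range G)"
    proof (rule zclI)
      fix q assume q: "polynomial_fun q" and van: "\<forall>w\<in>range G. q w = 0"
      define mx :: "(7 \<times> 7 \<Rightarrow> complex) \<Rightarrow> complex ^ 7 ^ 7" where "mx x = (\<chi> a b. x (a, b))" for x
      \<comment> \<open>\<open>x = lo x + hi x\<close> is also the linear part of \<open>(1 + lo x) (1 + hi x) - 1\<close>, so these products are dense\<close>
      define lo where "lo x = (\<lambda>(a, b). if weight hs (idx7 a) < weight hs (idx7 b) then x (a, b) else 0)"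
        for x :: "7 \<times> 7 \<Rightarrow> complex"
      define hi where "hi x = (\<lambda>(a, b). if weight hs (idx7 a) < weight hs (idx7 b) then 0 else x (a, b))"
        for x :: "7 \<times> 7 \<Rightarrow> complex"
      define pr where "pr x = (\<lambda>(a, b). \<Sum>k\<in>UNIV. lo x (a, k) * hi x (k, b))" for x
      define Q where "Q x = q (act (mat 1 + mx x) T)" for x
      have Q: "(\<lambda>x. q (act (mat 1 + mx x) T)) \<in> pfun UNIV"
        using q
      proof (rule polynomial_fun_param)
        show "(\<lambda>x. act (mat 1 + mx x) T $ i) \<in> pfun UNIV" for i
          unfolding mx_def mat_def
          by (intro pfun_act pfun.const) (auto intro!: pfun.add pfun.const pfun.var)
      qed
      have lohi: "mx x = mx (lo x) + mx (hi x)" for x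
        by (simp add: mx_def lo_def hi_def vec_eq_iff)
      have "q (act (mat 1 + mx x) T) = 0" for x
      proof (rule dominant_of_onto_linear_part[where \<Phi> = "\<lambda>x i. x i + pr x i" and M = "\<lambda>x t i. x i + t * pr x i", OF Q])
        show "q (act (mat 1 + mx (\<lambda>i. x i + pr x i)) T) = 0" for x
        proof -
          have "mx (\<lambda>i. x i + pr x i) = mx x + mx (lo x) ** mx (hi x)"
            by (simp add: mx_def pr_def vec_eq_iff matrix_matrix_mult_def)
          then have "mat 1 + mx (\<lambda>i. x i + pr x i) = (mat 1 + mx (lo x)) ** (mat 1 + mx (hi x))"
            by (simp add: lohi[of x] matrix_add_ldistrib matrix_add_right_distrib)
          moreover have "T \<in> trivectors" using T by (simp add: high_space_def)
          ultimately have "act (mat 1 + mx (\<lambda>i. x i + pr x i)) T = act (mat 1 + mx (lo x)) (act (mat 1 + mx (hi x)) T)"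
            by (simp add: act_act)
          also have "\<dots> \<in> range G"
          proof (intro surj high_space_act[OF T])
            show "mx (lo x) $ p $ r \<noteq> 0 \<Longrightarrow> weight hs (idx7 p) < weight hs (idx7 r)" for p r
              by (auto simp: mx_def lo_def split: if_splits)
            show "(mat 1 + mx (hi x)) $ i $ j \<noteq> 0 \<Longrightarrow> weight hs (idx7 j) \<le> weight hs (idx7 i)" for i j
              by (auto simp: mx_def hi_def mat_def split: if_splits)
          qed
          finally show ?thesis using van by blast
        qed
        show "t * x i + pr (\<lambda>j. t * x j) i = t * (x i + t * pr x i)" for x t i
        proof -
          have "lo (\<lambda>j. t * x j) = (\<lambda>j. t * lo x j)" "hi (\<lambda>j. t * x j) = (\<lambda>j. t * hi x j)"
            by (auto simp: lo_def hi_def)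
          then have "pr (\<lambda>j. t * x j) i = t * (t * pr x i)"
            by (cases i) (simp add: pr_def sum_distrib_left mult_ac)
          then show ?thesis by (simp add: distrib_left)
        qed
        show "((\<lambda>t. x i + t * pr x i) \<longlongrightarrow> x i + 0 * pr x i) (at 0)" for x i
          by (intro tendsto_intros)
        show "\<exists>x. \<forall>i\<in>UNIV. x i + 0 * pr x i = z i" for z
          by (rule exI[of _ z]) simp
      qed
      moreover have "mat 1 + mx (\<lambda>(a, b). (g - mat 1) $ a $ b) = g" by (simp add: mx_def vec_eq_iff)
      ultimately show "q v = 0" unfolding v by metis
    qed
  qed
  then show ?thesis using G_pfun unfolding d_def by blast
qed

text \<open>
  The weights and thresholds are chosen such that \<open>dim U + dim W\<close> is the dimension of the orbit.
\<close>

definition kempf_weights :: "(nat list \<times> nat) list" where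
  "kempf_weights = [([0,0,0,0,0,0,0], 1), ([1,1,1,0,0,0,0], 3), ([1,1,1,1,1,0,0], 3), ([1,0,0,0,0,0,0], 1),
     ([1,1,0,1,0,0,0], 2), ([1,1,1,1,1,1,0], 3), ([2,0,1,0,1,0,1], 3), ([2,1,1,2,1,1,0], 4),
     ([1,1,0,1,1,0,0], 2), ([0,0,0,0,0,0,0], 0)]"

lemma kempf_check:
  "list_all2 (\<lambda>S (hs, c). list_all (\<lambda>(i, j, k). c \<le> weight hs i + weight hs j + weight hs k) S)
     rep_triples kempf_weights"
  "map (\<lambda>(hs, c). length (unipotent_pos hs) + length (high_triples hs c)) kempf_weights = orbit_dims"
  by code_simp+

lemma alg_indep_on_le:
  assumes "alg_indep_on X p k" "m \<le> k"
  shows "alg_indep_on X p m"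
  unfolding alg_indep_on_def
proof (intro conjI ballI impI allI)
  show "polynomial_fun (p i)" if "i < m" for i using assms that by (simp add: alg_indep_on_def)
  fix F y assume F: "F \<in> pfun {..<m}" "\<forall>v\<in>X. F (\<lambda>i. p i v) = 0"
  have "(\<lambda>x. F (\<lambda>i. x i)) \<in> pfun {..<k}" by (rule pfun_compose[OF F(1)]) (use assms(2) in \<open>simp add: pfun.var\<close>)
  then have "F \<in> pfun {..<k}" by simp
  then show "F y = 0" using assms(1) F(2) by (simp add: alg_indep_on_def)
qed

lemma orbit_no_not_alg_indep:
  assumes i: "i \<le> 9"
  shows "\<not> alg_indep_on (zcl (orbit_no std i)) p (Suc (orbit_dims ! i))"
proof -
  have l: "length rep_triples = 10" "length kempf_weights = 10" by (simp_all add: rep_triples_def kempf_weights_def)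
  obtain hs c where hc: "kempf_weights ! i = (hs, c)" by force
  have "triples7 (rep_triples ! i)" using slices_check(3) i l by (simp add: list_all_length)
  moreover have "list_all (\<lambda>(i, j, k). c \<le> weight hs i + weight hs j + weight hs k) (rep_triples ! i)"
    using list_all2_nthD[OF kempf_check(1), of i] i l hc by simp
  ultimately have "wedge_sum std (rep_triples ! i) \<in> high_space hs c" by (rule wedge_sum_high_space)
  from orbit_subset_kempf[OF this] obtain G where G: "\<forall>j. (\<lambda>y. G y $ j) \<in> pfun {..<length (unipotent_pos hs) + length (high_triples hs c)}"
    "orbit (wedge_sum std (rep_triples ! i)) \<subseteq> zcl (range G)"
    by (elim exE conjE) (rule that)
  have "length (unipotent_pos hs) + length (high_triples hs c) = orbit_dims ! i"
    using arg_cong[OF kempf_check(2), of "\<lambda>xs. xs ! i"] i l hc by simp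
  moreover have "orbit_no std i = orbit (wedge_sum std (rep_triples ! i))"
    by (simp add: orbit_no_def representatives_nth[OF i])
  ultimately show ?thesis
    using G zcl_mono[OF G(2)] by (intro not_alg_indep_on_parametrized[of G]) auto
qed

lemma krull_dim_orbit_no:
  assumes "i \<le> 9"
  shows "krull_dim (subtopology zariski (orbit_no std i)) = enat (orbit_dims ! i)"
proof (rule antisym)
  show "krull_dim (subtopology zariski (orbit_no std i)) \<le> enat (orbit_dims ! i)"
    using orbit_no_not_alg_indep[OF assms] alg_indep_on_mono[OF _ zcl_superset]
    by (intro krull_dim_le) blast
qed (rule orbit_dim_ge_std[OF assms])

lemma orbit_closure_dim_le:
  assumes "i \<le> 9" "j \<le> 9" "orbit_no std i \<subseteq> zcl (orbit_no std j)"
  shows "orbit_dims ! i \<le> orbit_dims ! j"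
proof (rule ccontr)
  assume "\<not> ?thesis"
  then have le: "Suc (orbit_dims ! j) \<le> orbit_dims ! i" by simp
  obtain \<psi> where "alg_indep_on (orbit_no std i) \<psi> (orbit_dims ! i)"
    using orbit_dim_ge_std(2)[OF assms(1)] by blast
  then have "alg_indep_on (zcl (orbit_no std j)) \<psi> (orbit_dims ! i)" using assms(3) by (rule alg_indep_on_mono)
  then have "alg_indep_on (zcl (orbit_no std j)) \<psi> (Suc (orbit_dims ! j))" using le by (rule alg_indep_on_le)
  then show False using orbit_no_not_alg_indep[OF assms(2)] by blast
qed

section \<open>Changing bases\<close>

lemma basis7_upd:
  assumes f: "basis7 f" and i: "i \<in> {1..7}" and c: "c \<noteq> 0" and v: "v \<in> vec.span (f ` ({1..7} - {i}))"
  shows "basis7 (f(i := c *s f i + v))"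
proof (rule basis7_change[OF f])
  let ?f = "f(i := c *s f i + v)"
  fix j :: nat assume j: "j \<in> {1..7}"
  have oth: "f k \<in> vec.span (?f ` {1..7})" if "k \<in> {1..7} - {i}" for k
    using that by (intro vec.span_base) (auto simp: image_iff intro!: bexI[of _ k])
  have "vec.span (f ` ({1..7} - {i})) \<subseteq> vec.span (?f ` {1..7})"
    by (intro vec.span_minimal vec.subspace_span image_subsetI oth)
  then have v': "v \<in> vec.span (?f ` {1..7})" using v by blast
  show "f j \<in> vec.span (?f ` {1..7})"
  proof (cases "j = i")
    case True
    have "c *s f i + v \<in> vec.span (?f ` {1..7})"
      using i by (intro vec.span_base) (auto simp: image_iff intro!: bexI[of _ i])
    then have "(1/c) *s ((c *s f i + v) - v) \<in> vec.span (?f ` {1..7})"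
      using v' by (intro vec.span_scale vec.span_diff)
    then show ?thesis using True c by simp
  next
    case False
    then show ?thesis using oth j by blast
  qed
qed

lemma in_span_others: "j \<in> {1..7} \<Longrightarrow> j \<noteq> i \<Longrightarrow> f j \<in> vec.span (f ` ({1..7} - {i}))"
  by (intro vec.span_base) auto

lemmas span_lin = vec.span_add vec.span_diff vec.span_neg vec.span_scale vec.span_zero

lemma basis7_perm:
  assumes f: "basis7 f" and p: "p ` {1..7} = {1..7}"
  shows "basis7 (\<lambda>i. f (p i))"
proof (rule basis7_change[OF f])
  fix i :: nat assume "i \<in> {1..7}"
  then obtain j where "j \<in> {1..7}" "i = p j" using p by blast
  then show "f i \<in> vec.span ((\<lambda>i. f (p i)) ` {1..7})" by (intro vec.span_base) auto
qed

lemma basis7_wedge_expand: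
  assumes f: "basis7 f" and T: "T \<in> trivectors"
  shows "\<exists>c. T = (\<Sum>t\<in>set incr_triples. c t *s (case t of (i, j, k) \<Rightarrow> wedge (f i) (f j) (f k)))"
proof -
  obtain g where g: "invertible g" "\<forall>i\<in>{1..7}. g *v std i = f i" using std_to_basis7[OF f] by blast
  obtain h where h: "g ** h = mat 1" using g(1) by (auto simp: invertible_def)
  define S where "S = act h T"
  have S: "S \<in> trivectors" unfolding S_def by (rule act_trivectors[OF T])
  have "T = act g S" unfolding S_def act_act[OF T] h act_one[OF T] ..
  also have "\<dots> = act g (\<Sum>t\<in>set incr_triples. S $ triple_ix t *s basis_wedge t)"
    using trivector_expand[OF S] by simp
  also have "\<dots> = (\<Sum>t\<in>set incr_triples. S $ triple_ix t *s act g (basis_wedge t))"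
    by (simp add: vec.linear_sum[OF linear_act] act_scale)
  also have "\<dots> = (\<Sum>t\<in>set incr_triples. S $ triple_ix t *s (case t of (i, j, k) \<Rightarrow> wedge (f i) (f j) (f k)))"
    using g(2) by (intro sum.cong refl) (auto simp: basis_wedge_def act_wedge incr_triples_iff)
  finally show ?thesis by (intro exI[of _ "\<lambda>t. S $ triple_ix t"])
qed

lemma incr_triples_eq: "incr_triples =
  [(1,2,3),(1,2,4),(1,2,5),(1,2,6),(1,2,7),(1,3,4),(1,3,5),(1,3,6),(1,3,7),(1,4,5),(1,4,6),(1,4,7),
   (1,5,6),(1,5,7),(1,6,7),(2,3,4),(2,3,5),(2,3,6),(2,3,7),(2,4,5),(2,4,6),(2,4,7),(2,5,6),(2,5,7),(2,6,7),
   (3,4,5),(3,4,6),(3,4,7),(3,5,6),(3,5,7),(3,6,7),(4,5,6),(4,5,7),(4,6,7),(5,6,7)]"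
  by code_simp

text \<open>
  \<open>multiples u\<close> is \<open>u \<and> \<Lambda>\<^sup>2 F\<close>, the kernel of the projection to \<open>\<Lambda>\<^sup>3 (F / u)\<close> for \<open>u \<noteq> 0\<close>.
\<close>

definition multiples :: "complex ^ 7 \<Rightarrow> (complex ^ (7 \<times> 7 \<times> 7)) set" where
  "multiples u = vec.span {wedge u x y | x y. True}"

lemma multiples_wedge: "wedge u x y \<in> multiples u" "wedge x u y \<in> multiples u" "wedge x y u \<in> multiples u"
proof -
  show *: "wedge u x y \<in> multiples u" for x y unfolding multiples_def by (rule vec.span_base) blast
  have "- wedge u x y \<in> multiples u" "- wedge u x y \<in> multiples u" using * unfolding multiples_def by (auto intro: vec.span_neg)
  then show "wedge x u y \<in> multiples u" using wedge_swap(1)[of x u y] by simp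
  show "wedge x y u \<in> multiples u" using *[of x y] wedge_swap(2)[of x y u] wedge_swap(1)[of x u y] by simp
qed

lemma multiples_lin:
  "x \<in> multiples u \<Longrightarrow> y \<in> multiples u \<Longrightarrow> x + y \<in> multiples u"
  "x \<in> multiples u \<Longrightarrow> y \<in> multiples u \<Longrightarrow> x - y \<in> multiples u"
  "x \<in> multiples u \<Longrightarrow> - x \<in> multiples u"
  "x \<in> multiples u \<Longrightarrow> c *s x \<in> multiples u"
  "0 \<in> multiples u"
  unfolding multiples_def by (simp_all add: span_lin)

definition pairs6 :: "(nat \<times> nat) list" where
  "pairs6 = [(1,2),(1,3),(1,4),(1,5),(1,6),(2,3),(2,4),(2,5),(2,6),(3,4),(3,5),(3,6),(4,5),(4,6),(5,6)]"

definition form7 :: "(nat \<Rightarrow> complex ^ 7) \<Rightarrow> (nat \<times> nat \<Rightarrow> complex) \<Rightarrow> complex ^ (7 \<times> 7 \<times> 7)" where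
  "form7 f c = (\<Sum>(i, j)\<leftarrow>pairs6. c (i, j) *s wedge (f 7) (f i) (f j))"

lemma form7_expand:
  "form7 f c = c (1,2) *s wedge (f 7) (f 1) (f 2) + c (1,3) *s wedge (f 7) (f 1) (f 3)
    + c (1,4) *s wedge (f 7) (f 1) (f 4) + c (1,5) *s wedge (f 7) (f 1) (f 5) + c (1,6) *s wedge (f 7) (f 1) (f 6)
    + c (2,3) *s wedge (f 7) (f 2) (f 3) + c (2,4) *s wedge (f 7) (f 2) (f 4) + c (2,5) *s wedge (f 7) (f 2) (f 5)
    + c (2,6) *s wedge (f 7) (f 2) (f 6) + c (3,4) *s wedge (f 7) (f 3) (f 4) + c (3,5) *s wedge (f 7) (f 3) (f 5)
    + c (3,6) *s wedge (f 7) (f 3) (f 6) + c (4,5) *s wedge (f 7) (f 4) (f 5) + c (4,6) *s wedge (f 7) (f 4) (f 6)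
    + c (5,6) *s wedge (f 7) (f 5) (f 6)"
  by (simp add: form7_def pairs6_def add.assoc)

lemma multiples_form7:
  assumes f: "basis7 f" and R: "R \<in> multiples (f 7)"
  shows "\<exists>c. R = form7 f c"
proof -
  have add: "form7 f (\<lambda>p. c p + d p) = form7 f c + form7 f d" for c d
    by (simp add: form7_expand vec.scale_left_distrib)
  have scale: "form7 f (\<lambda>p. r * c p) = r *s form7 f c" for r c
    by (simp add: form7_expand vec.scale_right_distrib)
  have sub: "vec.subspace (range (form7 f))"
    unfolding vec.subspace_def
  proof (intro conjI ballI allI)
    have "form7 f (\<lambda>_. 0) = 0" unfolding form7_expand by simp
    then show "0 \<in> range (form7 f)" by (metis rangeI)
  qed (auto simp: add[symmetric] scale[symmetric])
  have base: "wedge (f 7) (f i) (f j) \<in> range (form7 f)" if "(i, j) \<in> set pairs6" for i j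
  proof -
    have "form7 f (\<lambda>p. if p = (i, j) then 1 else 0) = wedge (f 7) (f i) (f j)"
      using that unfolding pairs6_def list.set by (elim insertE emptyE) (simp_all add: form7_expand)
    then show ?thesis by (metis rangeI)
  qed
  have base2: "wedge (f 7) (f i) (f j) \<in> range (form7 f)" if "i \<in> {1..7}" "j \<in> {1..7}" for i j
  proof -
    have p: "(a, b) \<in> set pairs6" if "1 \<le> a" "a < b" "b \<le> 6" for a b
    proof -
      have "a \<in> {1,2,3,4,5,6}" "b \<in> {1,2,3,4,5,6}" using that by auto
      then show ?thesis using that(2) by (elim insertE emptyE) (simp_all add: pairs6_def)
    qed
    have "i \<le> 7" "j \<le> 7" using that by auto
    then consider "i = 7 \<or> j = 7 \<or> i = j" | "i < j" "j \<le> 6" | "j < i" "i \<le> 6" by linarith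
    then show ?thesis
    proof cases
      case 1
      then have "wedge (f 7) (f i) (f j) = 0" by auto
      then show ?thesis using vec.subspace_0[OF sub] by (simp only:)
    next
      case 2
      then show ?thesis using base p that by simp
    next
      case 3
      then have "- wedge (f 7) (f j) (f i) \<in> range (form7 f)"
        using base[of j i] p[of j i] that by (intro vec.subspace_neg[OF sub]) simp
      then show ?thesis using wedge_swap(2)[of "f 7" "f i" "f j"] by simp
    qed
  qed
  have span: "x \<in> vec.span (f ` {1..7})" for x using f by (simp add: basis7_def)
  have "wedge (f 7) (f i) y \<in> range (form7 f)" if "i \<in> {1..7}" for i y
  proof (rule vec.span_induct[OF span[of y]])
    show "vec.subspace {y. wedge (f 7) (f i) y \<in> range (form7 f)}"
      unfolding vec.subspace_def using vec.subspace_0[OF sub] vec.subspace_add[OF sub] vec.subspace_scale[OF sub]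
      by (simp add: wedge_add wedge_scale)
  qed (use base2 that in auto)
  then have "wedge (f 7) x y \<in> range (form7 f)" for x y
    by (intro vec.span_induct[OF span[of x], where P = "\<lambda>x. wedge (f 7) x y \<in> range (form7 f)"])
      (use vec.subspace_0[OF sub] vec.subspace_add[OF sub] vec.subspace_scale[OF sub]
       in \<open>auto simp: vec.subspace_def wedge_add wedge_scale\<close>)
  then have "multiples (f 7) \<subseteq> range (form7 f)"
    unfolding multiples_def by (intro vec.span_minimal sub) auto
  then show ?thesis using R by blast
qed

lemma form7_multiples: "form7 f c \<in> multiples (f 7)"
  unfolding form7_expand by (intro multiples_lin multiples_wedge)

text \<open>
  With \<open>f\<close> fixed these are terminating rewrite rules, which sort the factors of a basis trivector by index.
\<close>

lemma wedge_order:
  "j < i \<Longrightarrow> wedge (f i) (f j) z = - wedge (f j) (f i) z"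
  "j < i \<Longrightarrow> wedge z (f i) (f j) = - wedge z (f j) (f i)"
  for i j :: nat
  by (rule wedge_swap)+

section \<open>Normal forms of matrices\<close>

definition row_add :: "nat \<Rightarrow> nat \<Rightarrow> complex \<Rightarrow> (nat \<Rightarrow> nat \<Rightarrow> complex) \<Rightarrow> nat \<Rightarrow> nat \<Rightarrow> complex" where
  "row_add i j k M = (\<lambda>r s. if r = i then M r s + k * M j s else M r s)"

definition col_add :: "nat \<Rightarrow> nat \<Rightarrow> complex \<Rightarrow> (nat \<Rightarrow> nat \<Rightarrow> complex) \<Rightarrow> nat \<Rightarrow> nat \<Rightarrow> complex" where
  "col_add i j k M = (\<lambda>r s. if s = i then M r s + k * M r j else M r s)"

definition diag3 :: "(nat \<Rightarrow> nat \<Rightarrow> complex) \<Rightarrow> bool" where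
  "diag3 M \<longleftrightarrow> M 0 1 = 0 \<and> M 0 2 = 0 \<and> M 1 0 = 0 \<and> M 1 2 = 0 \<and> M 2 0 = 0 \<and> M 2 1 = 0"

text \<open>
  Gaussian elimination as an induction rule, because each operation is later realised by a change of
  basis. Exchanges are not among the operations: a missing pivot is obtained by adding a row or column.
\<close>

lemma diag_induct:
  assumes diag: "\<And>M. diag3 M \<Longrightarrow> P M"
    and row: "\<And>M i j k. i < 3 \<Longrightarrow> j < 3 \<Longrightarrow> i \<noteq> j \<Longrightarrow> P (row_add i j k M) \<Longrightarrow> P M"
    and col: "\<And>M i j k. i < 3 \<Longrightarrow> j < 3 \<Longrightarrow> i \<noteq> j \<Longrightarrow> P (col_add i j k M) \<Longrightarrow> P M"
  shows "P M"
proof -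
  define B where "B M \<longleftrightarrow> M 0 1 = 0 \<and> M 0 2 = 0 \<and> M 1 0 = 0 \<and> M 2 0 = 0" for M :: "nat \<Rightarrow> nat \<Rightarrow> complex"
  have 1: "P M" if "B M" "M 1 1 \<noteq> 0" for M
  proof -
    define N where "N = col_add 2 1 (- M 1 2 / M 1 1) (row_add 2 1 (- M 2 1 / M 1 1) M)"
    have "diag3 N" using that by (simp add: N_def diag3_def B_def row_add_def col_add_def)
    then have "P (row_add 2 1 (- M 2 1 / M 1 1) M)" unfolding N_def by (intro col[OF _ _ _ diag]) auto
    then show ?thesis by (rule row[rotated -1]) auto
  qed
  have 2: "P M" if "B M" "M 1 1 \<noteq> 0 \<or> M 1 2 \<noteq> 0" for M
  proof (cases "M 1 1 = 0")
    case True
    then show ?thesis using that by (intro col[of 1 2 1 M] 1) (auto simp: B_def col_add_def)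
  qed (use that 1 in blast)
  have 3: "P M" if "B M" for M
  proof (cases "M 1 1 = 0 \<and> M 1 2 = 0")
    case True
    show ?thesis
    proof (cases "M 2 1 = 0")
      case False
      then show ?thesis using that True by (intro row[of 1 2 1 M] 2) (auto simp: B_def row_add_def)
    qed (use that True in \<open>auto intro!: diag simp: diag3_def B_def\<close>)
  qed (use that 2 in blast)
  have 4: "P M" if "M 0 0 \<noteq> 0" for M
  proof -
    define M1 where "M1 = row_add 1 0 (- M 1 0 / M 0 0) M"
    define M2 where "M2 = row_add 2 0 (- M 2 0 / M 0 0) M1"
    define M3 where "M3 = col_add 1 0 (- M 0 1 / M 0 0) M2"
    define M4 where "M4 = col_add 2 0 (- M 0 2 / M 0 0) M3"
    have "B M4" using that by (simp add: M1_def M2_def M3_def M4_def B_def row_add_def col_add_def)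
    then have "P M4" by (rule 3)
    then have "P M3" unfolding M4_def by (rule col[rotated -1]) auto
    then have "P M2" unfolding M3_def by (rule col[rotated -1]) auto
    then have "P M1" unfolding M2_def by (rule row[rotated -1]) auto
    then show "P M" unfolding M1_def by (rule row[rotated -1]) auto
  qed
  have 5: "P M" if "M 0 0 \<noteq> 0 \<or> M 0 1 \<noteq> 0 \<or> M 0 2 \<noteq> 0" for M
  proof (cases "M 0 0 = 0")
    case True
    show ?thesis
    proof (cases "M 0 1 = 0")
      case False
      then show ?thesis using True by (intro col[of 0 1 1 M] 4) (auto simp: col_add_def)
    next
      case T: True
      then show ?thesis using True that by (intro col[of 0 2 1 M] 4) (auto simp: col_add_def)
    qed
  qed (rule 4)
  show "P M"
  proof (cases "M 0 0 \<noteq> 0 \<or> M 0 1 \<noteq> 0 \<or> M 0 2 \<noteq> 0")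
    case False
    then have z: "M 0 0 = 0" "M 0 1 = 0" "M 0 2 = 0" by auto
    consider "M 1 0 \<noteq> 0 \<or> M 1 1 \<noteq> 0 \<or> M 1 2 \<noteq> 0" | "M 2 0 \<noteq> 0 \<or> M 2 1 \<noteq> 0 \<or> M 2 2 \<noteq> 0"
      | "M 1 0 = 0" "M 1 2 = 0" "M 2 0 = 0" "M 2 1 = 0" by blast
    then show ?thesis
    proof cases
      case 1
      then show ?thesis using z by (intro row[of 0 1 1 M] 5) (auto simp: row_add_def)
    next
      case 2
      then show ?thesis using z by (intro row[of 0 2 1 M] 5) (auto simp: row_add_def)
    next
      case 3
      then show ?thesis using z by (intro diag) (simp add: diag3_def)
    qed
  qed (rule 5)
qed

definition sym_add :: "nat \<Rightarrow> nat \<Rightarrow> complex \<Rightarrow> (nat \<Rightarrow> nat \<Rightarrow> complex) \<Rightarrow> nat \<Rightarrow> nat \<Rightarrow> complex" where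
  "sym_add i j k M = col_add i j k (row_add i j k M)"

definition symm3 :: "(nat \<Rightarrow> nat \<Rightarrow> complex) \<Rightarrow> bool" where
  "symm3 M \<longleftrightarrow> M 1 0 = M 0 1 \<and> M 2 0 = M 0 2 \<and> M 2 1 = M 1 2"

lemma symm3_sym_add: "symm3 M \<Longrightarrow> i < 3 \<Longrightarrow> j < 3 \<Longrightarrow> i \<noteq> j \<Longrightarrow> symm3 (sym_add i j k M)"
  by (auto simp: symm3_def sym_add_def col_add_def row_add_def eval_nat_numeral less_Suc_eq)

text \<open>
  The same for symmetric matrices and congruences. A zero pivot is repaired by adding a multiple \<open>k\<close> of
  another row and column, which changes it to \<open>k (2 b + k d)\<close>; a suitable \<open>k\<close> exists as 2 is invertible.
\<close>

lemma symm_diag_induct: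
  assumes S: "symm3 M"
    and diag: "\<And>M. diag3 M \<Longrightarrow> P M"
    and op: "\<And>M i j k. i < 3 \<Longrightarrow> j < 3 \<Longrightarrow> i \<noteq> j \<Longrightarrow> symm3 M \<Longrightarrow> P (sym_add i j k M) \<Longrightarrow> P M"
  shows "P M"
proof -
  have nz: "\<exists>k. k * (2 * b + k * d) \<noteq> 0" if "b \<noteq> 0" for b d :: complex
  proof (cases "d = 0")
    case True
    then show ?thesis using that by (intro exI[of _ 1]) simp
  next
    case False
    then show ?thesis using that by (intro exI[of _ "b / d"]) simp
  qed
  define B where "B M \<longleftrightarrow> symm3 M \<and> M 0 1 = 0 \<and> M 0 2 = 0" for M :: "nat \<Rightarrow> nat \<Rightarrow> complex"
  have 1: "P M" if "B M" "M 1 1 \<noteq> 0" for M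
  proof (rule op[of 2 1 M "- M 2 1 / M 1 1"])
    show "P (sym_add 2 1 (- M 2 1 / M 1 1) M)"
      using that by (intro diag) (simp add: diag3_def B_def symm3_def sym_add_def row_add_def col_add_def)
  qed (use that B_def in simp_all)
  have 2: "P M" if "B M" for M
  proof (cases "M 1 1 = 0 \<and> M 1 2 \<noteq> 0")
    case True
    then obtain k where k: "k * (2 * M 1 2 + k * M 2 2) \<noteq> 0" using nz by blast
    have "B (sym_add 1 2 k M)" "sym_add 1 2 k M 1 1 \<noteq> 0"
      using that k True symm3_sym_add[of M 1 2 k]
      by (auto simp: B_def sym_add_def row_add_def col_add_def symm3_def algebra_simps)
    then have "P (sym_add 1 2 k M)" by (rule 1)
    then show ?thesis using that by (intro op[of 1 2 M k]) (simp_all add: B_def)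
  next
    case False
    show ?thesis
    proof (cases "M 1 1 = 0")
      case True
      then show ?thesis using that False by (intro diag) (simp add: diag3_def B_def symm3_def)
    qed (use 1 that in blast)
  qed
  have 3: "P M" if "symm3 M" "M 0 0 \<noteq> 0" for M
  proof (rule op[of 1 0 M "- M 1 0 / M 0 0"])
    let ?M = "sym_add 1 0 (- M 1 0 / M 0 0) M"
    have s: "symm3 ?M" by (rule symm3_sym_add) (use that in auto)
    show "P ?M"
    proof (rule op[of 2 0 ?M "- M 2 0 / M 0 0"])
      have "symm3 (sym_add 2 0 (- M 2 0 / M 0 0) ?M)" by (rule symm3_sym_add) (use s in auto)
      then show "P (sym_add 2 0 (- M 2 0 / M 0 0) ?M)"
        using that by (intro 2) (simp add: B_def symm3_def sym_add_def row_add_def col_add_def)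
    qed (use s in auto)
  qed (use that in auto)
  have 4: "P M" if M: "symm3 M" "M 0 0 = 0" "M 0 i \<noteq> 0" "i = 1 \<or> i = 2" for M i
  proof -
    obtain k where k: "k * (2 * M 0 i + k * M i i) \<noteq> 0" using nz[OF M(3)] by blast
    have "symm3 (sym_add 0 i k M)" "sym_add 0 i k M 0 0 \<noteq> 0"
      using M k symm3_sym_add[of M 0 i k] by (auto simp: sym_add_def row_add_def col_add_def symm3_def algebra_simps)
    then have "P (sym_add 0 i k M)" by (rule 3)
    then show ?thesis using M by (intro op[of 0 i M k]) auto
  qed
  show ?thesis
  proof (cases "M 0 0 = 0")
    case True
    show ?thesis
    proof (cases "M 0 1 = 0 \<and> M 0 2 = 0")
      case T: True
      then show ?thesis using S by (intro 2) (simp add: B_def)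
    next
      case False
      then show ?thesis using 4[of M] S True by blast
    qed
  qed (use 3 S in blast)
qed

section \<open>Trivectors modulo a line\<close>

definition shear :: "(nat \<Rightarrow> complex ^ 7) \<Rightarrow> nat \<Rightarrow> complex \<Rightarrow> nat \<Rightarrow> complex \<Rightarrow> nat \<Rightarrow> complex ^ 7" where
  "shear f i c j d = f(i := c *s f i + d *s f j)"

lemma basis7_shear:
  "basis7 f \<Longrightarrow> 1 \<le> i \<Longrightarrow> i \<le> 7 \<Longrightarrow> 1 \<le> j \<Longrightarrow> j \<le> 7 \<Longrightarrow> i \<noteq> j \<Longrightarrow> c \<noteq> 0 \<Longrightarrow> basis7 (shear f i c j d)"
  unfolding shear_def by (intro basis7_upd vec.span_scale in_span_others) auto

text \<open>
  The type of \<open>T\<close> modulo a line: \<open>rep_mod k T\<close> compares \<open>T\<close> and the representative of \<open>O\<^sub>k\<close> modulo \<open>f\<^sub>7\<close>.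
\<close>

definition rep_mod :: "nat \<Rightarrow> complex ^ (7 \<times> 7 \<times> 7) \<Rightarrow> bool" where
  "rep_mod k T \<longleftrightarrow> (\<exists>f. basis7 f \<and> T - wedge_sum f (rep_triples ! k) \<in> multiples (f 7))"

definition is_rep :: "nat \<Rightarrow> complex ^ (7 \<times> 7 \<times> 7) \<Rightarrow> bool" where
  "is_rep k T \<longleftrightarrow> (\<exists>f. basis7 f \<and> T = wedge_sum f (rep_triples ! k))"

lemma rep_modI: "basis7 g \<Longrightarrow> T - X \<in> multiples u \<Longrightarrow> u = g 7 \<Longrightarrow> X = wedge_sum g (rep_triples ! k) \<Longrightarrow> rep_mod k T"
  unfolding rep_mod_def by blast

text \<open>
  Rows of \<open>M\<close> belong to \<open>f\<^sub>1, f\<^sub>2, f\<^sub>3\<close> and columns to the basis \<open>f\<^sub>5 \<and> f\<^sub>6, f\<^sub>6 \<and> f\<^sub>4, f\<^sub>4 \<and> f\<^sub>5\<close> dual to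
  \<open>f\<^sub>4, f\<^sub>5, f\<^sub>6\<close>. With this choice the row and column operations on \<open>M\<close> are shears of the two triples of
  basis vectors that keep \<open>[123]\<close> and \<open>[456]\<close>.
\<close>

definition nf6 :: "(nat \<Rightarrow> complex ^ 7) \<Rightarrow> (nat \<Rightarrow> nat \<Rightarrow> complex) \<Rightarrow> complex \<Rightarrow> complex ^ (7 \<times> 7 \<times> 7)" where
  "nf6 f M c = wedge (f 1) (f 2) (f 3)
     + M 0 0 *s wedge (f 1) (f 5) (f 6) + M 0 1 *s wedge (f 1) (f 6) (f 4) + M 0 2 *s wedge (f 1) (f 4) (f 5)
     + M 1 0 *s wedge (f 2) (f 5) (f 6) + M 1 1 *s wedge (f 2) (f 6) (f 4) + M 1 2 *s wedge (f 2) (f 4) (f 5)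
     + M 2 0 *s wedge (f 3) (f 5) (f 6) + M 2 1 *s wedge (f 3) (f 6) (f 4) + M 2 2 *s wedge (f 3) (f 4) (f 5)
     + c *s wedge (f 4) (f 5) (f 6)"

lemmas wedge_expand = wedge_add wedge_diff wedge_minus wedge_scale

lemma less_3_cases: "(i::nat) < 3 \<longleftrightarrow> i = 0 \<or> i = 1 \<or> i = 2"
  by auto

lemma nf6_row_add:
  assumes "i < 3" "j < 3" "i \<noteq> j"
  shows "nf6 f M c = nf6 (shear f (j + 1) 1 (i + 1) (- k)) (row_add i j k M) c"
proof -
  define E where "E i j \<longleftrightarrow> nf6 f M c = nf6 (shear f (j + 1) 1 (i + 1) (- k)) (row_add i j k M) c" for i j
  have "E 0 1" "E 0 2" "E 1 0" "E 1 2" "E 2 0" "E 2 1"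
    unfolding E_def one_add_one add_0
    by (simp add: nf6_def row_add_def shear_def wedge_expand wedge_order[where f = f]; (simp add: vec_eq_iff)?)+
  then have "E i j" using assms unfolding less_3_cases by (elim disjE) simp_all
  then show ?thesis unfolding E_def .
qed

lemma nf6_col_add:
  assumes "i < 3" "j < 3" "i \<noteq> j"
  shows "nf6 f M c = nf6 (shear f (i + 4) 1 (j + 4) k) (col_add i j k M) c"
proof -
  define E where "E i j \<longleftrightarrow> nf6 f M c = nf6 (shear f (i + 4) 1 (j + 4) k) (col_add i j k M) c" for i j
  have "E 0 1" "E 0 2" "E 1 0" "E 1 2" "E 2 0" "E 2 1"
    unfolding E_def one_add_one add_0
    by (simp add: nf6_def col_add_def shear_def wedge_expand wedge_order[where f = f]; (simp add: vec_eq_iff)?)+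
  then have "E i j" using assms unfolding less_3_cases by (elim disjE) simp_all
  then show ?thesis unfolding E_def .
qed

definition rank1 :: "(nat \<Rightarrow> nat \<Rightarrow> complex) \<Rightarrow> bool" where
  "rank1 M \<longleftrightarrow> (\<forall>i<3. \<forall>j<3. \<forall>k<3. \<forall>l<3. M i j * M k l = M i l * M k j)"

definition zero3 :: "(nat \<Rightarrow> nat \<Rightarrow> complex) \<Rightarrow> bool" where
  "zero3 M \<longleftrightarrow> (\<forall>i<3. \<forall>j<3. M i j = 0)"

lemma rank1_row_add:
  assumes "rank1 (row_add i j k M)" "i < 3" "j < 3" "i \<noteq> j" shows "rank1 M"
proof -
  define N where "N = row_add i j k M"
  define e where "e r = (if r = i then k else 0)" for r
  have M: "M r s = N r s - e r * N j s" for r s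
    using assms(4) by (simp add: N_def row_add_def e_def)
  have N: "N a b * N c d = N a d * N c b" if "a < 3" "b < 3" "c < 3" "d < 3" for a b c d
    using assms(1) that unfolding N_def rank1_def by blast
  have "M a b * M c d = M a d * M c b" if "a < 3" "b < 3" "c < 3" "d < 3" for a b c d
    using N[OF that] N[OF assms(3) that(2-4)] N[OF that(1,2) assms(3) that(4)] unfolding M
    by algebra
  then show ?thesis unfolding rank1_def by blast
qed

lemma rank1_col_add:
  assumes "rank1 (col_add i j k M)" "i < 3" "j < 3" "i \<noteq> j" shows "rank1 M"
proof -
  define N where "N = col_add i j k M"
  define e where "e r = (if r = i then k else 0)" for r
  have M: "M r s = N r s - e s * N r j" for r s
    using assms(4) by (simp add: N_def col_add_def e_def)
  have N: "N a b * N c d = N a d * N c b" if "a < 3" "b < 3" "c < 3" "d < 3" for a b c d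
    using assms(1) that unfolding N_def rank1_def by blast
  have "M a b * M c d = M a d * M c b" if "a < 3" "b < 3" "c < 3" "d < 3" for a b c d
    using N[OF that] N[OF that(1) assms(3) that(3,4)] N[OF that(1-3) assms(3)] unfolding M
    by algebra
  then show ?thesis unfolding rank1_def by blast
qed

lemma zero3_row_add: "zero3 (row_add i j k M) \<Longrightarrow> i < 3 \<Longrightarrow> j < 3 \<Longrightarrow> i \<noteq> j \<Longrightarrow> zero3 M"
  unfolding zero3_def row_add_def by (metis add.right_neutral mult_zero_right)

lemma zero3_col_add: "zero3 (col_add i j k M) \<Longrightarrow> i < 3 \<Longrightarrow> j < 3 \<Longrightarrow> i \<noteq> j \<Longrightarrow> zero3 M"
  unfolding zero3_def col_add_def by (metis add.right_neutral mult_zero_right)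

lemma shear_7: "i \<noteq> 7 \<Longrightarrow> shear f i c j d 7 = f 7"
  by (simp add: shear_def)

definition diag_nf :: "(nat \<Rightarrow> complex ^ 7) \<Rightarrow> complex \<Rightarrow> complex \<Rightarrow> complex \<Rightarrow> complex \<Rightarrow> complex ^ (7 \<times> 7 \<times> 7)" where
  "diag_nf f x y z c = wedge (f 1) (f 2) (f 3) + x *s wedge (f 1) (f 5) (f 6)
     + y *s wedge (f 2) (f 6) (f 4) + z *s wedge (f 3) (f 4) (f 5) + c *s wedge (f 4) (f 5) (f 6)"

definition pick :: "nat list \<Rightarrow> (nat \<Rightarrow> complex ^ 7) \<Rightarrow> nat \<Rightarrow> complex ^ 7" where
  "pick ps f i = f (ps ! (i - 1))"

lemma basis7_pick:
  assumes "basis7 f" "length ps = 7" "set ps = {1..7}"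
  shows "basis7 (pick ps f)"
  unfolding pick_def
proof (rule basis7_perm[OF assms(1)])
  have "(\<lambda>i. ps ! (i - 1)) ` {1..7} = (\<lambda>i. ps ! i) ` (\<lambda>i. i - 1) ` {1..7}" by (simp add: image_image)
  also have "(\<lambda>i. i - 1) ` {1..7} = {..<7::nat}"
    by (auto simp: image_iff intro!: bexI[of _ "Suc _"])
  also have "(\<lambda>i. ps ! i) ` {..<7} = set ps" using assms(2) by (auto simp: set_conv_nth)
  finally show "(\<lambda>i. ps ! (i - 1)) ` {1..7} = {1..7}" using assms(3) by simp
qed

lemma set7: "{1..7} = {1,2,3,4,5,6,7::nat}"
  by auto

lemma pick_simps [simp]:
  "pick [a,b,c,d,e,g,h] f 1 = f a" "pick [a,b,c,d,e,g,h] f 2 = f b" "pick [a,b,c,d,e,g,h] f 3 = f c"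
  "pick [a,b,c,d,e,g,h] f 4 = f d" "pick [a,b,c,d,e,g,h] f 5 = f e" "pick [a,b,c,d,e,g,h] f 6 = f g"
  "pick [a,b,c,d,e,g,h] f 7 = f h" "pick [a,b,c,d,e,g,h] f (Suc 0) = f a"
  by (simp_all add: pick_def)

lemma wedge_sum_reps:
  "wedge_sum f (rep_triples ! 0) = 0"
  "wedge_sum f (rep_triples ! 1) = wedge (f 1) (f 2) (f 3)"
  "wedge_sum f (rep_triples ! 2) = wedge (f 1) (f 2) (f 3) + wedge (f 1) (f 4) (f 5)"
  "wedge_sum f (rep_triples ! 3) = wedge (f 1) (f 2) (f 3) + wedge (f 1) (f 4) (f 5) + wedge (f 1) (f 6) (f 7)"
  "wedge_sum f (rep_triples ! 4) = wedge (f 1) (f 2) (f 3) + wedge (f 1) (f 4) (f 5) + wedge (f 2) (f 4) (f 6)"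
  "wedge_sum f (rep_triples ! 5) = wedge (f 1) (f 2) (f 3) + wedge (f 4) (f 5) (f 6)"
  "wedge_sum f (rep_triples ! 6) = wedge (f 1) (f 2) (f 3) + wedge (f 1) (f 4) (f 5) + wedge (f 1) (f 6) (f 7) + wedge (f 3) (f 5) (f 7)"
  "wedge_sum f (rep_triples ! 7) = wedge (f 1) (f 2) (f 3) + wedge (f 4) (f 5) (f 6) + wedge (f 1) (f 4) (f 7)"
  "wedge_sum f (rep_triples ! 8) = wedge (f 1) (f 2) (f 3) + wedge (f 4) (f 5) (f 6) + wedge (f 1) (f 4) (f 7) + wedge (f 2) (f 5) (f 7)"
  "wedge_sum f (rep_triples ! 9) = wedge (f 1) (f 2) (f 3) + wedge (f 4) (f 5) (f 6) + wedge (f 1) (f 4) (f 7) + wedge (f 2) (f 5) (f 7) + wedge (f 3) (f 6) (f 7)"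
  by (simp_all add: rep_triples_def nth_Cons' add.assoc)

lemma diag_nf_cyc: "diag_nf f x y z c = diag_nf (pick [2,3,1,5,6,4,7] f) y z x c"
  by (simp add: diag_nf_def wedge_order[where f = f])

lemma diag_nf_rank1:
  assumes f: "basis7 f" and T: "T - diag_nf f 0 0 z c \<in> multiples (f 7)"
  shows "c \<noteq> 0 \<Longrightarrow> rep_mod 5 T" "c = 0 \<Longrightarrow> z \<noteq> 0 \<Longrightarrow> rep_mod 2 T"
proof -
  assume c: "c \<noteq> 0"
  show "rep_mod 5 T"
  proof (rule rep_modI[OF _ T])
    show "basis7 (shear f 6 c 3 z)" using f c by (intro basis7_shear) auto
  qed (simp_all add: diag_nf_def wedge_sum_reps shear_def wedge_expand wedge_order[where f = f])
next
  assume c: "c = 0" "z \<noteq> 0"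
  show "rep_mod 2 T"
  proof (rule rep_modI[OF _ T])
    show "basis7 (pick [3,1,2,4,5,6,7] (shear f 4 z 1 0))"
      using f c by (intro basis7_shear basis7_pick) (auto simp: set7)
  qed (simp_all add: diag_nf_def wedge_sum_reps shear_def wedge_expand wedge_order[where f = f] c)
qed

lemma diag_nf_rank2:
  assumes f: "basis7 f" and T: "T - diag_nf f 0 y z c \<in> multiples (f 7)" and yz: "y \<noteq> 0" "z \<noteq> 0"
  shows "rep_mod 4 T \<or> rep_mod 5 T"
proof (cases "c = 0")
  case True
  have "rep_mod 4 T"
  proof (rule rep_modI[OF _ T])
    show "basis7 (pick [2,3,1,4,6,5,7] (shear (shear f 6 (-y) 1 0) 5 z 1 0))"
      using f yz by (intro basis7_shear basis7_pick) (auto simp: set7)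
  qed (simp_all add: diag_nf_def wedge_sum_reps shear_def wedge_expand wedge_order[where f = f] True)
  then show ?thesis ..
next
  case False
  have "rep_mod 5 T"
  proof (rule rep_modI[OF _ T])
    show "basis7 (shear (shear (shear f 1 1 4 (- (y * z / c))) 5 1 2 (y / c)) 6 c 3 z)"
      using f False by (intro basis7_shear) auto
    show "diag_nf f 0 y z c = wedge_sum (shear (shear (shear f 1 1 4 (- (y * z / c))) 5 1 2 (y / c)) 6 c 3 z) (rep_triples ! 5)"
      using False by (simp add: diag_nf_def wedge_sum_reps shear_def wedge_expand wedge_order[where f = f])
  qed (simp add: shear_def)
  then show ?thesis ..
qed

text \<open>
  A cyclically symmetric form of the fourth representative: the derivative of \<open>[123]\<close> in the direction
  \<open>f\<^sub>1 \<mapsto> f\<^sub>4, f\<^sub>2 \<mapsto> f\<^sub>5, f\<^sub>3 \<mapsto> f\<^sub>6\<close>, that is, a tangent vector of the cone of decomposable trivectors.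
\<close>

definition cyc4 :: "(nat \<Rightarrow> complex ^ 7) \<Rightarrow> complex ^ (7 \<times> 7 \<times> 7)" where
  "cyc4 f = wedge (f 2) (f 3) (f 4) + wedge (f 3) (f 1) (f 5) + wedge (f 1) (f 2) (f 6)"

lemma cyc4_rep: "cyc4 f = wedge_sum (pick [1,2,6,3,5,4,7] (shear f 5 (-1) 1 0)) (rep_triples ! 4)"
  by (simp add: cyc4_def wedge_sum_reps shear_def wedge_expand wedge_order[where f = f])

lemma basis7_cyc4: "basis7 f \<Longrightarrow> basis7 (pick [1,2,6,3,5,4,7] (shear f 5 (-1) 1 0))"
  by (intro basis7_pick basis7_shear) (auto simp: set7)

lemma rep_cyc4: "wedge_sum f (rep_triples ! 4) = cyc4 (pick [1,2,4,6,5,3,7] (shear f 5 (-1) 1 0))"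
  by (simp add: cyc4_def wedge_sum_reps shear_def wedge_expand wedge_order[where f = f])

lemma wedge_pencil:
  "\<alpha> *s wedge (a + r *s x) (b + r *s y) (c + r *s z) + \<beta> *s wedge (a + s *s x) (b + s *s y) (c + s *s z) =
   (\<alpha> + \<beta>) *s wedge a b c + (\<alpha> * r + \<beta> * s) *s (wedge x b c + wedge a y c + wedge a b z)
   + (\<alpha> * (r * r) + \<beta> * (s * s)) *s (wedge a y z + wedge x b z + wedge x y c)
   + (\<alpha> * (r * r * r) + \<beta> * (s * s * s)) *s wedge x y z"
  by (simp add: wedge_expand) (simp add: vec_eq_iff algebra_simps)

text \<open>
  The aim is to write the trivector as
  \<open>\<alpha> (f\<^sub>1 + r f\<^sub>4) \<and> (f\<^sub>2 + r f\<^sub>5) \<and> (f\<^sub>3 + r f\<^sub>6) + \<beta> (f\<^sub>1 + s f\<^sub>4) \<and> (f\<^sub>2 + s f\<^sub>5) \<and> (f\<^sub>3 + s f\<^sub>6)\<close>. Comparing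
  coefficients, the moments \<open>\<alpha> r\<^sup>n + \<beta> s\<^sup>n\<close> for \<open>n = 0, 1, 2, 3\<close> must be \<open>1, 0, 1, c\<close>. This sequence satisfies the
  recursion of the polynomial \<open>t\<^sup>2 - c t - 1\<close>, whose roots serve as \<open>r\<close> and \<open>s\<close>. For a double root the two
  summands collapse to a tangent vector, the form \<open>cyc4\<close>.
\<close>

lemma diag_nf_unit:
  assumes f: "basis7 f" and T: "T - diag_nf f 1 1 1 c \<in> multiples (f 7)"
  shows "rep_mod 4 T \<or> rep_mod 5 T"
proof -
  define e where "e = csqrt (c\<^sup>2 + 4)"
  define r s where "r = (c + e) / 2" and "s = (c - e) / 2"
  have e2: "e * e = c * c + 4" unfolding e_def by (metis power2_csqrt power2_eq_square)
  have rs: "r + s = c" "r * s = -1" using e2 by (simp_all add: r_def s_def field_simps)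
  then have nz: "r \<noteq> 0" "s \<noteq> 0" by auto
  show ?thesis
  proof (cases "r = s")
    case False
    define \<alpha> \<beta> where "\<alpha> = - s / (r - s)" and "\<beta> = r / (r - s)"
    have d: "r - s \<noteq> 0" using False by simp
    have ab: "\<alpha> + \<beta> = 1" "\<alpha> * r + \<beta> * s = 0"
    proof -
      have "\<alpha> + \<beta> = (- s + r) / (r - s)" unfolding \<alpha>_def \<beta>_def by (rule add_divide_distrib[symmetric])
      then show "\<alpha> + \<beta> = 1" using d by simp
      show "\<alpha> * r + \<beta> * s = 0" unfolding \<alpha>_def \<beta>_def by simp
    qed
    have ab2: "\<alpha> * (r * r) + \<beta> * (s * s) = 1"
    proof -
      have "\<alpha> * (r * r) + \<beta> * (s * s) = (- (r * s)) * (r - s) / (r - s)"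
        unfolding \<alpha>_def \<beta>_def by (simp add: algebra_simps add_divide_distrib[symmetric] diff_divide_distrib[symmetric])
      then have "\<alpha> * (r * r) + \<beta> * (s * s) = - (r * s)" using d by simp
      then show ?thesis using rs by simp
    qed
    have ab3: "\<alpha> * (r * r * r) + \<beta> * (s * s * s) = c"
    proof -
      have "\<alpha> * (r * r * r) + \<beta> * (s * s * s) = (- (r * s) * (r + s)) * (r - s) / (r - s)"
        unfolding \<alpha>_def \<beta>_def by (simp add: algebra_simps add_divide_distrib[symmetric] diff_divide_distrib[symmetric])
      then have "\<alpha> * (r * r * r) + \<beta> * (s * s * s) = - (r * s) * (r + s)" using d by simp
      then show ?thesis using rs by simp
    qed
    have nz2: "\<alpha> \<noteq> 0" "\<beta> \<noteq> 0" "s - r \<noteq> 0" using nz d by (auto simp: \<alpha>_def \<beta>_def)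
    define g where "g = shear (shear (shear (shear (shear (shear (shear (shear f 1 1 4 r) 2 1 5 r) 3 1 6 r)
      4 (s - r) 1 1) 5 (s - r) 2 1) 6 (s - r) 3 1) 1 \<alpha> 2 0) 4 \<beta> 2 0"
    have "basis7 g" unfolding g_def using f nz2 by (intro basis7_shear) auto
    moreover have g: "g 1 = \<alpha> *s (f 1 + r *s f 4)" "g 2 = f 2 + r *s f 5" "g 3 = f 3 + r *s f 6"
      "g 4 = \<beta> *s (f 1 + s *s f 4)" "g 5 = f 2 + s *s f 5" "g 6 = f 3 + s *s f 6" "g 7 = f 7"
      by (simp_all add: g_def shear_def vec_eq_iff algebra_simps)
    moreover have "wedge_sum g (rep_triples ! 5) = diag_nf f 1 1 1 c"
      unfolding wedge_sum_reps g wedge_scale(1) wedge_pencil ab ab2 ab3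
      by (simp add: diag_nf_def wedge_order[where f = f])
    ultimately show ?thesis using rep_modI[OF _ T, of g 5] by simp
  next
    case True
    have c: "c = 2 * r" and r2: "r * r = -1" using rs True by auto
    have r2': "r * (r * x) = - x" for x using r2 by (metis mult.assoc mult_minus1)
    define h where "h = shear (shear (shear (shear (shear (shear f 1 1 4 r) 2 1 5 r) 3 1 6 r) 4 (- r) 1 (1/3)) 5 (- r) 2 (1/3)) 6 (- r) 3 (1/3)"
    have "basis7 h" unfolding h_def using f nz by (intro basis7_shear) auto
    moreover have "cyc4 h = diag_nf f 1 1 1 c"
      unfolding h_def c by (simp add: cyc4_def diag_nf_def shear_def wedge_expand wedge_order[where f = f])
        (simp add: vec_eq_iff algebra_simps r2 r2')
    moreover have "h 7 = f 7" by (simp add: h_def shear_def)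
    ultimately have "rep_mod 4 T"
      by (intro rep_modI[OF basis7_cyc4[of h] T]) (simp_all add: cyc4_rep shear_7)
    then show ?thesis ..
  qed
qed

text \<open>
  The scaling factors \<open>l, m, n\<close> of \<open>f\<^sub>4, f\<^sub>5, f\<^sub>6\<close> have to satisfy \<open>m n = x\<close>, \<open>n l = y\<close> and \<open>l m = z\<close>.
\<close>

lemma diag_nf_rank3:
  assumes f: "basis7 f" and T: "T - diag_nf f x y z c \<in> multiples (f 7)" and nz: "x \<noteq> 0" "y \<noteq> 0" "z \<noteq> 0"
  shows "rep_mod 4 T \<or> rep_mod 5 T"
proof -
  define l where "l = csqrt (y * z / x)"
  have l2: "l * l = y * z / x" unfolding l_def by (metis power2_csqrt power2_eq_square)
  have l: "l \<noteq> 0" using l2 nz by auto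
  define m n where "m = z / l" and "n = y / l"
  have mn: "m \<noteq> 0" "n \<noteq> 0" "n * l = y" "l * m = z" using l nz by (auto simp: m_def n_def)
  have mn2: "m * n = x"
  proof -
    have "m * n = y * z / (l * l)" by (simp add: m_def n_def)
    then show ?thesis using nz by (simp add: l2)
  qed
  define g where "g = shear (shear (shear f 4 l 1 0) 5 m 1 0) 6 n 1 0"
  have g: "basis7 g" unfolding g_def using f l mn by (intro basis7_shear) auto
  have e: "m * n * w = x * w" "n * l * w = y * w" "l * m * w = z * w" for w using mn mn2 by simp_all
  have "diag_nf g 1 1 1 (c / (l * m * n)) = wedge (f 1) (f 2) (f 3) + (m * n) *s wedge (f 1) (f 5) (f 6)
     + (n * l) *s wedge (f 2) (f 6) (f 4) + (l * m) *s wedge (f 3) (f 4) (f 5) + c *s wedge (f 4) (f 5) (f 6)"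
    using l mn(1,2) by (simp add: g_def diag_nf_def shear_def wedge_expand) (simp add: vec_eq_iff field_simps)
  then have "diag_nf g 1 1 1 (c / (l * m * n)) = diag_nf f x y z c"
    unfolding mn mn2 diag_nf_def .
  moreover have "g 7 = f 7" by (simp add: g_def shear_def)
  ultimately show ?thesis using diag_nf_unit[OF g, of T "c / (l * m * n)"] T by simp
qed

lemma diag_nf_classify:
  assumes f: "basis7 f" and T: "T - diag_nf f x y z c \<in> multiples (f 7)"
  shows "c \<noteq> 0 \<or> (x \<noteq> 0 \<and> y \<noteq> 0 \<or> y \<noteq> 0 \<and> z \<noteq> 0 \<or> x \<noteq> 0 \<and> z \<noteq> 0) \<Longrightarrow> rep_mod 4 T \<or> rep_mod 5 T"
    "x \<noteq> 0 \<or> y \<noteq> 0 \<or> z \<noteq> 0 \<Longrightarrow> rep_mod 2 T \<or> rep_mod 4 T \<or> rep_mod 5 T"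
proof -
  let ?p = "[2,3,1,5,6,4,7]"
  define f1 where "f1 = pick ?p f"
  define f2 where "f2 = pick ?p f1"
  have f1: "basis7 f1" unfolding f1_def by (rule basis7_pick[OF f]) (auto simp: set7)
  have f2: "basis7 f2" unfolding f2_def by (rule basis7_pick[OF f1]) (auto simp: set7)
  have T1: "T - diag_nf f1 y z x c \<in> multiples (f1 7)" using T by (simp add: diag_nf_cyc[of f] f1_def)
  have T2: "T - diag_nf f2 z x y c \<in> multiples (f2 7)" using T1 by (simp add: diag_nf_cyc[of f1] f2_def)
  have "rep_mod 4 T \<or> rep_mod 5 T" if "x \<noteq> 0 \<and> y \<noteq> 0 \<or> y \<noteq> 0 \<and> z \<noteq> 0 \<or> x \<noteq> 0 \<and> z \<noteq> 0"
    using that diag_nf_rank3[OF f T] diag_nf_rank2[OF f, of T y z c] diag_nf_rank2[OF f1, of T z x c]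
      diag_nf_rank2[OF f2, of T x y c] T T1 T2 by (cases "x = 0"; cases "y = 0"; cases "z = 0"; simp)
  moreover have "(c \<noteq> 0 \<longrightarrow> rep_mod 5 T) \<and> (c = 0 \<longrightarrow> x \<noteq> 0 \<or> y \<noteq> 0 \<or> z \<noteq> 0 \<longrightarrow> rep_mod 2 T)"
    if "\<not> (x \<noteq> 0 \<and> y \<noteq> 0 \<or> y \<noteq> 0 \<and> z \<noteq> 0 \<or> x \<noteq> 0 \<and> z \<noteq> 0)"
    using that diag_nf_rank1[OF f, of T z c] diag_nf_rank1[OF f1, of T x c]
      diag_nf_rank1[OF f2, of T y c] T T1 T2 by (cases "c = 0"; cases "x = 0"; cases "y = 0"; cases "z = 0"; simp)
  ultimately show "c \<noteq> 0 \<or> (x \<noteq> 0 \<and> y \<noteq> 0 \<or> y \<noteq> 0 \<and> z \<noteq> 0 \<or> x \<noteq> 0 \<and> z \<noteq> 0) \<Longrightarrow> rep_mod 4 T \<or> rep_mod 5 T"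
    "x \<noteq> 0 \<or> y \<noteq> 0 \<or> z \<noteq> 0 \<Longrightarrow> rep_mod 2 T \<or> rep_mod 4 T \<or> rep_mod 5 T" by blast+
qed

lemma all_less_3: "(\<forall>i<(3::nat). P i) \<longleftrightarrow> P 0 \<and> P 1 \<and> P 2"
  by (auto simp: less_3_cases)

lemma nf6_classify:
  assumes "basis7 f" "T - nf6 f M c \<in> multiples (f 7)"
  shows "c \<noteq> 0 \<or> \<not> rank1 M \<Longrightarrow> rep_mod 4 T \<or> rep_mod 5 T"
    "\<not> zero3 M \<Longrightarrow> rep_mod 2 T \<or> rep_mod 4 T \<or> rep_mod 5 T"
proof -
  define P where "P M \<longleftrightarrow> (\<forall>f. basis7 f \<longrightarrow> T - nf6 f M c \<in> multiples (f 7) \<longrightarrow>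
     (c \<noteq> 0 \<or> \<not> rank1 M \<longrightarrow> rep_mod 4 T \<or> rep_mod 5 T) \<and>
     (\<not> zero3 M \<longrightarrow> rep_mod 2 T \<or> rep_mod 4 T \<or> rep_mod 5 T))" for M
  have "P M"
  proof (rule diag_induct[of P])
    fix M assume M: "diag3 M"
    have nf: "nf6 f M c = diag_nf f (M 0 0) (M 1 1) (M 2 2) c" for f
      using M by (simp add: nf6_def diag_nf_def diag3_def)
    have "M 0 0 \<noteq> 0 \<and> M 1 1 \<noteq> 0 \<or> M 1 1 \<noteq> 0 \<and> M 2 2 \<noteq> 0 \<or> M 0 0 \<noteq> 0 \<and> M 2 2 \<noteq> 0" if "\<not> rank1 M"
    proof (rule ccontr)
      assume n: "\<not> ?thesis"
      have "rank1 M"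
        using M n unfolding rank1_def all_less_3 diag3_def by (cases "M 0 0 = 0"; cases "M 1 1 = 0"; simp)
      then show False using that by simp
    qed
    moreover have "M 0 0 \<noteq> 0 \<or> M 1 1 \<noteq> 0 \<or> M 2 2 \<noteq> 0" if "\<not> zero3 M"
      using that M unfolding zero3_def all_less_3 diag3_def by auto
    ultimately show "P M" unfolding P_def nf using diag_nf_classify[of _ T "M 0 0" "M 1 1" "M 2 2" c] by blast
  next
    fix M i j k assume ij: "i < (3::nat)" "j < 3" "i \<noteq> j" and IH: "P (row_add i j k M)"
    show "P M" unfolding P_def
    proof (intro allI impI)
      fix f assume f: "basis7 f" and T: "T - nf6 f M c \<in> multiples (f 7)"
      have g: "basis7 (shear f (j + 1) 1 (i + 1) (- k))" using f ij by (intro basis7_shear) auto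
      have "T - nf6 (shear f (j + 1) 1 (i + 1) (- k)) (row_add i j k M) c \<in> multiples (shear f (j + 1) 1 (i + 1) (- k) 7)"
        using T ij unfolding nf6_row_add[OF ij, of f M c k] by (simp add: shear_def)
      then show "(c \<noteq> 0 \<or> \<not> rank1 M \<longrightarrow> rep_mod 4 T \<or> rep_mod 5 T) \<and>
        (\<not> zero3 M \<longrightarrow> rep_mod 2 T \<or> rep_mod 4 T \<or> rep_mod 5 T)"
        using IH g rank1_row_add[OF _ ij] zero3_row_add[OF _ ij] unfolding P_def by blast
    qed
  next
    fix M i j k assume ij: "i < (3::nat)" "j < 3" "i \<noteq> j" and IH: "P (col_add i j k M)"
    show "P M" unfolding P_def
    proof (intro allI impI)
      fix f assume f: "basis7 f" and T: "T - nf6 f M c \<in> multiples (f 7)"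
      have g: "basis7 (shear f (i + 4) 1 (j + 4) k)" using f ij by (intro basis7_shear) auto
      have "T - nf6 (shear f (i + 4) 1 (j + 4) k) (col_add i j k M) c \<in> multiples (shear f (i + 4) 1 (j + 4) k 7)"
        using T ij unfolding nf6_col_add[OF ij, of f M c k] by (simp add: shear_def)
      then show "(c \<noteq> 0 \<or> \<not> rank1 M \<longrightarrow> rep_mod 4 T \<or> rep_mod 5 T) \<and>
        (\<not> zero3 M \<longrightarrow> rep_mod 2 T \<or> rep_mod 4 T \<or> rep_mod 5 T)"
        using IH g rank1_col_add[OF _ ij] zero3_col_add[OF _ ij] unfolding P_def by blast
    qed
  qed
  then show "c \<noteq> 0 \<or> \<not> rank1 M \<Longrightarrow> rep_mod 4 T \<or> rep_mod 5 T"
    "\<not> zero3 M \<Longrightarrow> rep_mod 2 T \<or> rep_mod 4 T \<or> rep_mod 5 T"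
    using assms unfolding P_def by blast+
qed

text \<open>
  Shears within \<open>f\<^sub>1, f\<^sub>2, f\<^sub>3\<close> and within \<open>f\<^sub>4, f\<^sub>5, f\<^sub>6\<close> keep \<open>[123] + [456]\<close> and act on the matrix \<open>M\<close> by row
  and column operations.
\<close>

definition nf7 :: "(nat \<Rightarrow> complex ^ 7) \<Rightarrow> (nat \<Rightarrow> nat \<Rightarrow> complex) \<Rightarrow> complex ^ (7 \<times> 7 \<times> 7)" where
  "nf7 f M = wedge (f 1) (f 2) (f 3) + wedge (f 4) (f 5) (f 6)
     + M 0 0 *s wedge (f 1) (f 4) (f 7) + M 0 1 *s wedge (f 1) (f 5) (f 7) + M 0 2 *s wedge (f 1) (f 6) (f 7)
     + M 1 0 *s wedge (f 2) (f 4) (f 7) + M 1 1 *s wedge (f 2) (f 5) (f 7) + M 1 2 *s wedge (f 2) (f 6) (f 7)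
     + M 2 0 *s wedge (f 3) (f 4) (f 7) + M 2 1 *s wedge (f 3) (f 5) (f 7) + M 2 2 *s wedge (f 3) (f 6) (f 7)"

lemma nf7_row_add:
  assumes "i < 3" "j < 3" "i \<noteq> j"
  shows "nf7 f M = nf7 (shear f (j + 1) 1 (i + 1) (- k)) (row_add i j k M)"
proof -
  define E where "E i j \<longleftrightarrow> nf7 f M = nf7 (shear f (j + 1) 1 (i + 1) (- k)) (row_add i j k M)" for i j
  have "E 0 1" "E 0 2" "E 1 0" "E 1 2" "E 2 0" "E 2 1"
    unfolding E_def one_add_one add_0
    by (simp add: nf7_def row_add_def shear_def wedge_expand wedge_order[where f = f]; (simp add: vec_eq_iff)?)+
  then have "E i j" using assms unfolding less_3_cases by (elim disjE) simp_all
  then show ?thesis unfolding E_def .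
qed

lemma nf7_col_add:
  assumes "i < 3" "j < 3" "i \<noteq> j"
  shows "nf7 f M = nf7 (shear f (j + 4) 1 (i + 4) (- k)) (col_add i j k M)"
proof -
  define E where "E i j \<longleftrightarrow> nf7 f M = nf7 (shear f (j + 4) 1 (i + 4) (- k)) (col_add i j k M)" for i j
  have "E 0 1" "E 0 2" "E 1 0" "E 1 2" "E 2 0" "E 2 1"
    unfolding E_def one_add_one add_0
    by (simp add: nf7_def col_add_def shear_def wedge_expand wedge_order[where f = f]; (simp add: vec_eq_iff)?)+
  then have "E i j" using assms unfolding less_3_cases by (elim disjE) simp_all
  then show ?thesis unfolding E_def .
qed

lemma is_repI: "basis7 g \<Longrightarrow> T = wedge_sum g (rep_triples ! k) \<Longrightarrow> is_rep k T"
  unfolding is_rep_def by blast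

definition nf7d :: "(nat \<Rightarrow> complex ^ 7) \<Rightarrow> complex \<Rightarrow> complex \<Rightarrow> complex \<Rightarrow> complex ^ (7 \<times> 7 \<times> 7)" where
  "nf7d f x y z = wedge (f 1) (f 2) (f 3) + wedge (f 4) (f 5) (f 6)
     + x *s wedge (f 1) (f 4) (f 7) + y *s wedge (f 2) (f 5) (f 7) + z *s wedge (f 3) (f 6) (f 7)"

lemma nf7d_cyc: "nf7d f x y z = nf7d (pick [2,3,1,5,6,4,7] f) y z x"
  by (simp add: nf7d_def wedge_order[where f = f])

lemma nf7d_1: "basis7 f \<Longrightarrow> x \<noteq> 0 \<Longrightarrow> is_rep 7 (nf7d f x 0 0)"
  by (rule is_repI[of "shear f 7 x 1 0"])
    (intro basis7_shear, simp_all add: nf7d_def wedge_sum_reps shear_def wedge_expand)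

lemma nf7d_2: "basis7 f \<Longrightarrow> x \<noteq> 0 \<Longrightarrow> y \<noteq> 0 \<Longrightarrow> is_rep 8 (nf7d f x y 0)"
  by (rule is_repI[of "shear (shear (shear f 7 x 1 0) 2 (y / x) 1 0) 3 (x / y) 1 0"])
    (intro basis7_shear, simp_all add: nf7d_def wedge_sum_reps shear_def wedge_expand)

lemma cube_root_exists: "\<exists>t::complex. t ^ 3 = w"
proof (cases "w = 0")
  case False
  have "exp (Ln w / 3) ^ 3 = exp (3 * (Ln w / 3))" by (simp only: exp_of_nat_mult[symmetric]) simp
  then show ?thesis using False by (intro exI[of _ "exp (Ln w / 3)"]) simp
qed (rule exI[of _ 0], simp)

lemma nf7d_3:
  assumes f: "basis7 f" and nz: "x \<noteq> 0" "y \<noteq> 0" "z \<noteq> 0"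
  shows "is_rep 9 (nf7d f x y z)"
proof -
  obtain t where t: "t ^ 3 = x * y * z" using cube_root_exists by blast
  then have t0: "t \<noteq> 0" using nz by auto
  \<comment> \<open>scaling \<open>f\<^sub>7\<close> by \<open>t\<close> and \<open>f\<^sub>1, f\<^sub>2, f\<^sub>3\<close> by \<open>x/t, y/t, z/t\<close> keeps \<open>[123]\<close> exactly if \<open>t\<^sup>3 = x y z\<close>\<close>
  define g where "g = shear (shear (shear (shear f 7 t 1 0) 1 (x / t) 2 0) 2 (y / t) 1 0) 3 (z / t) 1 0"
  have "basis7 g" unfolding g_def using f nz t0 by (intro basis7_shear) auto
  moreover have "nf7d f x y z = wedge_sum g (rep_triples ! 9)"
  proof -
    have "wedge_sum g (rep_triples ! 9) = (x * y * z / t ^ 3) *s wedge (f 1) (f 2) (f 3) + wedge (f 4) (f 5) (f 6)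
      + x *s wedge (f 1) (f 4) (f 7) + y *s wedge (f 2) (f 5) (f 7) + z *s wedge (f 3) (f 6) (f 7)"
      using t0 by (simp add: g_def wedge_sum_reps shear_def wedge_expand power3_eq_cube mult_ac)
    then show ?thesis using t t0 nz by (simp add: nf7d_def)
  qed
  ultimately show ?thesis by (rule is_repI)
qed

lemma nf7d_classify:
  assumes f: "basis7 f"
  shows "\<exists>k\<in>{5,7,8,9}. is_rep k (nf7d f x y z)"
proof -
  define f1 where "f1 = pick [2,3,1,5,6,4,7] f"
  define f2 where "f2 = pick [2,3,1,5,6,4,7] f1"
  have f1: "basis7 f1" unfolding f1_def by (rule basis7_pick[OF f]) (auto simp: set7)
  have f2: "basis7 f2" unfolding f2_def by (rule basis7_pick[OF f1]) (auto simp: set7)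
  have c: "nf7d f x y z = nf7d f1 y z x" "nf7d f1 y z x = nf7d f2 z x y"
    unfolding f2_def f1_def by (rule nf7d_cyc)+
  have 0: "is_rep 5 (nf7d f 0 0 0)" by (rule is_repI[OF f]) (simp add: nf7d_def wedge_sum_reps)
  show ?thesis
    using 0 nf7d_1[OF f, of x] nf7d_1[OF f1, of y] nf7d_1[OF f2, of z] nf7d_2[OF f, of x y]
      nf7d_2[OF f1, of y z] nf7d_2[OF f2, of z x] nf7d_3[OF f, of x y z] c
    by (cases "x = 0"; cases "y = 0"; cases "z = 0"; simp)
qed

lemma nf7_classify: "basis7 f \<Longrightarrow> \<exists>k\<in>{5,7,8,9}. is_rep k (nf7 f M)"
proof (induction M arbitrary: f rule: diag_induct)
  case (1 M)
  have "nf7 f M = nf7d f (M 0 0) (M 1 1) (M 2 2)" using 1(1) by (simp add: nf7_def nf7d_def diag3_def)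
  then show ?case using nf7d_classify[OF 1(2)] by simp
next
  case (2 M i j k)
  have "basis7 (shear f (j + 1) 1 (i + 1) (- k))" using 2 by (intro basis7_shear) auto
  from 2(4)[OF this] show ?case unfolding nf7_row_add[OF 2(1-3), symmetric] .
next
  case (3 M i j k)
  have "basis7 (shear f (j + 4) 1 (i + 4) (- k))" using 3 by (intro basis7_shear) auto
  from 3(4)[OF this] show ?case unfolding nf7_col_add[OF 3(1-3), symmetric] .
qed

lemma rep_mod_form7:
  assumes "rep_mod k T"
  obtains f c where "basis7 f" "T = wedge_sum f (rep_triples ! k) + form7 f c"
proof -
  obtain f where f: "basis7 f" "T - wedge_sum f (rep_triples ! k) \<in> multiples (f 7)"
    using assms unfolding rep_mod_def by blast
  obtain c where "T - wedge_sum f (rep_triples ! k) = form7 f c" using multiples_form7[OF f] by blast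
  then have "T = wedge_sum f (rep_triples ! k) + form7 f c" by (simp add: algebra_simps)
  then show thesis by (rule that[OF f(1)])
qed

text \<open>
  Shears of \<open>f\<^sub>1, \<dots>, f\<^sub>6\<close> along \<open>f\<^sub>7\<close> remove the part of \<open>\<omega>\<close> within each of the triples 123 and 456; the part
  between them is the matrix of \<open>nf7\<close>.
\<close>

lemma rep_mod_5: "rep_mod 5 T \<Longrightarrow> \<exists>k\<in>{5,7,8,9}. is_rep k T"
proof (erule rep_mod_form7)
  fix f c assume f: "basis7 f" and T: "T = wedge_sum f (rep_triples ! 5) + form7 f c"
  define g where "g = shear (shear (shear (shear (shear (shear f 1 1 7 (c (2,3))) 2 1 7 (- c (1,3))) 3 1 7 (c (1,2)))
    4 1 7 (c (5,6))) 5 1 7 (- c (4,6))) 6 1 7 (c (4,5))"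
  have g: "basis7 g" unfolding g_def using f by (intro basis7_shear) auto
  have "T = nf7 g (\<lambda>i j. c ([1,2,3] ! i, [4,5,6] ! j))"
    unfolding T by (simp add: wedge_sum_reps g_def nf7_def form7_expand shear_def wedge_expand wedge_order[where f = f])
      (simp add: vec_eq_iff)?
  then show "\<exists>k\<in>{5,7,8,9}. is_rep k T" using nf7_classify[OF g] by simp
qed

section \<open>Tangent trivectors modulo a line\<close>

definition nf4 :: "(nat \<Rightarrow> complex ^ 7) \<Rightarrow> (nat \<Rightarrow> nat \<Rightarrow> complex) \<Rightarrow> complex ^ (7 \<times> 7 \<times> 7)" where
  "nf4 f M = cyc4 f
     + M 0 0 *s wedge (f 1) (f 4) (f 7) + M 0 1 *s wedge (f 1) (f 5) (f 7) + M 0 2 *s wedge (f 1) (f 6) (f 7)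
     + M 1 0 *s wedge (f 2) (f 4) (f 7) + M 1 1 *s wedge (f 2) (f 5) (f 7) + M 1 2 *s wedge (f 2) (f 6) (f 7)
     + M 2 0 *s wedge (f 3) (f 4) (f 7) + M 2 1 *s wedge (f 3) (f 5) (f 7) + M 2 2 *s wedge (f 3) (f 6) (f 7)"

text \<open>
  The special linear group of \<open>\<langle>f\<^sub>1, f\<^sub>2, f\<^sub>3\<rangle>\<close>, acting in the same way on \<open>f\<^sub>4, f\<^sub>5, f\<^sub>6\<close>, fixes \<open>cyc4\<close> and acts on
  \<open>M\<close> by congruences.
\<close>

lemma nf4_sym_add:
  assumes "i < 3" "j < 3" "i \<noteq> j"
  shows "nf4 f M = nf4 (shear (shear f (j + 1) 1 (i + 1) (- k)) (j + 4) 1 (i + 4) (- k)) (sym_add i j k M)"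
proof -
  define E where "E i j \<longleftrightarrow> nf4 f M = nf4 (shear (shear f (j + 1) 1 (i + 1) (- k)) (j + 4) 1 (i + 4) (- k)) (sym_add i j k M)" for i j
  have "E 0 1" "E 0 2" "E 1 0" "E 1 2" "E 2 0" "E 2 1"
    unfolding E_def one_add_one add_0
    by (simp add: nf4_def cyc4_def sym_add_def col_add_def row_add_def shear_def wedge_expand wedge_order[where f = f];
      (simp add: vec_eq_iff algebra_simps)?)+
  then have "E i j" using assms unfolding less_3_cases by (elim disjE) simp_all
  then show ?thesis unfolding E_def .
qed

definition nf4d :: "(nat \<Rightarrow> complex ^ 7) \<Rightarrow> complex \<Rightarrow> complex \<Rightarrow> complex \<Rightarrow> complex ^ (7 \<times> 7 \<times> 7)" where
  "nf4d f x y z = cyc4 f + x *s wedge (f 1) (f 4) (f 7) + y *s wedge (f 2) (f 5) (f 7) + z *s wedge (f 3) (f 6) (f 7)"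

lemma nf4d_cyc: "nf4d f x y z = nf4d (pick [2,3,1,5,6,4,7] f) y z x"
  by (simp add: nf4d_def cyc4_def wedge_order[where f = f])

lemma nf4d_0: "basis7 f \<Longrightarrow> is_rep 4 (nf4d f 0 0 0)"
  by (rule is_repI[OF basis7_cyc4]) (simp_all add: nf4d_def cyc4_rep)

lemma nf4d_1: "basis7 f \<Longrightarrow> x \<noteq> 0 \<Longrightarrow> is_rep 6 (nf4d f x 0 0)"
proof (rule is_repI)
  assume f: "basis7 f" and x: "x \<noteq> 0"
  show "basis7 (pick [1,6,2,5,3,7,4] (shear (shear f 6 (-1) 1 0) 7 (- x) 1 0))"
    using f x by (intro basis7_pick basis7_shear) (auto simp: set7)
  show "nf4d f x 0 0 = wedge_sum (pick [1,6,2,5,3,7,4] (shear (shear f 6 (-1) 1 0) 7 (- x) 1 0)) (rep_triples ! 6)"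
    by (simp add: nf4d_def cyc4_def wedge_sum_reps shear_def wedge_expand wedge_order[where f = f])
qed

text \<open>
  If the quadratic form has rank at least 2, the line of \<open>f\<^sub>7\<close> is replaced by that of \<open>f\<^sub>7 - s f\<^sub>6\<close>. Modulo the
  new line the terms with \<open>f\<^sub>7\<close> turn into terms with \<open>s f\<^sub>6\<close>, and the value of \<open>s\<close> normalises the product of
  their coefficients to \<open>(s x) (s y) = -1\<close>; the sum with \<open>cyc4\<close> is then of the form \<open>[123] + [456]\<close>.
\<close>

lemma nf4d_2:
  assumes f: "basis7 f" and xy: "x \<noteq> 0" "y \<noteq> 0"
  shows "rep_mod 5 (nf4d f x y z)"
proof -
  define s where "s = csqrt (- 1 / (x * y))"
  have s2: "s * s = - 1 / (x * y)" unfolding s_def by (metis power2_csqrt power2_eq_square)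
  define p q where "p = s * x" and "q = s * y"
  have s2': "s * (s * (x * (y * w))) = - w" for w
  proof -
    have "s * (s * (x * (y * w))) = (s * s) * (x * y) * w" by (simp only: mult_ac)
    then show ?thesis using s2 xy by simp
  qed
  define g where "g = shear (shear (shear (shear (shear (shear (shear (shear (shear f 7 1 6 (- s)) 2 1 4 p) 2 1 5 1) 1 1 4 1) 1 1 5 (- q))
     4 (-2) 1 1) 5 (-2) 2 1) 3 1 6 1) 6 2 3 (-1)"
  define h where "h = pick [3,1,2,6,4,5,7] (shear (shear g 3 (1/2) 1 0) 6 (1/2) 1 0)"
  have "basis7 h" unfolding h_def g_def using f by (intro basis7_pick basis7_shear) (auto simp: set7)
  moreover have "nf4d f x y z = wedge_sum h (rep_triples ! 5) + x *s wedge (f 1) (f 4) (h 7) + y *s wedge (f 2) (f 5) (h 7)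
      + z *s wedge (f 3) (f 6) (h 7)"
    unfolding h_def
    by (simp add: g_def nf4d_def cyc4_def wedge_sum_reps shear_def wedge_expand wedge_order[where f = f])
      (simp add: vec_eq_iff algebra_simps s2' p_def q_def)
  ultimately show ?thesis
    by (intro rep_modI[of h _ "wedge_sum h (rep_triples ! 5)" "h 7"]) (auto intro!: multiples_lin multiples_wedge)
qed

lemma nf4d_classify:
  assumes f: "basis7 f"
  shows "rep_mod 5 (nf4d f x y z) \<or> is_rep 4 (nf4d f x y z) \<or> is_rep 6 (nf4d f x y z)"
proof -
  define f1 where "f1 = pick [2,3,1,5,6,4,7] f"
  define f2 where "f2 = pick [2,3,1,5,6,4,7] f1"
  have f1: "basis7 f1" unfolding f1_def by (rule basis7_pick[OF f]) (auto simp: set7)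
  have f2: "basis7 f2" unfolding f2_def by (rule basis7_pick[OF f1]) (auto simp: set7)
  have c: "nf4d f x y z = nf4d f1 y z x" "nf4d f1 y z x = nf4d f2 z x y"
    unfolding f2_def f1_def by (rule nf4d_cyc)+
  show ?thesis
    using nf4d_0[OF f] nf4d_1[OF f, of x] nf4d_1[OF f1, of y] nf4d_1[OF f2, of z] nf4d_2[OF f, of x y z]
      nf4d_2[OF f1, of y z x] nf4d_2[OF f2, of z x y] c
    by (cases "x = 0"; cases "y = 0"; cases "z = 0"; simp)
qed

lemma nf4_classify:
  assumes "symm3 M" "basis7 f"
  shows "rep_mod 5 (nf4 f M) \<or> is_rep 4 (nf4 f M) \<or> is_rep 6 (nf4 f M)"
proof -
  define P where "P M \<longleftrightarrow> (\<forall>f. basis7 f \<longrightarrow> rep_mod 5 (nf4 f M) \<or> is_rep 4 (nf4 f M) \<or> is_rep 6 (nf4 f M))" for M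
  have "P M"
  proof (rule symm_diag_induct[OF assms(1), of P])
    fix M assume "diag3 M"
    then have "nf4 f M = nf4d f (M 0 0) (M 1 1) (M 2 2)" for f by (simp add: nf4_def nf4d_def diag3_def)
    then show "P M" unfolding P_def using nf4d_classify by simp
  next
    fix M i j k assume ij: "i < (3::nat)" "j < 3" "i \<noteq> j" and IH: "P (sym_add i j k M)"
    show "P M" unfolding P_def
    proof (intro allI impI)
      fix f assume "basis7 f"
      then have g: "basis7 (shear (shear f (j + 1) 1 (i + 1) (- k)) (j + 4) 1 (i + 4) (- k))"
        using ij by (intro basis7_shear) auto
      show "rep_mod 5 (nf4 f M) \<or> is_rep 4 (nf4 f M) \<or> is_rep 6 (nf4 f M)"
        unfolding nf4_sym_add[OF ij, of f M k] using IH g unfolding P_def by blast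
    qed
  qed
  then show ?thesis using assms(2) by (simp add: P_def)
qed

text \<open>
  Shears of \<open>f\<^sub>1, f\<^sub>2, f\<^sub>3\<close> along \<open>f\<^sub>7\<close> change the matrix of \<open>nf4\<close> by an arbitrary antisymmetric one.
\<close>

lemma cyc4_symmetrize:
  assumes f: "basis7 f" and c: "c (4,5) = 0" "c (4,6) = 0" "c (5,6) = 0"
  shows "\<exists>g M. basis7 g \<and> symm3 M \<and> cyc4 f + form7 f c = nf4 g M"
proof -
  define t1 t2 t3 where "t1 = (c (2,6) - c (3,5)) / 2" and "t2 = (c (3,4) - c (1,6)) / 2" and "t3 = (c (1,5) - c (2,4)) / 2"
  define g where "g = shear (shear (shear (shear (shear (shear f 4 1 7 (c (2,3))) 5 1 7 (- c (1,3))) 6 1 7 (c (1,2)))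
    1 1 7 t1) 2 1 7 t2) 3 1 7 t3"
  define M where "M i j = [[c (1,4), c (1,5) - t3, c (1,6) + t2], [c (2,4) + t3, c (2,5), c (2,6) - t1],
    [c (3,4) - t2, c (3,5) + t1, c (3,6)]] ! i ! j" for i j
  have "basis7 g" unfolding g_def using f by (intro basis7_shear) auto
  moreover have "symm3 M" by (simp add: symm3_def M_def t1_def t2_def t3_def field_simps)
  moreover have "cyc4 f + form7 f c = nf4 g M"
    by (simp add: c g_def nf4_def M_def cyc4_def form7_expand shear_def wedge_expand wedge_order[where f = f])
  ultimately show ?thesis by blast
qed

definition nf4_456 :: "(nat \<Rightarrow> complex ^ 7) \<Rightarrow> complex \<Rightarrow> complex \<Rightarrow> complex \<Rightarrow> complex ^ (7 \<times> 7 \<times> 7)" where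
  "nf4_456 f a b c = cyc4 f + wedge (f 7) (f 5) (f 6) + a *s wedge (f 7) (f 1) (f 4)
     + b *s wedge (f 7) (f 2) (f 4) + c *s wedge (f 7) (f 3) (f 4)"

text \<open>
  Modulo \<open>f\<^sub>7 - f\<^sub>4\<close> the terms with coefficients \<open>a, b, c\<close> vanish, and \<open>cyc4 f + [456]\<close> is the difference of
  the decomposable trivectors \<open>(f\<^sub>1 + f\<^sub>4) \<and> (f\<^sub>2 + f\<^sub>5) \<and> (f\<^sub>3 + f\<^sub>6)\<close> and
  \<open>(f\<^sub>1 - f\<^sub>4) \<and> (f\<^sub>2 - f\<^sub>5) \<and> (f\<^sub>3 - f\<^sub>6)\<close>, up to the factor 2.
\<close>

lemma nf4_456_rep_mod:
  assumes f: "basis7 f"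
  shows "rep_mod 5 (nf4_456 f a b c)"
proof -
  define g where "g = shear (shear (shear (shear (shear (shear (shear (shear (shear f 7 1 4 (-1)) 1 1 4 1) 2 1 5 1) 3 1 6 1)
    4 2 1 (-1)) 5 2 2 (-1)) 6 2 3 (-1)) 1 (1/2) 2 0) 4 (1/2) 2 0"
  have "basis7 g" unfolding g_def using f by (intro basis7_shear) auto
  moreover have "nf4_456 f a b c = wedge_sum g (rep_triples ! 5) + wedge (g 7) (f 5) (f 6) + a *s wedge (g 7) (f 1) (f 4)
     + b *s wedge (g 7) (f 2) (f 4) + c *s wedge (g 7) (f 3) (f 4)"
    by (simp add: g_def nf4_456_def cyc4_def wedge_sum_reps shear_def wedge_expand wedge_order[where f = f])
      (simp add: vec_eq_iff algebra_simps)
  ultimately show ?thesis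
    by (intro rep_modI[of g _ "wedge_sum g (rep_triples ! 5)" "g 7"]) (auto intro!: multiples_lin multiples_wedge)
qed

text \<open>
  Shears of \<open>f\<^sub>5\<close> and \<open>f\<^sub>6\<close> along \<open>f\<^sub>1, \<dots>, f\<^sub>4\<close> complete \<open>\<omega>\<close> to \<open>f\<^sub>5 \<and> f\<^sub>6\<close> plus a form \<open>d\<close> in
  \<open>f\<^sub>1, \<dots>, f\<^sub>4\<close> alone. The shears by \<open>x, y, m\<close> undo the change that they cause in \<open>cyc4\<close>, and those along \<open>f\<^sub>7\<close>
  remove the part of \<open>d\<close> within 1, 2, 3.
\<close>

lemma cyc4_456_unit:
  assumes f: "basis7 f" and c: "c (5,6) = 1"
  shows "rep_mod 5 (cyc4 f + form7 f c)"
proof -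
  define x y m where "x = c (4,6)" and "y = - c (4,5)" and "m = c (3,5) - c (2,6)"
  define d where "d i j = c (i, j) + c (i, 6) * c (j, 5) - c (j, 6) * c (i, 5)" for i j
  define g where "g = shear (shear (shear (shear (shear (shear (shear (shear (shear (shear (shear f
    5 1 1 (c (1,6))) 5 1 2 (c (2,6))) 5 1 3 (c (3,6))) 5 1 4 (c (4,6)))
    6 1 1 (- c (1,5))) 6 1 2 (- c (2,5))) 6 1 3 (- c (3,5))) 6 1 4 (- c (4,5)))
    2 1 1 x) 3 1 1 y) 4 1 1 m"
  define h where "h = shear (shear (shear g 4 1 7 (d 2 3)) 5 1 7 (- (d 1 3 - x * d 2 3 + m * d 3 4))) 6 1 7 (d 1 2 + y * d 2 3 + m * d 2 4)"
  have "basis7 h" unfolding h_def g_def using f by (intro basis7_shear) auto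
  moreover have "cyc4 f + form7 f c = nf4_456 h (d 1 4 - x * d 2 4 - y * d 3 4) (d 2 4) (d 3 4)"
    unfolding h_def
    by (simp add: c g_def nf4_456_def cyc4_def form7_expand shear_def wedge_expand wedge_order[where f = f])
      (simp add: vec_eq_iff algebra_simps x_def y_def m_def d_def)
  ultimately show ?thesis using nf4_456_rep_mod by simp
qed

lemma cyc4_456:
  assumes f: "basis7 f" and c: "c (5,6) \<noteq> 0"
  shows "rep_mod 5 (cyc4 f + form7 f c)"
proof -
  define g where "g = shear f 7 (c (5,6)) 1 0"
  have "basis7 g" unfolding g_def using f c by (intro basis7_shear) auto
  moreover have "cyc4 f + form7 f c = cyc4 g + form7 g (\<lambda>p. c p / c (5,6))"
    using c by (simp add: g_def cyc4_def form7_expand shear_def wedge_expand)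
  ultimately show ?thesis using cyc4_456_unit[of g "\<lambda>p. c p / c (5,6)"] c by simp
qed

lemma cyc4_form_cyc:
  "cyc4 f + form7 f c = cyc4 (pick [2,3,1,5,6,4,7] f) + form7 (pick [2,3,1,5,6,4,7] f)
    (\<lambda>(i, j). let p = [2,3,1,5,6,4] ! (i - 1); q = [2,3,1,5,6,4] ! (j - 1) in if p < q then c (p, q) else - c (q, p))"
  by (simp add: cyc4_def form7_expand Let_def wedge_order[where f = f])

lemma rep_mod_4: "rep_mod 4 T \<Longrightarrow> rep_mod 5 T \<or> is_rep 4 T \<or> is_rep 6 T"
proof (erule rep_mod_form7)
  fix f' c' assume f': "basis7 f'" and T': "T = wedge_sum f' (rep_triples ! 4) + form7 f' c'"
  define f where "f = pick [1,2,4,6,5,3,7] (shear f' 5 (-1) 1 0)"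
  have f: "basis7 f" unfolding f_def using f' by (intro basis7_pick basis7_shear) (auto simp: set7)
  have "form7 f' c' \<in> multiples (f 7)" using form7_multiples[of f' c'] by (simp add: f_def shear_def)
  then obtain c where "form7 f' c' = form7 f c" using multiples_form7[OF f] by blast
  then have T: "T = cyc4 f + form7 f c" unfolding T' rep_cyc4 f_def by simp
  define f1 where "f1 = pick [2,3,1,5,6,4,7] f"
  define c1 where "c1 = (\<lambda>(i, j). let p = [2,3,1,5,6,4] ! (i - 1); q = [2,3,1,5,6,4] ! (j - 1) in if p < q then c (p, q) else - c (q, p))"
  define f2 where "f2 = pick [2,3,1,5,6,4,7] f1"
  define c2 where "c2 = (\<lambda>(i, j). let p = [2,3,1,5,6,4] ! (i - 1); q = [2,3,1,5,6,4] ! (j - 1) in if p < q then c1 (p, q) else - c1 (q, p))"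
  have f1: "basis7 f1" unfolding f1_def by (rule basis7_pick[OF f]) (auto simp: set7)
  have f2: "basis7 f2" unfolding f2_def by (rule basis7_pick[OF f1]) (auto simp: set7)
  have T1: "T = cyc4 f1 + form7 f1 c1" unfolding T f1_def c1_def by (rule cyc4_form_cyc)
  have T2: "T = cyc4 f2 + form7 f2 c2" unfolding T1 f2_def c2_def by (rule cyc4_form_cyc)
  have cc: "c1 (5,6) = - c (4,6)" "c2 (5,6) = c (4,5)"
    by (simp_all add: c1_def c2_def Let_def)
  show "rep_mod 5 T \<or> is_rep 4 T \<or> is_rep 6 T"
  proof (cases "c (4,5) = 0 \<and> c (4,6) = 0 \<and> c (5,6) = 0")
    case True
    then obtain g M where "basis7 g" "symm3 M" "T = nf4 g M" using cyc4_symmetrize[OF f] T by blast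
    then show ?thesis using nf4_classify by blast
  next
    case False
    then show ?thesis
      using cyc4_456[OF f, of c] cyc4_456[OF f1, of c1] cyc4_456[OF f2, of c2] cc T T1 T2 by auto
  qed
qed

section \<open>The remaining trivectors modulo a line\<close>

text \<open>
  Modulo \<open>f\<^sub>7 - f\<^sub>6\<close>, \<open>f\<^sub>7 - f\<^sub>3\<close> and \<open>f\<^sub>7 - f\<^sub>2\<close> in turn, \<open>T\<close> becomes an instance of \<open>nf6\<close> with
  \<open>c \<noteq> 0\<close> or a matrix of rank at least 2, unless certain coefficients of \<open>\<omega>\<close> are zero. If all of these
  vanish, only \<open>[123] + [145]\<close> and a multiple of \<open>[167]\<close> are left.
\<close>

lemma rep_mod_2: "rep_mod 2 T \<Longrightarrow> rep_mod 4 T \<or> rep_mod 5 T \<or> is_rep 2 T \<or> is_rep 3 T"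
proof (erule rep_mod_form7)
  fix f' c assume f': "basis7 f'" and T': "T = wedge_sum f' (rep_triples ! 2) + form7 f' c"
  define f where "f = shear (shear (shear (shear (shear f' 1 1 7 (c (4,5))) 3 1 7 (c (1,2))) 2 1 7 (- c (1,3)))
    5 1 7 (c (1,4))) 4 1 7 (- c (1,5))"
  have f: "basis7 f" unfolding f_def using f' by (intro basis7_shear) auto
  define e where "e = c (2,3) - c (4,5)"
  have T: "T = wedge (f 1) (f 2) (f 3) + wedge (f 1) (f 4) (f 5) + c (1,6) *s wedge (f 7) (f 1) (f 6)
    + c (2,6) *s wedge (f 7) (f 2) (f 6) + c (3,6) *s wedge (f 7) (f 3) (f 6) + c (4,6) *s wedge (f 7) (f 4) (f 6)
    + c (5,6) *s wedge (f 7) (f 5) (f 6) + c (2,4) *s wedge (f 7) (f 2) (f 4) + c (2,5) *s wedge (f 7) (f 2) (f 5)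
    + c (3,4) *s wedge (f 7) (f 3) (f 4) + c (3,5) *s wedge (f 7) (f 3) (f 5) + e *s wedge (f 7) (f 2) (f 3)"
    unfolding T' f_def
    by (simp add: e_def wedge_sum_reps form7_expand shear_def wedge_expand wedge_order[where f = f'])
  show ?thesis
  proof (cases "c (2,4) = 0 \<and> c (2,5) = 0 \<and> c (3,4) = 0 \<and> c (3,5) = 0 \<and> e = 0")
    case False
    define h where "h = shear (shear f 7 1 6 (-1)) 1 1 6 e"
    define M where "M i j = [[0, 0, 1], [c (2,5), - c (2,4), 0], [c (3,5), - c (3,4), 0]] ! i ! j" for i j
    have h: "basis7 h" unfolding h_def using f by (intro basis7_shear) auto
    have "T - nf6 h M (- e) = c (1,6) *s wedge (h 7) (f 1) (f 6)
      + c (2,6) *s wedge (h 7) (f 2) (f 6) + c (3,6) *s wedge (h 7) (f 3) (f 6) + c (4,6) *s wedge (h 7) (f 4) (f 6)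
      + c (5,6) *s wedge (h 7) (f 5) (f 6) + c (2,4) *s wedge (h 7) (f 2) (f 4) + c (2,5) *s wedge (h 7) (f 2) (f 5)
      + c (3,4) *s wedge (h 7) (f 3) (f 4) + c (3,5) *s wedge (h 7) (f 3) (f 5) + e *s wedge (h 7) (f 2) (f 3)"
      unfolding T by (simp add: h_def M_def nf6_def shear_def wedge_expand wedge_order[where f = f])
    then have "T - nf6 h M (- e) \<in> multiples (h 7)" by (auto intro!: multiples_lin multiples_wedge)
    moreover have "- e \<noteq> 0 \<or> \<not> rank1 M"
      using False unfolding rank1_def all_less_3 by (auto simp: M_def)
    ultimately show ?thesis using nf6_classify(1)[OF h] by blast
  next
    case te: True
    show ?thesis
    proof (cases "c (2,6) = 0 \<and> c (4,6) = 0 \<and> c (5,6) = 0")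
      case False
      define h where "h = shear (shear (shear f 7 1 3 (-1)) 2 1 6 (c (1,6))) 1 1 6 (- c (2,6))"
      define M where "M i j = [[0, 0, 1], [0, 0, 0], [c (5,6), - c (4,6), 0]] ! i ! j" for i j
      have h: "basis7 h" unfolding h_def using f by (intro basis7_shear) auto
      have "T - nf6 h M (c (2,6)) = c (1,6) *s wedge (h 7) (f 1) (f 6)
        + c (2,6) *s wedge (h 7) (f 2) (f 6) + c (3,6) *s wedge (h 7) (f 3) (f 6) + c (4,6) *s wedge (h 7) (f 4) (f 6)
        + c (5,6) *s wedge (h 7) (f 5) (f 6)"
        unfolding T by (simp add: te h_def M_def nf6_def shear_def wedge_expand wedge_order[where f = f])
      then have "T - nf6 h M (c (2,6)) \<in> multiples (h 7)" by (auto intro!: multiples_lin multiples_wedge)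
      moreover have "c (2,6) \<noteq> 0 \<or> \<not> rank1 M"
        using False unfolding rank1_def all_less_3 by (auto simp: M_def)
      ultimately show ?thesis using nf6_classify(1)[OF h] by blast
    next
      case v: True
      show ?thesis
      proof (cases "c (3,6) = 0")
        case False
        define h where "h = shear (shear (shear f 7 1 2 (-1)) 3 1 6 (- c (1,6))) 1 1 6 (c (3,6))"
        define M :: "nat \<Rightarrow> nat \<Rightarrow> complex" where "M i j = [[0, 0, 1], [0, 0, 0], [0, 0, 0]] ! i ! j" for i j
        have h: "basis7 h" unfolding h_def using f by (intro basis7_shear) auto
        have "T - nf6 h M (- c (3,6)) = c (1,6) *s wedge (h 7) (f 1) (f 6) + c (3,6) *s wedge (h 7) (f 3) (f 6)"
          unfolding T by (simp add: te v h_def M_def nf6_def shear_def wedge_expand wedge_order[where f = f])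
        then have "T - nf6 h M (- c (3,6)) \<in> multiples (h 7)" by (auto intro!: multiples_lin multiples_wedge)
        then show ?thesis using nf6_classify(1)[OF h, of T M "- c (3,6)"] False by auto
      next
        case True
        show ?thesis
        proof (cases "c (1,6) = 0")
          case T0: True
          have "is_rep 2 T" by (rule is_repI[OF f]) (simp add: T te v True T0[unfolded One_nat_def] wedge_sum_reps)
          then show ?thesis by simp
        next
          case False
          have "is_rep 3 T"
          proof (rule is_repI)
            show "basis7 (shear f 7 (c (1,6)) 1 0)" using f False by (intro basis7_shear) auto
          qed (simp add: T te v True wedge_sum_reps shear_def wedge_expand wedge_order[where f = f])
          then show ?thesis by simp
        qed
      qed
    qed
  qed
qed

text \<open>
  The coefficients of \<open>\<omega>\<close> are detected modulo the three lines \<open>f\<^sub>7 - f\<^sub>4\<close>, \<open>f\<^sub>7 - f\<^sub>5\<close> and \<open>f\<^sub>7 - f\<^sub>6\<close>: replacing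
  \<open>f\<^sub>7\<close> by \<open>f\<^sub>x\<close> makes them coefficients of an instance of \<open>nf6\<close>.
\<close>

lemma rep_mod_1: "rep_mod 1 T \<Longrightarrow> rep_mod 2 T \<or> rep_mod 4 T \<or> rep_mod 5 T \<or> is_rep 1 T"
proof (erule rep_mod_form7)
  fix f' c assume f': "basis7 f'" and T': "T = wedge_sum f' (rep_triples ! 1) + form7 f' c"
  define f where "f = shear (shear (shear f' 3 1 7 (c (1,2))) 2 1 7 (- c (1,3))) 1 1 7 (c (2,3))"
  have f: "basis7 f" unfolding f_def using f' by (intro basis7_shear) auto
  define R where "R u = c (1,4) *s wedge u (f 1) (f 4) + c (1,5) *s wedge u (f 1) (f 5) + c (1,6) *s wedge u (f 1) (f 6)
    + c (2,4) *s wedge u (f 2) (f 4) + c (2,5) *s wedge u (f 2) (f 5) + c (2,6) *s wedge u (f 2) (f 6)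
    + c (3,4) *s wedge u (f 3) (f 4) + c (3,5) *s wedge u (f 3) (f 5) + c (3,6) *s wedge u (f 3) (f 6)
    + c (4,5) *s wedge u (f 4) (f 5) + c (4,6) *s wedge u (f 4) (f 6) + c (5,6) *s wedge u (f 5) (f 6)" for u
  have T: "T = wedge (f 1) (f 2) (f 3) + R (f 7)"
    unfolding T' f_def R_def wedge_sum_reps
    by (simp add: form7_expand shear_def wedge_expand wedge_order[where f = f'])
  have R: "R u \<in> multiples u" for u unfolding R_def by (intro multiples_lin multiples_wedge)
  have Rd: "R (u - v) = R u - R v" for u v unfolding R_def by (simp add: wedge_expand algebra_simps vec.scale_right_diff_distrib)
  have red: "rep_mod 2 T \<or> rep_mod 4 T \<or> rep_mod 5 T"
    if "x \<in> {4,5,6}" "wedge (f 1) (f 2) (f 3) + R (f x) = nf6 f M e" "e \<noteq> 0 \<or> \<not> zero3 M" for x M e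
  proof -
    define h where "h = shear f 7 1 x (-1)"
    have h: "basis7 h" unfolding h_def using f that(1) by (intro basis7_shear) auto
    have "h 7 = f 7 - f x" by (simp add: h_def shear_def)
    then have "T - nf6 f M e = R (h 7)" unfolding that(2)[symmetric] T by (simp add: Rd)
    moreover have "nf6 f M e = nf6 h M e" by (simp add: nf6_def h_def shear_def)
    ultimately have "T - nf6 h M e \<in> multiples (h 7)" using R by simp
    then show ?thesis using nf6_classify[OF h, of T M e] that(3) by blast
  qed
  define M4 where "M4 i j = [[0, c (1,6), - c (1,5)], [0, c (2,6), - c (2,5)], [0, c (3,6), - c (3,5)]] ! i ! j" for i j
  define M5 where "M5 i j = [[- c (1,6), 0, c (1,4)], [- c (2,6), 0, c (2,4)], [- c (3,6), 0, c (3,4)]] ! i ! j" for i j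
  define M6 where "M6 i j = [[c (1,5), - c (1,4), 0], [c (2,5), - c (2,4), 0], [c (3,5), - c (3,4), 0]] ! i ! j" for i j
  have 4: "wedge (f 1) (f 2) (f 3) + R (f 4) = nf6 f M4 (c (5,6))"
    "wedge (f 1) (f 2) (f 3) + R (f 5) = nf6 f M5 (- c (4,6))"
    "wedge (f 1) (f 2) (f 3) + R (f 6) = nf6 f M6 (c (4,5))"
    by (simp_all add: R_def nf6_def M4_def M5_def M6_def wedge_order[where f = f])
  show ?thesis
  proof (cases "c (5,6) \<noteq> 0 \<or> \<not> zero3 M4 \<or> c (4,6) \<noteq> 0 \<or> \<not> zero3 M5 \<or> c (4,5) \<noteq> 0 \<or> \<not> zero3 M6")
    case True
    then show ?thesis using red[of 4 M4 "c (5,6)"] red[of 5 M5 "- c (4,6)"] red[of 6 M6 "c (4,5)"] 4 by auto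
  next
    case False
    then have "R (f 7) = 0" unfolding zero3_def all_less_3 by (simp add: M4_def M5_def M6_def R_def)
    then have "is_rep 1 T" by (intro is_repI[OF f]) (simp only: T wedge_sum_reps add_0_right)
    then show ?thesis by simp
  qed
qed

lemma nonzero_basis:
  assumes T: "T \<in> trivectors" and nz: "T \<noteq> 0"
  shows "\<exists>f c. basis7 f \<and> c (1,2,3) \<noteq> 0 \<and>
    T = (\<Sum>t\<in>set incr_triples. c t *s (case t of (i, j, k) \<Rightarrow> wedge (f i) (f j) (f k)))"
proof -
  obtain i j k where ijk: "1 \<le> i" "i < j" "j < k" "k \<le> 7" "T $ triple_ix (i, j, k) \<noteq> 0"
  proof (rule ccontr)
    assume "\<not> thesis"
    then have "T = 0" using that
      by (intro trivector_eqI[OF T vec.subspace_0[OF subspace_trivectors]]) (metis zero_index)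
    then show False using nz by simp
  qed
  define ps where "ps = [i, j, k] @ filter (\<lambda>x. x \<notin> {i, j, k}) [1..<8]"
  have d: "distinct ps" using ijk by (auto simp: ps_def)
  have s: "set ps = {1..7}" using ijk by (auto simp: ps_def)
  have l: "length ps = 7" using distinct_card[OF d] s by simp
  have f: "basis7 (pick ps std)" by (rule basis7_pick[OF basis7_std l s])
  obtain c where c: "T = (\<Sum>t\<in>set incr_triples. c t *s (case t of (i, j, k) \<Rightarrow> wedge (pick ps std i) (pick ps std j) (pick ps std k)))"
    using basis7_wedge_expand[OF f T] by blast
  have r: "ps ! (n - 1) \<in> {1..7}" if "1 \<le> n" "n \<le> 7" for n
    using nth_mem[of "n - 1" ps] s l that by simp
  have ne: "ps ! (n - 1) \<notin> {i, j, k}" if "4 \<le> n" "n \<le> 7" for n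
  proof -
    have "ps ! (n - 1) \<noteq> ps ! m" if "m < 3" for m
      using nth_eq_iff_index_eq[OF d, of "n - 1" m] that \<open>4 \<le> n\<close> \<open>n \<le> 7\<close> l by auto
    from this[of 0] this[of 1] this[of 2] show ?thesis by (simp add: ps_def)
  qed
  have w: "(case t of (l, m, n) \<Rightarrow> wedge (pick ps std l) (pick ps std m) (pick ps std n)) $ triple_ix (i, j, k) =
      (if t = (1,2,3) then 1 else 0)" if "t \<in> set incr_triples" for t
  proof -
    obtain l m n where t: "t = (l, m, n)" by (cases t) auto
    have lmn: "1 \<le> l" "l < m" "m < n" "n \<le> 7" using that incr_triples_iff t by auto
    have e: "wedge (pick ps std l) (pick ps std m) (pick ps std n) $ triple_ix (i, j, k)
      = of_int (wedge_coeff (ps ! (l - 1), ps ! (m - 1), ps ! (n - 1)) (i, j, k))"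
      unfolding pick_def by (rule wedge_std_nth) (use r lmn ijk in auto)
    show ?thesis
    proof (cases "n \<le> 3")
      case True
      then have "l = 1" "m = 2" "n = 3" using lmn by auto
      moreover have "ps ! 0 = i" "ps ! (2 - 1) = j" "ps ! (3 - 1) = k" by (simp_all add: ps_def)
      ultimately show ?thesis unfolding t prod.case e using ijk by (simp add: kron_def)
    next
      case False
      then have "ps ! (n - 1) \<notin> {i, j, k}" using ne lmn by simp
      then show ?thesis using False by (auto simp: t e kron_def)
    qed
  qed
  have "T $ triple_ix (i, j, k) = (\<Sum>t\<in>set incr_triples. if t = (1,2,3) then c (1,2,3) else 0)"
    unfolding arg_cong[OF c, of "\<lambda>x. x $ triple_ix (i, j, k)"] sum_component vector_smult_component
    by (intro sum.cong refl) (simp add: w)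
  also have "\<dots> = c (1,2,3)" using incr_triples_iff[of 1 2 3] by simp
  finally have "c (1,2,3) \<noteq> 0" using ijk by simp
  then show ?thesis using f c by blast
qed

text \<open>
  Shearing \<open>f\<^sub>1, f\<^sub>2, f\<^sub>3\<close> along \<open>f\<^sub>4, f\<^sub>5, f\<^sub>6\<close> completes \<open>[123]\<close> so that it absorbs the monomials with two
  indices among 1, 2, 3; the products that this creates are corrected in \<open>M\<close> and \<open>e\<close>.
\<close>

lemma nonzero_rep_mod:
  assumes T: "T \<in> trivectors" and nz: "T \<noteq> 0"
  shows "rep_mod 1 T \<or> rep_mod 2 T \<or> rep_mod 4 T \<or> rep_mod 5 T"
proof -
  obtain f' b where f': "basis7 f'" and b: "b (1,2,3) \<noteq> 0" and
    Tb: "T = (\<Sum>t\<in>set incr_triples. b t *s (case t of (i, j, k) \<Rightarrow> wedge (f' i) (f' j) (f' k)))"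
    using nonzero_basis[OF assms] by blast
  define f where "f = shear f' 1 (b (1,2,3)) 2 0"
  have f: "basis7 f" unfolding f_def using f' b by (intro basis7_shear) auto
  define c where "c = (\<lambda>(i, j, k). if i = 1 then b (i, j, k) / b (1,2,3) else b (i, j, k))"
  have c1: "c (1,2,3) = 1" using b by (simp add: c_def)
  have "T = (\<Sum>t\<in>set incr_triples. c t *s (case t of (i, j, k) \<Rightarrow> wedge (f i) (f j) (f k)))"
    unfolding Tb
  proof (intro sum.cong refl)
    fix t assume t: "t \<in> set incr_triples"
    obtain i j k where ijk: "t = (i, j, k)" by (cases t) auto
    have lt: "1 \<le> i" "i < j" "j < k" using t incr_triples_iff[of i j k] ijk by simp_all
    have fm: "f m = f' m" if "m \<noteq> 1" for m using that by (simp add: f_def shear_def)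
    have f1: "f 1 = b (1,2,3) *s f' 1" by (simp add: f_def shear_def)
    have fjk: "f j = f' j" "f k = f' k" using lt by (simp_all add: fm)
    have "c (i, j, k) *s wedge (f i) (f j) (f k) = b (i, j, k) *s wedge (f' i) (f' j) (f' k)"
    proof (cases "i = 1")
      case True
      then show ?thesis using b unfolding fjk True f1 wedge_scale c_def prod.case by simp
    next
      case False
      then show ?thesis unfolding fjk fm[OF False] c_def prod.case by simp
    qed
    then show "b t *s (case t of (i, j, k) \<Rightarrow> wedge (f' i) (f' j) (f' k)) = c t *s (case t of (i, j, k) \<Rightarrow> wedge (f i) (f j) (f k))"
      by (simp add: ijk)
  qed
  also have "\<dots> = (\<Sum>t\<leftarrow>incr_triples. c t *s (case t of (i, j, k) \<Rightarrow> wedge (f i) (f j) (f k)))"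
    by (rule sum_list_distinct_conv_sum_set[symmetric]) (rule distinct_incr_triples)
  finally have Tc: "T = (\<Sum>t\<leftarrow>incr_triples. c t *s (case t of (i, j, k) \<Rightarrow> wedge (f i) (f j) (f k)))" .
  define A where "A i = c (2,3,i)" for i
  define B where "B i = - c (1,3,i)" for i
  define C where "C i = c (1,2,i)" for i
  define g where "g = shear (shear (shear (shear (shear (shear (shear (shear (shear f 1 1 4 (A 4)) 1 1 5 (A 5)) 1 1 6 (A 6))
    2 1 4 (B 4)) 2 1 5 (B 5)) 2 1 6 (B 6)) 3 1 4 (C 4)) 3 1 5 (C 5)) 3 1 6 (C 6)"
  define M where "M i j = [
    [c (1,5,6) - (B 5 * C 6 - B 6 * C 5), - c (1,4,6) - (B 6 * C 4 - B 4 * C 6), c (1,4,5) - (B 4 * C 5 - B 5 * C 4)],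
    [c (2,5,6) + (A 5 * C 6 - A 6 * C 5), - c (2,4,6) + (A 6 * C 4 - A 4 * C 6), c (2,4,5) + (A 4 * C 5 - A 5 * C 4)],
    [c (3,5,6) - (A 5 * B 6 - A 6 * B 5), - c (3,4,6) - (A 6 * B 4 - A 4 * B 6), c (3,4,5) - (A 4 * B 5 - A 5 * B 4)]] ! i ! j"
    for i j
  define e where "e = c (4,5,6)
    + 2 * (A 4 * (B 5 * C 6 - B 6 * C 5) + A 5 * (B 6 * C 4 - B 4 * C 6) + A 6 * (B 4 * C 5 - B 5 * C 4))
    - (A 4 * c (1,5,6) - A 5 * c (1,4,6) + A 6 * c (1,4,5)) - (B 4 * c (2,5,6) - B 5 * c (2,4,6) + B 6 * c (2,4,5))
    - (C 4 * c (3,5,6) - C 5 * c (3,4,6) + C 6 * c (3,4,5))"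
  have g: "basis7 g" unfolding g_def using f by (intro basis7_shear) auto
  define R where "R u = (\<Sum>(i, j)\<leftarrow>pairs6. c (i, j, 7) *s wedge (f i) (f j) u)" for u
  have R: "R u \<in> multiples u" for u unfolding R_def pairs6_def by (auto intro!: multiples_lin multiples_wedge)
  have "T = nf6 g M e + R (f 7)"
    unfolding Tc incr_triples_eq R_def pairs6_def
    by (simp add: c1[unfolded One_nat_def] g_def M_def nf6_def shear_def wedge_expand wedge_order[where f = f])
      (simp add: vec_eq_iff e_def A_def B_def C_def algebra_simps)
  moreover have "g 7 = f 7" by (simp add: g_def shear_def)
  ultimately have Tg: "T - nf6 g M e \<in> multiples (g 7)" using R[of "f 7"] by simp
  show ?thesis
  proof (cases "e = 0 \<and> zero3 M")
    case True
    then have "nf6 g M e = wedge_sum g (rep_triples ! 1)" unfolding zero3_def all_less_3 nf6_def wedge_sum_reps by simp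
    then show ?thesis using rep_modI[OF g Tg, of 1] by simp
  next
    case False
    then show ?thesis using nf6_classify[OF g Tg] by blast
  qed
qed

theorem trivector_classification:
  assumes "T \<in> trivectors"
  shows "\<exists>k\<le>9. is_rep k T"
proof (cases "T = 0")
  case True
  have "is_rep 0 T" by (rule is_repI[OF basis7_std]) (simp add: True wedge_sum_reps)
  then show ?thesis by blast
next
  case False
  have 5: "\<exists>k\<le>9. is_rep k T" if r: "rep_mod 5 T"
  proof -
    obtain k where "k \<in> {5,7,8,9}" "is_rep k T" using rep_mod_5[OF r] by blast
    then show ?thesis by (intro exI[of _ k]) auto
  qed
  have 4: "\<exists>k\<le>9. is_rep k T" if "rep_mod 4 T"
    using rep_mod_4[OF that] 5 by (elim disjE) (auto intro: exI[of _ "4::nat"] exI[of _ "6::nat"])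
  have w: "\<exists>k\<le>9. is_rep k T" if "is_rep j T" "j \<le> 9" for j using that by blast
  have 2: "\<exists>k\<le>9. is_rep k T" if "rep_mod 2 T"
    using rep_mod_2[OF that] 4 5 w[of 2] w[of 3] by (elim disjE) simp_all
  show ?thesis using nonzero_rep_mod[OF assms False] rep_mod_1[of T] w[of 1] 2 4 5 by fastforce
qed

section \<open>Closures of orbits\<close>

lemma polynomial_fun_sum: "(\<And>a. a \<in> A \<Longrightarrow> polynomial_fun (p a)) \<Longrightarrow> polynomial_fun (\<lambda>x. \<Sum>a\<in>A. p a x)"
  by (induction A rule: infinite_finite_induct) (auto intro: polynomial_fun.intros)

lemma polynomial_fun_prod: "(\<And>a. a \<in> A \<Longrightarrow> polynomial_fun (p a)) \<Longrightarrow> polynomial_fun (\<lambda>x. \<Prod>a\<in>A. p a x)"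
  by (induction A rule: infinite_finite_induct) (auto intro: polynomial_fun.intros)

lemma polynomial_fun_det:
  assumes "\<And>a b. polynomial_fun (\<lambda>x. A x $ a $ b)"
  shows "polynomial_fun (\<lambda>x. det (A x :: complex ^ 'n ^ 'n::finite))"
  unfolding det_def by (intro polynomial_fun_sum polynomial_fun.mult polynomial_fun.const polynomial_fun_prod assms)

lemma polynomial_fun_compose:
  "polynomial_fun q \<Longrightarrow> (\<And>i. polynomial_fun (\<lambda>x. G x $ i)) \<Longrightarrow> polynomial_fun (\<lambda>x. q (G x))"
  by (induction rule: polynomial_fun.induct) (auto intro: polynomial_fun.intros)

lemma polynomial_fun_act: "polynomial_fun (\<lambda>T. act g T $ i)"
proof -
  obtain a b c where i: "i = (a, b, c)" by (cases i) auto
  show ?thesis unfolding i act_nth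
    by (intro polynomial_fun_sum polynomial_fun.mult polynomial_fun.const polynomial_fun.coord)
qed

lemma polynomial_fun_tendsto:
  assumes "polynomial_fun q" "(\<gamma> \<longlongrightarrow> x) F"
  shows "((\<lambda>t. q (\<gamma> t)) \<longlongrightarrow> q x) F"
  using assms(1) by (induction rule: polynomial_fun.induct) (auto intro: tendsto_intros assms(2))

text \<open>
  Polynomials are continuous, so limits in the classical topology belong to the Zariski closure.
\<close>

lemma zcl_limit:
  assumes "\<And>t. t \<noteq> 0 \<Longrightarrow> \<gamma> t \<in> S" "(\<gamma> \<longlongrightarrow> x) (at (0::complex))"
  shows "x \<in> zcl S"
proof (rule zclI)
  fix q assume q: "polynomial_fun q" "\<forall>w\<in>S. q w = 0"
  have "((\<lambda>t. q (\<gamma> t)) \<longlongrightarrow> q x) (at 0)" using q(1) assms(2) by (rule polynomial_fun_tendsto)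
  moreover have "eventually (\<lambda>t. q (\<gamma> t) = 0) (at 0)"
    using q(2) assms(1) by (auto simp: eventually_at_filter)
  then have "((\<lambda>t. q (\<gamma> t)) \<longlongrightarrow> 0) (at 0)" using tendsto_eventually by fastforce
  ultimately show "q x = 0" using LIM_unique by blast
qed

lemma tendsto_line: "((\<lambda>t. X + t *s Y) \<longlongrightarrow> X) (at (0::complex))"
proof (rule vec_tendstoI)
  fix i
  have "((\<lambda>t. X $ i + t * Y $ i) \<longlongrightarrow> X $ i + 0 * Y $ i) (at 0)" by (intro tendsto_intros)
  then show "((\<lambda>t. (X + t *s Y) $ i) \<longlongrightarrow> X $ i) (at 0)" by simp
qed

lemma zcl_limit_line:
  assumes "\<And>t. t \<noteq> 0 \<Longrightarrow> X + t *s Y \<in> S" shows "X \<in> zcl S"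
  using assms tendsto_line by (rule zcl_limit)

lemma zcl_act_subset:
  assumes "\<And>v. v \<in> S \<Longrightarrow> act g v \<in> S" "T \<in> zcl S"
  shows "act g T \<in> zcl S"
proof (rule zclI)
  fix q assume q: "polynomial_fun q" "\<forall>w\<in>S. q w = 0"
  have "polynomial_fun (\<lambda>v. q (act g v))" using q(1) polynomial_fun_act by (rule polynomial_fun_compose)
  then show "q (act g T) = 0"
    by (rule zclD[OF assms(2), where q = "\<lambda>v. q (act g v)"]) (use assms(1) q(2) in blast)
qed

lemma orbit_no_iff_is_rep: "i \<le> 9 \<Longrightarrow> T \<in> orbit_no std i \<longleftrightarrow> is_rep i T"
  unfolding is_rep_def by (rule orbit_no_iff[OF basis7_std])

lemma orbit_no_trivectors: "i \<le> 9 \<Longrightarrow> orbit_no std i \<subseteq> trivectors"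
  using wedge_sum_trivectors by (auto simp: orbit_no_iff_is_rep is_rep_def)

lemma orbit_no_act: "i \<le> 9 \<Longrightarrow> invertible g \<Longrightarrow> T \<in> orbit_no std i \<Longrightarrow> act g T \<in> orbit_no std i"
  unfolding orbit_no_iff_is_rep is_rep_def
proof (elim exE conjE)
  fix f assume "invertible g" "basis7 f" "T = wedge_sum f (rep_triples ! i)"
  then show "\<exists>f. basis7 f \<and> act g T = wedge_sum f (rep_triples ! i)"
    by (intro exI[of _ "\<lambda>i. g *v f i"]) (simp add: basis7_invertible act_wedge_sum)
qed

text \<open>
  The closure of an orbit is stable under the group, so a single point decides.
\<close>

lemma orbit_no_subset_zcl:
  assumes ij: "i \<le> 9" "j \<le> 9" and T: "is_rep i T" "T \<in> zcl (orbit_no std j)"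
  shows "orbit_no std i \<subseteq> zcl (orbit_no std j)"
proof
  fix S assume "S \<in> orbit_no std i"
  then obtain f' where f': "basis7 f'" "S = wedge_sum f' (rep_triples ! i)" using ij by (auto simp: orbit_no_iff_is_rep is_rep_def)
  obtain f where f: "basis7 f" "T = wedge_sum f (rep_triples ! i)" using T by (auto simp: is_rep_def)
  obtain g where g: "invertible g" "\<forall>i\<in>{1..7}. g *v f i = f' i" using basis7_to_basis7[OF f(1) f'(1)] by blast
  have "S = act g T"
    unfolding act_wedge_sum f(2) f'(2)
    by (rule wedge_sum_cong[OF _ rep_triples_range[OF ij(1)]]) (simp add: g(2)[rule_format])
  then show "S \<in> zcl (orbit_no std j)"
    using zcl_act_subset[OF orbit_no_act[OF ij(2) g(1)] T(2)] by simp
qed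

definition degenerates :: "nat \<Rightarrow> nat \<Rightarrow> bool" where
  "degenerates i j \<longleftrightarrow> orbit_no std i \<subseteq> zcl (orbit_no std j)"

lemma degenerates_trans: "degenerates i j \<Longrightarrow> degenerates j k \<Longrightarrow> degenerates i k"
  unfolding degenerates_def using zcl_mono zcl_zcl by blast

lemma degeneratesI:
  assumes "i \<le> 9" "j \<le> 9" "is_rep i X" "\<And>t. t \<noteq> 0 \<Longrightarrow> is_rep j (X + t *s Y)"
  shows "degenerates i j"
  unfolding degenerates_def using assms orbit_no_iff_is_rep
  by (intro orbit_no_subset_zcl[of i j X] zcl_limit_line[of X Y]) auto

lemma degenerates_01: "degenerates 0 1"
proof (rule degeneratesI[of 0 1 0 "wedge (std 1) (std 2) (std 3)"])
  show "is_rep 0 0" by (rule is_repI[OF basis7_std]) (simp add: wedge_sum_reps)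
  show "is_rep 1 (0 + t *s wedge (std 1) (std 2) (std 3))" if "t \<noteq> 0" for t
  proof (rule is_repI)
    show "basis7 (shear std 1 t 2 0)" using that by (intro basis7_shear basis7_std) auto
    show "0 + t *s wedge (std 1) (std 2) (std 3) = wedge_sum (shear std 1 t 2 0) (rep_triples ! 1)"
      unfolding wedge_sum_reps by (simp add: shear_def wedge_expand)
  qed
qed simp_all

lemma degenerates_12: "degenerates 1 2"
proof (rule degeneratesI[of 1 2 "wedge_sum std (rep_triples ! 1)" "wedge (std 1) (std 4) (std 5)"])
  show "is_rep 1 (wedge_sum std (rep_triples ! 1))" by (rule is_repI[OF basis7_std refl])
  show "is_rep 2 (wedge_sum std (rep_triples ! 1) + t *s wedge (std 1) (std 4) (std 5))" if "t \<noteq> 0" for t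
    unfolding wedge_sum_reps
    by (rule is_repI[of "shear std 4 t 2 0"])
      (intro basis7_shear basis7_std, use that in \<open>simp_all add: wedge_sum_reps shear_def wedge_expand\<close>)
qed simp_all

lemma degenerates_23: "degenerates 2 3"
proof (rule degeneratesI[of 2 3 "wedge_sum std (rep_triples ! 2)" "wedge (std 1) (std 6) (std 7)"])
  show "is_rep 2 (wedge_sum std (rep_triples ! 2))" by (rule is_repI[OF basis7_std refl])
  show "is_rep 3 (wedge_sum std (rep_triples ! 2) + t *s wedge (std 1) (std 6) (std 7))" if "t \<noteq> 0" for t
    by (rule is_repI[of "shear std 6 t 2 0"])
      (intro basis7_shear basis7_std, use that in \<open>simp_all add: wedge_sum_reps shear_def wedge_expand\<close>)
qed simp_all

lemma degenerates_24: "degenerates 2 4"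
proof (rule degeneratesI[of 2 4 "wedge_sum std (rep_triples ! 2)" "wedge (std 2) (std 4) (std 6)"])
  show "is_rep 2 (wedge_sum std (rep_triples ! 2))" by (rule is_repI[OF basis7_std refl])
  show "is_rep 4 (wedge_sum std (rep_triples ! 2) + t *s wedge (std 2) (std 4) (std 6))" if "t \<noteq> 0" for t
    by (rule is_repI[of "shear std 6 t 2 0"])
      (intro basis7_shear basis7_std, use that in \<open>simp_all add: wedge_sum_reps shear_def wedge_expand\<close>)
qed simp_all

lemma degenerates_45: "degenerates 4 5"
proof -
  let ?X = "cyc4 std"
  let ?Y = "wedge (std 1) (std 5) (std 6) + wedge (std 4) (std 2) (std 6) + wedge (std 4) (std 5) (std 3)"
  let ?Z = "wedge (std 4) (std 5) (std 6)"
  \<comment> \<open>\<open>t \<gamma>(t)\<close> is the difference of \<open>(f\<^sub>1 + t f\<^sub>4) \<and> (f\<^sub>2 + t f\<^sub>5) \<and> (f\<^sub>3 + t f\<^sub>6)\<close> and \<open>[123]\<close>\<close>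
  define \<gamma> where "\<gamma> t = ?X + t *s (?Y + t *s ?Z)" for t
  have X: "is_rep 4 ?X" by (rule is_repI[OF basis7_cyc4[OF basis7_std]]) (rule cyc4_rep)
  have "is_rep 5 (\<gamma> t)" if "t \<noteq> 0" for t
  proof (rule is_repI)
    show "basis7 (shear (shear (shear (shear (shear (shear (shear (shear std 1 1 4 t) 2 1 5 t) 3 1 6 t) 4 (- t) 1 1) 5 (- t) 2 1) 6 (- t) 3 1)
       1 (1 / t) 2 0) 4 (- (1 / t)) 2 0)"
      using that by (intro basis7_shear basis7_std) auto
    show "\<gamma> t = wedge_sum (shear (shear (shear (shear (shear (shear (shear (shear std 1 1 4 t) 2 1 5 t) 3 1 6 t) 4 (- t) 1 1) 5 (- t) 2 1) 6 (- t) 3 1)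
       1 (1 / t) 2 0) 4 (- (1 / t)) 2 0) (rep_triples ! 5)"
      using that by (simp add: \<gamma>_def wedge_sum_reps cyc4_def shear_def wedge_expand wedge_order[where f = std])
  qed
  moreover have "(\<gamma> \<longlongrightarrow> ?X) (at 0)"
  proof (rule vec_tendstoI)
    fix i
    have "((\<lambda>t. ?X $ i + t * (?Y $ i + t * ?Z $ i)) \<longlongrightarrow> ?X $ i + 0 * (?Y $ i + 0 * ?Z $ i)) (at 0)"
      by (intro tendsto_intros)
    moreover have "\<gamma> t $ i = ?X $ i + t * (?Y $ i + t * ?Z $ i)" for t
      by (simp only: \<gamma>_def vector_add_component vector_smult_component)
    ultimately show "((\<lambda>t. \<gamma> t $ i) \<longlongrightarrow> ?X $ i) (at 0)"
      by (simp only: mult_zero_left add_0_right)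
  qed
  ultimately have "?X \<in> zcl (orbit_no std 5)" by (intro zcl_limit[of \<gamma>]) (auto simp: orbit_no_iff_is_rep)
  then show ?thesis unfolding degenerates_def using X by (intro orbit_no_subset_zcl) auto
qed

lemma degenerates_36: "degenerates 3 6"
proof (rule degeneratesI[of 3 6 "wedge_sum std (rep_triples ! 3)" "wedge (std 3) (std 5) (std 7)"])
  show "is_rep 3 (wedge_sum std (rep_triples ! 3))" by (rule is_repI[OF basis7_std refl])
  show "is_rep 6 (wedge_sum std (rep_triples ! 3) + t *s wedge (std 3) (std 5) (std 7))" if "t \<noteq> 0" for t
    by (rule is_repI[of "shear (shear std 3 t 1 0) 2 (1 / t) 1 0"])
      (intro basis7_shear basis7_std, use that in \<open>simp_all add: wedge_sum_reps shear_def wedge_expand\<close>)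
qed simp_all

lemma degenerates_46: "degenerates 4 6"
proof (rule degeneratesI[of 4 6 "wedge (std 1) (std 2) (std 3) + wedge (std 1) (std 4) (std 5) + wedge (std 3) (std 5) (std 7)"
    "wedge (std 1) (std 6) (std 7)"])
  show "is_rep 4 (wedge (std 1) (std 2) (std 3) + wedge (std 1) (std 4) (std 5) + wedge (std 3) (std 5) (std 7))"
  proof (rule is_repI)
    show "basis7 (pick [1,3,2,5,4,7,6] (shear (shear std 2 (-1) 1 0) 4 (-1) 1 0))"
      by (intro basis7_pick basis7_shear basis7_std) (auto simp: set7)
  qed (simp add: wedge_sum_reps shear_def wedge_expand wedge_order[where f = std])
  show "is_rep 6 (wedge (std 1) (std 2) (std 3) + wedge (std 1) (std 4) (std 5) + wedge (std 3) (std 5) (std 7)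
      + t *s wedge (std 1) (std 6) (std 7))" if "t \<noteq> 0" for t
    by (rule is_repI[of "shear std 6 t 2 0"])
      (intro basis7_shear basis7_std, use that in \<open>simp_all add: wedge_sum_reps shear_def wedge_expand\<close>)
qed simp_all

lemma degenerates_57: "degenerates 5 7"
proof (rule degeneratesI[of 5 7 "wedge_sum std (rep_triples ! 5)" "wedge (std 1) (std 4) (std 7)"])
  show "is_rep 5 (wedge_sum std (rep_triples ! 5))" by (rule is_repI[OF basis7_std refl])
  show "is_rep 7 (wedge_sum std (rep_triples ! 5) + t *s wedge (std 1) (std 4) (std 7))" if "t \<noteq> 0" for t
    using nf7d_1[OF basis7_std that] by (simp add: nf7d_def wedge_sum_reps)
qed simp_all

lemma degenerates_78: "degenerates 7 8"
proof (rule degeneratesI[of 7 8 "wedge_sum std (rep_triples ! 7)" "wedge (std 2) (std 5) (std 7)"])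
  show "is_rep 7 (wedge_sum std (rep_triples ! 7))" by (rule is_repI[OF basis7_std refl])
  show "is_rep 8 (wedge_sum std (rep_triples ! 7) + t *s wedge (std 2) (std 5) (std 7))" if "t \<noteq> 0" for t
    using nf7d_2[OF basis7_std, of 1 t] that by (simp add: nf7d_def wedge_sum_reps)
qed simp_all

lemma degenerates_89: "degenerates 8 9"
proof (rule degeneratesI[of 8 9 "wedge_sum std (rep_triples ! 8)" "wedge (std 3) (std 6) (std 7)"])
  show "is_rep 8 (wedge_sum std (rep_triples ! 8))" by (rule is_repI[OF basis7_std refl])
  show "is_rep 9 (wedge_sum std (rep_triples ! 8) + t *s wedge (std 3) (std 6) (std 7))" if "t \<noteq> 0" for t
    using nf7d_3[OF basis7_std, of 1 1 t] that by (simp add: nf7d_def wedge_sum_reps)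
qed simp_all

text \<open>
  The first shears are those of \<open>nf4d_2\<close> for \<open>x = 1\<close>, \<open>y = - r\<^sup>2\<close> and \<open>s = 1 / r\<close>. The remaining multiple of
  the new seventh vector \<open>h 7\<close> then has rank one as a matrix between the two triples.
\<close>

lemma nf4d_rep7:
  assumes r: "r \<noteq> 0"
  shows "is_rep 7 (nf4d std 1 (- (r * r)) 0)"
proof -
  define h where "h = pick [3,1,2,6,4,5,7] (shear (shear (shear (shear (shear (shear (shear (shear (shear (shear (shear
     std 7 1 6 (- (1 / r))) 2 1 4 (1 / r)) 2 1 5 1) 1 1 4 1) 1 1 5 r)
     4 (-2) 1 1) 5 (-2) 2 1) 3 1 6 1) 6 2 3 (-1)) 3 (1/2) 1 0) 6 (1/2) 1 0)"
  define g where "g = pick [2,3,1,5,6,4,7] (shear (shear (shear (shear (shear h 1 1 7 (r / 2)) 4 1 7 (r / 2)) 2 1 3 (- r)) 5 1 6 r) 7 (- (1/2)) 1 0)"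
  have h: "basis7 h" unfolding h_def using r by (intro basis7_pick basis7_shear basis7_std) (auto simp: set7)
  have g: "basis7 g" unfolding g_def using h by (intro basis7_pick basis7_shear) (auto simp: set7)
  have h': "h 1 = (1/2) *s (std 3 + std 6)" "h 2 = std 1 + std 4 + r *s std 5" "h 3 = std 2 + (1 / r) *s std 4 + std 5"
    "h 4 = (1/2) *s (std 6 - std 3)" "h 5 = std 1 - std 4 + r *s std 5" "h 6 = std 2 + (1 / r) *s std 4 - std 5"
    "h 7 = std 7 - (1 / r) *s std 6"
    by (simp_all add: h_def shear_def vec_eq_iff algebra_simps)
  have 1: "wedge_sum g (rep_triples ! 7) = wedge (h 1) (h 2) (h 3) + wedge (h 4) (h 5) (h 6)
      + (r / 2) *s wedge (h 7) (h 2) (h 3) + (r / 2) *s wedge (h 7) (h 5) (h 6)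
      - (1/2) *s wedge (h 2 - r *s h 3) (h 5 + r *s h 6) (h 7)"
    by (simp add: g_def wedge_sum_reps shear_def wedge_expand wedge_order[where f = h])
  have "nf4d std 1 (- (r * r)) 0 = wedge_sum g (rep_triples ! 7)"
    unfolding 1 h' using r
    by (simp add: nf4d_def cyc4_def wedge_expand wedge_order[where f = std])
      (simp add: vec_eq_iff field_simps)
  then show ?thesis by (rule is_repI[OF g])
qed

lemma degenerates_67: "degenerates 6 7"
proof -
  let ?X = "nf4d std 1 0 0"
  have X: "is_rep 6 ?X" by (rule nf4d_1[OF basis7_std]) simp
  have eq: "nf4d std 1 (- (r * r)) 0 = ?X + r *s ((- r) *s wedge (std 2) (std 5) (std 7))" for r
    by (simp add: nf4d_def vec_eq_iff)
  have "((\<lambda>r. nf4d std 1 (- (r * r)) 0) \<longlongrightarrow> ?X) (at 0)"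
  proof (rule vec_tendstoI)
    fix i
    have "((\<lambda>r. ?X $ i + r * (- r * wedge (std 2) (std 5) (std 7) $ i)) \<longlongrightarrow> ?X $ i + 0 * (- 0 * wedge (std 2) (std 5) (std 7) $ i)) (at 0)"
      by (intro tendsto_intros)
    moreover have "nf4d std 1 (- (r * r)) 0 $ i = ?X $ i + r * (- r * wedge (std 2) (std 5) (std 7) $ i)" for r
      unfolding eq by (simp only: vector_add_component vector_smult_component)
    ultimately show "((\<lambda>r. nf4d std 1 (- (r * r)) 0 $ i) \<longlongrightarrow> ?X $ i) (at 0)"
      by (simp only: mult_zero_left add_0_right)
  qed
  then have "?X \<in> zcl (orbit_no std 7)"
    using nf4d_rep7 by (intro zcl_limit[of "\<lambda>r. nf4d std 1 (- (r * r)) 0"]) (auto simp: orbit_no_iff_is_rep)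
  then show ?thesis unfolding degenerates_def using X by (intro orbit_no_subset_zcl) auto
qed

section \<open>Orbits outside the closures of larger ones\<close>

definition dot :: "complex ^ 'n::finite \<Rightarrow> complex ^ 'n \<Rightarrow> complex" where
  "dot \<xi> u = (\<Sum>k\<in>UNIV. \<xi> $ k * u $ k)"

lemma dot_lin: "dot (a *s \<xi> + b *s \<eta>) u = a * dot \<xi> u + b * dot \<eta> u"
  by (simp add: dot_def sum.distrib sum_distrib_left distrib_right mult.assoc)

lemma contract_wedge:
  "(\<Sum>k\<in>UNIV. \<xi> $ k * wedge u v w $ (k, r, s)) =
     dot \<xi> u * (v $ r * w $ s - v $ s * w $ r) - dot \<xi> v * (u $ r * w $ s - u $ s * w $ r)
     + dot \<xi> w * (u $ r * v $ s - u $ s * v $ r)"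
proof -
  have "\<xi> $ k * wedge u v w $ (k, r, s) = (\<xi> $ k * u $ k) * (v $ r * w $ s - v $ s * w $ r)
     - (\<xi> $ k * v $ k) * (u $ r * w $ s - u $ s * w $ r) + (\<xi> $ k * w $ k) * (u $ r * v $ s - u $ s * v $ r)" for k
    by (simp add: wedge_nth algebra_simps)
  then show ?thesis unfolding dot_def by (simp add: sum.distrib sum_subtractf sum_distrib_right)
qed

lemma dual_basis7:
  assumes "basis7 f"
  shows "\<exists>\<xi>. \<forall>i\<in>{1..7}. \<forall>j\<in>{1..7}. dot (\<xi> i) (f j) = (if i = j then 1 else 0)"
proof -
  obtain g where g: "invertible g" "\<forall>i\<in>{1..7}. g *v std i = f i" using std_to_basis7[OF assms] by blast
  obtain h where h: "h ** g = mat 1" using g(1) by (auto simp: invertible_def)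
  have "dot (h $ of_nat i) (f j) = (if i = j then 1 else 0)" if "i \<in> {1..7}" "j \<in> {1..7}" for i j
  proof -
    have "h *v f j = std j" using g(2) that h by (metis matrix_vector_mul_assoc matrix_vector_mul_lid)
    moreover have "(h *v f j) $ of_nat i = dot (h $ of_nat i) (f j)"
      by (simp add: dot_def matrix_vector_mult_def)
    ultimately show ?thesis using that std_nth[OF that(2,1)] by metis
  qed
  then show ?thesis by (intro exI[of _ "\<lambda>i. h $ of_nat i"]) blast
qed

lemma det_eq_0_left_kernel:
  fixes A :: "complex ^ 'n ^ 'n::finite"
  assumes "\<xi> \<noteq> 0" "\<And>c. (\<Sum>k\<in>UNIV. \<xi> $ k * A $ k $ c) = 0"
  shows "det A = 0"
proof (rule ccontr)
  assume "det A \<noteq> 0"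
  then have "det (transpose A) \<noteq> 0" by (simp add: det_transpose)
  then have "invertible (transpose A)" by (simp only: invertible_det_nz not_False_eq_True)
  then obtain B where "B ** transpose A = mat 1" unfolding invertible_def by blast
  moreover have "transpose A *v \<xi> = 0"
    using assms(2) by (simp add: vec_eq_iff matrix_vector_mult_def transpose_def mult.commute)
  ultimately have "\<xi> = 0" by (metis matrix_vector_mul_assoc matrix_vector_mul_lid matrix_vector_mult_0_right)
  then show False using assms(1) by simp
qed

definition sum_coeff :: "(nat \<times> nat \<times> nat) list \<Rightarrow> nat \<times> nat \<times> nat \<Rightarrow> int" where
  "sum_coeff S t = (\<Sum>s\<leftarrow>S. wedge_coeff s t)"

lemma sum_coeff:
  assumes "triples7 S" "{l, m, n} \<subseteq> {1..7}"
  shows "wedge_sum std S $ (of_nat l, of_nat m, of_nat n) = of_int (sum_coeff S (l, m, n))"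
  using assms(1)
proof (induction S)
  case (Cons t S)
  obtain i j k where t: "t = (i, j, k)" by (cases t) auto
  have r: "{i, j, k} \<subseteq> {1..7}" using Cons.prems by (simp add: t triples7_def in7_def)
  have "wedge_sum std S $ (of_nat l, of_nat m, of_nat n) = of_int (sum_coeff S (l, m, n))"
    using Cons by (simp add: triples7_def)
  then show ?case using wedge_std_nth[OF r assms(2)]
    by (simp add: t sum_coeff_def triple_ix_def del: wedge_coeff.simps)
qed (simp add: sum_coeff_def)

lemma det_diagonal_nonzero:
  fixes A :: "complex ^ 7 ^ 7"
  assumes "\<And>k c. k \<in> {1..7} \<Longrightarrow> c \<in> {1..7} \<Longrightarrow> k \<noteq> c \<Longrightarrow> A $ of_nat k $ of_nat c = 0"
    and "\<And>k. k \<in> {1..7} \<Longrightarrow> A $ of_nat k $ of_nat k \<noteq> 0"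
  shows "det A \<noteq> 0"
proof -
  have "A $ a $ b = 0" if "a \<noteq> b" for a b
    using assms(1)[OF idx7_range[of a] idx7_range[of b]] that of_nat_idx7 by metis
  then have "det A = (\<Prod>a\<in>UNIV. A $ a $ a)" by (intro det_diagonal) auto
  moreover have "A $ a $ a \<noteq> 0" for a using assms(2)[OF idx7_range[of a]] by (simp add: of_nat_idx7)
  ultimately show ?thesis by simp
qed

text \<open>
  \<open>contraction_minor T\<close> is a \<open>7 \<times> 7\<close> block of the matrix of \<open>\<xi> \<mapsto> \<iota>\<^sub>\<xi> T\<close>; the columns are those for which it
  is diagonal for the third representative.
\<close>

definition contraction_cols :: "nat \<Rightarrow> nat \<times> nat" where
  "contraction_cols c = [(2,3), (1,3), (1,2), (1,5), (1,4), (1,7), (1,6)] ! (c - 1)"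

definition contraction_minor :: "complex ^ (7 \<times> 7 \<times> 7) \<Rightarrow> complex ^ 7 ^ 7" where
  "contraction_minor T = (\<chi> k c. T $ (k, of_nat (fst (contraction_cols (idx7 c))), of_nat (snd (contraction_cols (idx7 c)))))"

lemma contraction_cols_check:
  "\<forall>c\<in>set [1..<8]. in7 (fst (contraction_cols c)) \<and> in7 (snd (contraction_cols c)) \<and> (\<forall>k\<in>set [1..<8].
     (sum_coeff (rep_triples ! 3) (k, fst (contraction_cols c), snd (contraction_cols c)) = 0) = (k \<noteq> c))"
  by code_simp

lemma not_degenerates_35: "\<not> degenerates 3 5"
proof
  assume "degenerates 3 5"
  moreover have "is_rep 3 (wedge_sum std (rep_triples ! 3))" by (rule is_repI[OF basis7_std refl])
  ultimately have cl: "wedge_sum std (rep_triples ! 3) \<in> zcl (orbit_no std 5)"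
    unfolding degenerates_def by (auto simp: orbit_no_iff_is_rep)
  have "det (contraction_minor (wedge_sum std (rep_triples ! 3))) = 0"
  proof (rule zclD[OF cl, where q = "\<lambda>T. det (contraction_minor T)"])
    show "polynomial_fun (\<lambda>T. det (contraction_minor T))"
      unfolding contraction_minor_def by (intro polynomial_fun_det) (simp add: polynomial_fun.coord)
    fix T assume "T \<in> orbit_no std 5"
    then obtain f where f: "basis7 f" "T = wedge (f 1) (f 2) (f 3) + wedge (f 4) (f 5) (f 6)"
      by (auto simp: orbit_no_iff_is_rep is_rep_def wedge_sum_reps)
    obtain \<xi> where x: "\<forall>i\<in>{1..7}. \<forall>j\<in>{1..7}. dot (\<xi> i) (f j) = (if i = j then 1 else 0)"
      using dual_basis7[OF f(1)] by blast
    have z: "dot (\<xi> 7) (f 1) = 0" "dot (\<xi> 7) (f 2) = 0" "dot (\<xi> 7) (f 3) = 0" "dot (\<xi> 7) (f 4) = 0"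
      "dot (\<xi> 7) (f 5) = 0" "dot (\<xi> 7) (f 6) = 0" "dot (\<xi> 7) (f 7) = 1"
      using x by simp_all
    \<comment> \<open>no term of \<open>T\<close> involves \<open>f 7\<close>, so contracting with the last vector of the dual basis gives 0\<close>
    show "det (contraction_minor T) = 0"
    proof (rule det_eq_0_left_kernel[of "\<xi> 7"])
      show "\<xi> 7 \<noteq> 0" using z(7) by (auto simp: dot_def)
      show "(\<Sum>k\<in>UNIV. \<xi> 7 $ k * contraction_minor T $ k $ c) = 0" for c
        unfolding contraction_minor_def vec_lambda_beta f(2) vector_add_component distrib_left sum.distrib contract_wedge z by simp
    qed
  qed
  moreover have "det (contraction_minor (wedge_sum std (rep_triples ! 3))) \<noteq> 0"
  proof (rule det_diagonal_nonzero)
    have S: "triples7 (rep_triples ! 3)" by code_simp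
    have e: "contraction_minor (wedge_sum std (rep_triples ! 3)) $ of_nat k $ of_nat c
        = of_int (sum_coeff (rep_triples ! 3) (k, fst (contraction_cols c), snd (contraction_cols c)))"
      if "k \<in> {1..7}" "c \<in> {1..7}" for k c
      unfolding contraction_minor_def vec_lambda_beta idx7_of_nat[OF that(2)]
      by (rule sum_coeff[OF S]) (use contraction_cols_check that in \<open>auto simp: in7_def\<close>)
    show "contraction_minor (wedge_sum std (rep_triples ! 3)) $ of_nat k $ of_nat c = 0"
      if "k \<in> {1..7}" "c \<in> {1..7}" "k \<noteq> c" for k c
      unfolding e[OF that(1,2)] using contraction_cols_check that by auto
    show "contraction_minor (wedge_sum std (rep_triples ! 3)) $ of_nat k $ of_nat k \<noteq> 0" if "k \<in> {1..7}" for k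
      unfolding e[OF that that] using contraction_cols_check that by auto
  qed
  ultimately show False by simp
qed

text \<open>
  The value of the exterior product of an alternating 2-form and an alternating 3-form, as a sum over the
  (2,3)-shuffles.
\<close>

definition alt5 :: "('a \<Rightarrow> 'a \<Rightarrow> 'b) \<Rightarrow> ('a \<Rightarrow> 'a \<Rightarrow> 'a \<Rightarrow> 'b) \<Rightarrow> 'a \<times> 'a \<times> 'a \<times> 'a \<times> 'a \<Rightarrow> 'b::comm_ring_1" where
  "alt5 B C = (\<lambda>(p, q, r, s, t). B p q * C r s t - B p r * C q s t + B p s * C q r t - B p t * C q r s
     + B q r * C p s t - B q s * C p r t + B q t * C p r s + B r s * C p q t - B r t * C p q s + B s t * C p q r)"

lemma alt5_add: "alt5 B (\<lambda>p q r. C p q r + D p q r) x = alt5 B C x + alt5 B D x"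
  by (cases x) (simp add: alt5_def algebra_simps)

lemma alt5_add_left: "alt5 (\<lambda>p q. A p q + B p q) C x = alt5 A C x + alt5 B C x"
  by (cases x) (simp add: alt5_def algebra_simps)

lemma alt5_scale_left: "alt5 (\<lambda>p q. c * B p q) C x = c * alt5 B C x"
  by (cases x) (simp add: alt5_def algebra_simps)

lemma alt5_sum: "(\<Sum>k\<in>K. c k * alt5 (B k) C x) = alt5 (\<lambda>p q. \<Sum>k\<in>K. c k * B k p q) C x"
proof (induction K rule: infinite_finite_induct)
  case (insert k K)
  then show ?case by (simp add: alt5_add_left alt5_scale_left)
qed (cases x; simp add: alt5_def)+

text \<open>
  The exterior product of two decomposable elements with a common factor vanishes.
\<close>

lemma alt5_wedge_eq_0:
  fixes u v y z :: "complex ^ 'n::finite"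
  shows "alt5 (\<lambda>p q. u $ p * v $ q - u $ q * v $ p) (\<lambda>p q r. wedge u y z $ (p, q, r)) x = 0"
    "alt5 (\<lambda>p q. u $ p * v $ q - u $ q * v $ p) (\<lambda>p q r. wedge v y z $ (p, q, r)) x = 0"
    "alt5 (\<lambda>p q. u $ p * v $ q - u $ q * v $ p) (\<lambda>p q r. wedge y v z $ (p, q, r)) x = 0"
proof -
  obtain p q r s t where x: "x = (p, q, r, s, t)" by (rule prod_cases5)
  show "alt5 (\<lambda>p q. u $ p * v $ q - u $ q * v $ p) (\<lambda>p q r. wedge u y z $ (p, q, r)) x = 0"
    "alt5 (\<lambda>p q. u $ p * v $ q - u $ q * v $ p) (\<lambda>p q r. wedge v y z $ (p, q, r)) x = 0"
    "alt5 (\<lambda>p q. u $ p * v $ q - u $ q * v $ p) (\<lambda>p q r. wedge y v z $ (p, q, r)) x = 0"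
    unfolding alt5_def x prod.case wedge_nth by algebra+
qed

text \<open>
  The first six columns of \<open>contraction_wedge_minor T\<close> belong to \<open>\<xi> \<mapsto> \<iota>\<^sub>\<xi> T \<and> T\<close>, which has rank 6 at the fifth
  representative; the last column is the coordinate \<open>\<xi>\<^sub>7\<close>. A kernel of dimension 2 contains a nonzero
  \<open>\<xi>\<close> with \<open>\<xi>\<^sub>7 = 0\<close> and makes the determinant zero.
\<close>

definition contraction_wedge_cols :: "nat \<Rightarrow> nat \<times> nat \<times> nat \<times> nat \<times> nat" where
  "contraction_wedge_cols c = [(2,3,4,5,6), (1,3,4,5,6), (1,2,4,5,6), (1,2,3,5,6), (1,2,3,4,6), (1,2,3,4,5)] ! (c - 1)"

definition of_nat5 :: "nat \<times> nat \<times> nat \<times> nat \<times> nat \<Rightarrow> 7 \<times> 7 \<times> 7 \<times> 7 \<times> 7" where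
  "of_nat5 = (\<lambda>(p, q, r, s, t). (of_nat p, of_nat q, of_nat r, of_nat s, of_nat t))"

definition contraction_wedge_minor :: "complex ^ (7 \<times> 7 \<times> 7) \<Rightarrow> complex ^ 7 ^ 7" where
  "contraction_wedge_minor T = (\<chi> k c. if idx7 c = 7 then (if idx7 k = 7 then 1 else 0)
     else alt5 (\<lambda>p q. T $ (k, p, q)) (\<lambda>p q r. T $ (p, q, r)) (of_nat5 (contraction_wedge_cols (idx7 c))))"

lemma contraction_wedge_cols_check:
  "\<forall>c\<in>set [1..<7]. (case contraction_wedge_cols c of (p, q, r, s, t) \<Rightarrow> in7 p \<and> in7 q \<and> in7 r \<and> in7 s \<and> in7 t) \<and> (\<forall>k\<in>set [1..<8].
     (alt5 (\<lambda>p q. sum_coeff (rep_triples ! 5) (k, p, q)) (\<lambda>p q r. sum_coeff (rep_triples ! 5) (p, q, r)) (contraction_wedge_cols c) = 0) = (k \<noteq> c))"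
  by code_simp

lemma polynomial_fun_diff: "polynomial_fun p \<Longrightarrow> polynomial_fun q \<Longrightarrow> polynomial_fun (\<lambda>x. p x - q x)"
  using polynomial_fun.add[OF _ polynomial_fun.mult[OF polynomial_fun.const[of "-1"]], of p q] by simp

lemma not_degenerates_56: "\<not> degenerates 5 6"
proof
  assume "degenerates 5 6"
  moreover have "is_rep 5 (wedge_sum std (rep_triples ! 5))" by (rule is_repI[OF basis7_std refl])
  ultimately have cl: "wedge_sum std (rep_triples ! 5) \<in> zcl (orbit_no std 6)"
    unfolding degenerates_def by (auto simp: orbit_no_iff_is_rep)
  have "det (contraction_wedge_minor (wedge_sum std (rep_triples ! 5))) = 0"
  proof (rule zclD[OF cl, where q = "\<lambda>T. det (contraction_wedge_minor T)"])
    show "polynomial_fun (\<lambda>T. det (contraction_wedge_minor T))"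
    proof (rule polynomial_fun_det)
      fix k c :: 7
      obtain p q r s t where "of_nat5 (contraction_wedge_cols (idx7 c)) = (p, q, r, s, t)" by (cases "of_nat5 (contraction_wedge_cols (idx7 c))") auto
      then show "polynomial_fun (\<lambda>T. contraction_wedge_minor T $ k $ c)"
        by (cases "idx7 c = 7") (simp_all add: contraction_wedge_minor_def alt5_def polynomial_fun.const
          polynomial_fun.add polynomial_fun_diff polynomial_fun.mult polynomial_fun.coord)
    qed
    fix T assume "T \<in> orbit_no std 6"
    then obtain f where f: "basis7 f" "T = wedge (f 1) (f 2) (f 3) + wedge (f 1) (f 4) (f 5) + wedge (f 1) (f 6) (f 7) + wedge (f 3) (f 5) (f 7)"
      by (auto simp: orbit_no_iff_is_rep is_rep_def wedge_sum_reps)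
    obtain \<xi> where x: "\<forall>i\<in>{1..7}. \<forall>j\<in>{1..7}. dot (\<xi> i) (f j) = (if i = j then 1 else 0)"
      using dual_basis7[OF f(1)] by blast
    \<comment> \<open>the contractions with \<open>\<xi> 2\<close> and \<open>\<xi> 4\<close> are multiples of \<open>f\<^sub>1 \<and> f\<^sub>3\<close> and \<open>f\<^sub>1 \<and> f\<^sub>5\<close>, and every term of \<open>T\<close>
      shares a factor with each of them\<close>
    obtain a b where ab: "a \<noteq> 0 \<or> b \<noteq> 0" "a * \<xi> 2 $ of_nat 7 + b * \<xi> 4 $ of_nat 7 = 0"
    proof (cases "\<xi> 2 $ of_nat 7 = 0")
      case True
      then show thesis by (intro that[of 1 0]) simp_all
    next
      case False
      then show thesis by (intro that[of "\<xi> 4 $ of_nat 7" "- \<xi> 2 $ of_nat 7"]) simp_all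
    qed
    define \<eta> where "\<eta> = a *s \<xi> 2 + b *s \<xi> 4"
    have z: "dot \<eta> (f 1) = 0" "dot \<eta> (f 2) = a" "dot \<eta> (f 3) = 0" "dot \<eta> (f 4) = b"
      "dot \<eta> (f 5) = 0" "dot \<eta> (f 6) = 0" "dot \<eta> (f 7) = 0"
      using x by (simp_all add: \<eta>_def dot_lin)
    have con: "(\<Sum>k\<in>UNIV. \<eta> $ k * T $ (k, p, q)) = (- a) * (f 1 $ p * f 3 $ q - f 1 $ q * f 3 $ p)
        + (- b) * (f 1 $ p * f 5 $ q - f 1 $ q * f 5 $ p)" for p q
      unfolding f(2) vector_add_component distrib_left sum.distrib contract_wedge z by simp
    show "det (contraction_wedge_minor T) = 0"
    proof (rule det_eq_0_left_kernel[of \<eta>])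
      show "\<eta> \<noteq> 0" using z ab(1) by (auto simp: dot_def)
      show "(\<Sum>k\<in>UNIV. \<eta> $ k * contraction_wedge_minor T $ k $ c) = 0" for c
      proof (cases "idx7 c = 7")
        case True
        have k7: "idx7 k = 7 \<longleftrightarrow> k = of_nat 7" for k
          using of_nat_idx7[of k] idx7_of_nat[of 7] by auto
        have "(\<Sum>k\<in>UNIV. \<eta> $ k * contraction_wedge_minor T $ k $ c) = (\<Sum>k\<in>UNIV. if k = of_nat 7 then \<eta> $ k else 0)"
          using True by (intro sum.cong refl) (auto simp: contraction_wedge_minor_def k7)
        also have "\<dots> = \<eta> $ of_nat 7" by (subst sum.delta) auto
        also have "\<dots> = 0" using ab(2) by (simp add: \<eta>_def)
        finally show ?thesis .
      next
        case False
        then have "(\<Sum>k\<in>UNIV. \<eta> $ k * contraction_wedge_minor T $ k $ c) =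
          alt5 (\<lambda>p q. \<Sum>k\<in>UNIV. \<eta> $ k * T $ (k, p, q)) (\<lambda>p q r. T $ (p, q, r)) (of_nat5 (contraction_wedge_cols (idx7 c)))"
          by (simp add: contraction_wedge_minor_def alt5_sum)
        also have "\<dots> = 0"
          unfolding con alt5_add_left alt5_scale_left unfolding f(2) vector_add_component alt5_add alt5_wedge_eq_0 by simp
        finally show ?thesis .
      qed
    qed
  qed
  moreover have "det (contraction_wedge_minor (wedge_sum std (rep_triples ! 5))) \<noteq> 0"
  proof (rule det_diagonal_nonzero)
    have S: "triples7 (rep_triples ! 5)" by code_simp
    have e: "contraction_wedge_minor (wedge_sum std (rep_triples ! 5)) $ of_nat k $ of_nat c
        = of_int (alt5 (\<lambda>p q. sum_coeff (rep_triples ! 5) (k, p, q)) (\<lambda>p q r. sum_coeff (rep_triples ! 5) (p, q, r)) (contraction_wedge_cols c))"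
      if "k \<in> {1..7}" "c \<in> {1..6}" for k c
    proof -
      obtain p q r s t where c: "contraction_wedge_cols c = (p, q, r, s, t)" by (cases "contraction_wedge_cols c") auto
      have "c \<in> set [1..<7]" using that by auto
      then have "in7 p \<and> in7 q \<and> in7 r \<and> in7 s \<and> in7 t" using contraction_wedge_cols_check c by fastforce
      then have r: "p \<in> {1..7}" "q \<in> {1..7}" "r \<in> {1..7}" "s \<in> {1..7}" "t \<in> {1..7}" by (auto simp: in7_def)
      have i: "idx7 (of_nat c) = c" "c \<noteq> 7" using idx7_of_nat[of c] that by auto
      show ?thesis using r that unfolding contraction_wedge_minor_def vec_lambda_beta i(1) c
        by (simp add: i(2) of_nat5_def alt5_def sum_coeff[OF S])
    qed
    have c7: "contraction_wedge_minor (wedge_sum std (rep_triples ! 5)) $ of_nat k $ of_nat 7 = (if k = 7 then 1 else 0)"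
      if "k \<in> {1..7}" for k
      using idx7_of_nat[of 7] idx7_of_nat[OF that] by (simp add: contraction_wedge_minor_def)
    show "contraction_wedge_minor (wedge_sum std (rep_triples ! 5)) $ of_nat k $ of_nat c = 0"
      if "k \<in> {1..7}" "c \<in> {1..7}" "k \<noteq> c" for k c
    proof (cases "c = 7")
      case True
      then show ?thesis using c7[OF that(1)] that by simp
    next
      case False
      then have c6: "c \<in> {1..6}" using that by auto
      show ?thesis unfolding e[OF that(1) c6] using contraction_wedge_cols_check that c6 by auto
    qed
    show "contraction_wedge_minor (wedge_sum std (rep_triples ! 5)) $ of_nat k $ of_nat k \<noteq> 0" if k: "k \<in> {1..7}" for k
    proof (cases "k = 7")
      case True
      then show ?thesis using c7[OF k] by simp
    next
      case False
      then have k6: "k \<in> {1..6}" using k by auto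
      show ?thesis unfolding e[OF k k6] using contraction_wedge_cols_check k k6 by auto
    qed
  qed
  ultimately show False by simp
qed

section \<open>The ten orbits and their closures\<close>

definition covers :: "(nat \<times> nat) set" where
  "covers = {(0, 1), (1, 2), (2, 3), (2, 4), (4, 5), (3, 6), (4, 6), (5, 7), (6, 7), (7, 8), (8, 9)}"

definition below :: "nat \<Rightarrow> nat \<Rightarrow> bool" where
  "below i j \<longleftrightarrow> i \<le> j \<and> (i, j) \<notin> {(3, 4), (3, 5), (5, 6)}"

lemma covers_below: "(i, j) \<in> covers \<Longrightarrow> i < j \<and> below i j \<and> i \<le> 9 \<and> j \<le> 9"
  by (auto simp: covers_def below_def)

text \<open>
  By these two finite checks on ten elements, \<open>below\<close> is a reflexive relation generated by \<open>covers\<close>, and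
  \<open>covers\<close> are its covering pairs.
\<close>

lemma below_step:
  "\<forall>i\<in>set [0..<10]. \<forall>j\<in>set [0..<10]. below i j \<longrightarrow> i \<noteq> j \<longrightarrow> (\<exists>k\<in>set [0..<10]. (i, k) \<in> covers \<and> below k j)"
  unfolding below_def covers_def by code_simp

lemma covers_iff_below:
  "\<forall>i\<in>set [0..<10]. \<forall>j\<in>set [0..<10]. (i, j) \<in> covers \<longleftrightarrow> below i j \<and> i \<noteq> j \<and>
     \<not> (\<exists>k\<in>set [0..<10]. below i k \<and> i \<noteq> k \<and> below k j \<and> k \<noteq> j)"
  unfolding below_def covers_def by code_simp

lemma below_rtrancl:
  assumes "i \<le> 9" "j \<le> 9" "below i j"
  shows "(i, j) \<in> covers\<^sup>*"
  using assms
proof (induction "j - i" arbitrary: i rule: less_induct)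
  case less
  show ?case
  proof (cases "i = j")
    case False
    have "i \<in> set [0..<10]" "j \<in> set [0..<10]" using less.prems by auto
    from below_step[rule_format, OF this less.prems(3) False]
    obtain k where k: "(i, k) \<in> covers" "below k j" by (elim bexE conjE) (rule that)
    have kj: "k \<le> j" using k(2) unfolding below_def by (rule conjunct1)
    have ik: "i < k" "k \<le> 9" using covers_below[OF k(1)] by simp_all
    have "j - k < j - i" using ik kj by linarith
    then have "(k, j) \<in> covers\<^sup>*" by (rule less.hyps[OF _ ik(2) less.prems(2) k(2)])
    with k(1) show ?thesis by (rule converse_rtrancl_into_rtrancl)
  qed simp
qed

lemma covers_degenerates: "(i, j) \<in> covers \<Longrightarrow> degenerates i j"
  unfolding covers_def
  using degenerates_01 degenerates_12 degenerates_23 degenerates_24 degenerates_45 degenerates_36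
    degenerates_46 degenerates_57 degenerates_67 degenerates_78 degenerates_89
  by auto

lemma rtrancl_degenerates: "(i, j) \<in> covers\<^sup>* \<Longrightarrow> degenerates i j"
proof (induction rule: rtrancl_induct)
  case base
  then show ?case by (simp add: degenerates_def zcl_superset)
next
  case (step y z)
  then show ?case using covers_degenerates degenerates_trans by blast
qed

lemma orbit_dims_le:
  "\<forall>i\<in>set [0..<10]. \<forall>j\<in>set [0..<10]. orbit_dims ! i \<le> orbit_dims ! j \<longrightarrow> i \<le> j"
  by code_simp

lemma degenerates_below:
  assumes "i \<le> 9" "j \<le> 9" "degenerates i j"
  shows "below i j"
proof -
  have "i \<in> set [0..<10]" "j \<in> set [0..<10]" using assms by auto
  moreover have "orbit_dims ! i \<le> orbit_dims ! j"
    using orbit_closure_dim_le assms by (simp add: degenerates_def)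
  ultimately have "i \<le> j" using orbit_dims_le by blast
  moreover have "(i, j) \<noteq> (3, 5)" "(i, j) \<noteq> (5, 6)" using assms(3) not_degenerates_35 not_degenerates_56 by auto
  moreover have "(i, j) \<noteq> (3, 4)" using assms(3) degenerates_trans degenerates_45 not_degenerates_35 by blast
  ultimately show ?thesis by (simp add: below_def)
qed

lemma degenerates_iff_below: "i \<le> 9 \<Longrightarrow> j \<le> 9 \<Longrightarrow> degenerates i j \<longleftrightarrow> below i j"
  using degenerates_below below_rtrancl rtrancl_degenerates by blast

lemma zcl_trivectors: "zcl (trivectors :: (complex ^ ('n::finite \<times> 'n \<times> 'n)) set) = trivectors"
proof
  show "zcl (trivectors :: (complex ^ ('n \<times> 'n \<times> 'n)) set) \<subseteq> trivectors"
  proof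
    fix T :: "complex ^ ('n \<times> 'n \<times> 'n)"
    assume T: "T \<in> zcl trivectors"
    have "T $ (j, i, k) + T $ (i, j, k) = 0" for i j k
      by (rule zclD[OF T, where q = "\<lambda>T. T $ (j, i, k) + T $ (i, j, k)"])
        (auto intro: polynomial_fun.intros simp: trivectorsD(1)[of _ j i k])
    moreover have "T $ (i, k, j) + T $ (i, j, k) = 0" for i j k
      by (rule zclD[OF T, where q = "\<lambda>T. T $ (i, k, j) + T $ (i, j, k)"])
        (auto intro: polynomial_fun.intros simp: trivectorsD(2)[of _ i k j])
    ultimately show "T \<in> trivectors" by (simp add: trivectors_def eq_neg_iff_add_eq_0)
  qed
qed (rule zcl_superset)

lemma orbit_closure_eq:
  assumes "basis7 f" "i \<le> 9"
  shows "orbit_closure f i = zcl (orbit_no std i)"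
proof -
  have s: "orbit_no std i \<subseteq> trivectors" by (rule orbit_no_trivectors[OF assms(2)])
  have "zcl (orbit_no std i) \<subseteq> trivectors" using zcl_mono[OF s] by (simp add: zcl_trivectors)
  then show ?thesis
    using s by (simp add: orbit_closure_def orbit_no_std[OF assms] closure_of_subtopology zariski_closure_of Int_absorb1)
qed

lemma orbit_closure_subset_iff:
  assumes "basis7 f" "i \<le> 9" "j \<le> 9"
  shows "orbit_closure f i \<subseteq> orbit_closure f j \<longleftrightarrow> below i j"
proof -
  have "zcl (orbit_no std i) \<subseteq> zcl (orbit_no std j) \<longleftrightarrow> degenerates i j"
    unfolding degenerates_def using zcl_superset[of "orbit_no std i"] zcl_mono[of "orbit_no std i" "zcl (orbit_no std j)"]
    by (auto simp: zcl_zcl)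
  then show ?thesis using assms by (simp add: orbit_closure_eq degenerates_iff_below)
qed

lemma orbit_eq:
  assumes "R \<in> trivectors" "T \<in> orbit R"
  shows "orbit T = orbit R"
proof -
  obtain g where g: "T = act g R" "invertible g" using assms(2) by (auto simp: orbit_def)
  obtain h where h: "h ** g = mat 1" "g ** h = mat 1" using g(2) by (auto simp: invertible_def)
  have ih: "invertible h" using h unfolding invertible_def by blast
  have T: "act p T = act (p ** g) R" for p by (simp add: g(1) act_act[OF assms(1)])
  have R: "act p R = act (p ** h) T" for p
    unfolding T by (simp add: matrix_mul_assoc[symmetric] h(1))
  show ?thesis
  proof
    show "orbit T \<subseteq> orbit R" unfolding orbit_def T using invertible_mult[OF _ g(2)] by blast
    show "orbit R \<subseteq> orbit T" unfolding orbit_def R using invertible_mult[OF _ ih] by blast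
  qed
qed

lemma bij_betw_orbits: "bij_betw (orbit_no std) {0..9} (orbit ` (trivectors :: (complex ^ (7 \<times> 7 \<times> 7)) set))"
  unfolding bij_betw_def
proof
  show "inj_on (orbit_no std) {0..9}"
  proof (rule inj_onI)
    fix i j :: nat
    assume ij: "i \<in> {0..9}" "j \<in> {0..9}" "orbit_no std i = orbit_no std j"
    then have "degenerates i j" "degenerates j i" by (simp_all add: degenerates_def zcl_superset)
    then have "below i j" "below j i" using ij by (simp_all add: degenerates_below)
    then show "i = j" by (simp add: below_def)
  qed
  show "orbit_no std ` {0..9} = orbit ` (trivectors :: (complex ^ (7 \<times> 7 \<times> 7)) set)"
  proof (intro equalityI subsetI)
    fix X assume "X \<in> orbit_no std ` {0..9}"
    then obtain i where i: "i \<le> 9" "X = orbit_no std i" by auto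
    have "representatives std ! i \<in> trivectors"
      by (simp add: representatives_nth[OF i(1)] wedge_sum_trivectors)
    then show "X \<in> orbit ` trivectors" using i(2) by (simp add: orbit_no_def)
  next
    fix X assume "X \<in> orbit ` (trivectors :: (complex ^ (7 \<times> 7 \<times> 7)) set)"
    then obtain T where T: "T \<in> trivectors" "X = orbit T" by auto
    obtain k where k: "k \<le> 9" "is_rep k T" using trivector_classification[OF T(1)] by blast
    from k have "T \<in> orbit_no std k" by (simp add: orbit_no_iff_is_rep)
    moreover have "representatives std ! k \<in> trivectors"
      by (simp add: representatives_nth[OF k(1)] wedge_sum_trivectors)
    ultimately have "X = orbit_no std k" using T(2) orbit_eq by (simp add: orbit_no_def)
    then show "X \<in> orbit_no std ` {0..9}" using k(1) by auto
  qed
qed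

lemma enat_orbit_dims:
  assumes "i \<le> 9"
  shows "enat (orbit_dims ! i) = [0, 13, 20, 21, 25, 26, 28, 31, 34, 35] ! i"
proof -
  have "i = 0 \<or> i = 1 \<or> i = 2 \<or> i = 3 \<or> i = 4 \<or> i = 5 \<or> i = 6 \<or> i = 7 \<or> i = 8 \<or> i = 9"
    using assms by auto
  then show ?thesis
    unfolding orbit_dims_def by (elim disjE) (simp_all add: numeral_eq_enat zero_enat_def)
qed

theorem mainTheorem3:
  fixes f :: "nat \<Rightarrow> complex ^ 7"
  assumes "basis7 f"
  shows "card (orbit ` (trivectors :: (complex ^ (7 \<times> 7 \<times> 7)) set)) = 10 \<and>
    bij_betw (orbit_no f) {0..9} (orbit ` trivectors) \<and>
    (\<forall>i\<in>{0..9}. krull_dim (subtopology zariski (orbit_no f i))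
       = [0, 13, 20, 21, 25, 26, 28, 31, 34, 35] ! i) \<and>
    (let covers = {(0, 1), (1, 2), (2, 3), (2, 4), (4, 5), (3, 6), (4, 6), (5, 7), (6, 7), (7, 8), (8, 9)}
     in (\<forall>i\<in>{0..9}. \<forall>j\<in>{0..9}.
          (orbit_closure f i \<subseteq> orbit_closure f j \<longleftrightarrow> (i, j) \<in> covers\<^sup>*) \<and>
          ((i, j) \<in> covers \<longleftrightarrow> orbit_closure f i \<subset> orbit_closure f j \<and>
             \<not> (\<exists>k\<in>{0..9}. orbit_closure f i \<subset> orbit_closure f k \<and>
                            orbit_closure f k \<subset> orbit_closure f j))))"
proof -
  have bij: "bij_betw (orbit_no f) {0..9} (orbit ` trivectors)"
    using bij_betw_orbits by (subst bij_betw_cong[of _ _ "orbit_no std"]) (auto simp: orbit_no_std[OF assms])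
  then have card: "card (orbit ` (trivectors :: (complex ^ (7 \<times> 7 \<times> 7)) set)) = 10"
    using bij_betw_same_card[OF bij] by simp
  have dims: "\<forall>i\<in>{0..9}. krull_dim (subtopology zariski (orbit_no f i))
       = [0, 13, 20, 21, 25, 26, 28, 31, 34, 35] ! i"
    using enat_orbit_dims by (simp add: orbit_no_std[OF assms] krull_dim_orbit_no)
  have closures: "\<forall>i\<in>{0..9}. \<forall>j\<in>{0..9}.
          (orbit_closure f i \<subseteq> orbit_closure f j \<longleftrightarrow> (i, j) \<in> covers\<^sup>*) \<and>
          ((i, j) \<in> covers \<longleftrightarrow> orbit_closure f i \<subset> orbit_closure f j \<and>
             \<not> (\<exists>k\<in>{0..9}. orbit_closure f i \<subset> orbit_closure f k \<and>
                            orbit_closure f k \<subset> orbit_closure f j))"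
  proof (intro ballI conjI)
    fix i j :: nat assume ij: "i \<in> {0..9}" "j \<in> {0..9}"
    have sub: "orbit_closure f i \<subseteq> orbit_closure f j \<longleftrightarrow> below i j" if "i \<in> {0..9}" "j \<in> {0..9}" for i j
      using orbit_closure_subset_iff[OF assms] that by simp
    have psub: "orbit_closure f i \<subset> orbit_closure f j \<longleftrightarrow> below i j \<and> i \<noteq> j" if "i \<in> {0..9}" "j \<in> {0..9}" for i j
      unfolding less_le_not_le sub[OF that] sub[OF that(2,1)] by (auto simp: below_def)
    have le: "i \<le> 9" "j \<le> 9" using ij by simp_all
    show "orbit_closure f i \<subseteq> orbit_closure f j \<longleftrightarrow> (i, j) \<in> covers\<^sup>*"
      unfolding sub[OF ij]
      by (rule iffI[OF below_rtrancl[OF le] degenerates_below[OF le rtrancl_degenerates]])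
    have "{0..9::nat} = set [0..<10]" by auto
    from bspec[OF bspec[OF covers_iff_below, folded this, OF ij(1)] ij(2)]
    have "(i, j) \<in> covers \<longleftrightarrow> below i j \<and> i \<noteq> j \<and>
      \<not> (\<exists>k\<in>{0..9}. below i k \<and> i \<noteq> k \<and> below k j \<and> k \<noteq> j)" .
    moreover have "(\<exists>k\<in>{0..9}. orbit_closure f i \<subset> orbit_closure f k \<and> orbit_closure f k \<subset> orbit_closure f j)
      \<longleftrightarrow> (\<exists>k\<in>{0..9}. below i k \<and> i \<noteq> k \<and> below k j \<and> k \<noteq> j)"
      by (rule bex_cong[OF refl]) (simp only: psub ij conj_assoc)
    ultimately show "(i, j) \<in> covers \<longleftrightarrow> orbit_closure f i \<subset> orbit_closure f j \<and>
             \<not> (\<exists>k\<in>{0..9}. orbit_closure f i \<subset> orbit_closure f k \<and>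
                            orbit_closure f k \<subset> orbit_closure f j)"
      unfolding psub[OF ij] by (simp only: conj_assoc)
  qed
  show ?thesis
    unfolding Let_def covers_def[symmetric] by (intro conjI card bij dims closures)
qed

end
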